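(* $$\mathcal{H}_+=\bigcap_{k=1}^\infty H^2\big(\ell_2(\mathfrak{p}^{1/k})\cap B_{\ell_\infty(\mathfrak{p}^{1/k})}\big),$$ where on the intersection the topology of the projective limit is considered and a Dirichlet series $\sum a_nn^{-s}$ is identified with the function $f$ whose monomial coefficients satisfy $c_\alpha(f)=a_n$ whenever $n=\mathfrak{p}^\alpha$.
   Context: $\mathfrak{p}=(\mathfrak{p}_j)_j$ is the sequence of primes; $\mathbb{N}_0^{(\mathbb{N})}$ is the set of finitely supported sequences $\alpha$ of non-negative integers, and $\mathfrak{p}^\alpha=\prod_j\mathfrak{p}_j^{\alpha_j}$. $\mathcal{H}_{+}$ is the space of Dirichlet series $D=\sum a_nn^{-s}$ such that $\|D\|_{2,k}:=\big(\sum_n|a_n|^2n^{-2/k}\big)^{1/2}<\infty$ for every $k\in\mathbb{N}$, with the Fréchet topology given by these seminorms. $\ell_\infty(\mathfrak{p}^{1/k})=\{z\in\mathbb{C}^{\mathbb{N}}:\sup_n|z_n\mathfrak{p}_n^{1/k}|<\infty\}$ with this supremum as norm and open unit ball $B_{\ell_\infty(\mathfrak{p}^{1/k})}$; $\ell_2(\mathfrak{p}^{1/k})=\{z\in\mathbb{C}^{\mathbb{N}}:(\sum_n|z_n\mathfrak{p}_n^{1/k}|^2)^{1/2}<\infty\}$ with this norm. The set $R_k=\ell_2(\mathfrak{p}^{1/k})\cap B_{\ell_\infty(\mathfrak{p}^{1/k})}$ is open in $\ell_2(\mathfrak{p}^{1/k})$. $H^2(R_k)$ is the Banach space of holomorphic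 (Fréchet differentiable) functions $f:R_k\to\mathbb{C}$ with $$\|f\|=\sup_N\ \sup_{0<r_j<\mathfrak{p}_j^{-1/k},\,1\le j\le N}\Big(\int_{\mathbb{T}^N}|f(r_1z_1,\dots,r_Nz_N,0,0,\dots)|^2dz\Big)^{1/2}<\infty,$$ with $dz$ normalized Lebesgue measure on $\mathbb{T}^N$. For $f$ holomorphic on $R_k$ and $\alpha\in\mathbb{N}_0^{(\mathbb{N})}$ supported in the first $N$ coordinates, $c_\alpha(f)$ is the coefficient of $z^\alpha$ in the power series expansion of the restriction of $f$ to $R_k\cap\mathbb{C}^N=\{z\in\mathbb{C}^N:|z_j|<\mathfrak{p}_j^{-1/k}\}$. One has $R_k\subseteq R_{k+1}$, and the intersection is the projective limit along the restriction maps $H^2(R_{k+1})\to H^2(R_k)$: its elements are functions on $\bigcup_kR_k$ whose restriction to each $R_k$ lies in $H^2(R_k)$, with topology given by all the norms of $H^2(R_k)$, $k\in\mathbb{N}$. The equality means that the identification is a linear homeomorphism. *)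

theory Defs
  imports "HOL-Analysis.Analysis" "HOL-Library.Poly_Mapping" "HOL-Library.Infinite_Set"
    "HOL-Computational_Algebra.Primes"
begin

section \<open>Primes and multi-indices\<close>

text \<open>All sequences are indexed from \<open>0\<close>, so \<open>nth_prime 0 = 2\<close>.\<close>

definition nth_prime :: "nat \<Rightarrow> nat" where
  "nth_prime = enumerate {p. prime p}"

definition prime_power :: "(nat \<Rightarrow>\<^sub>0 nat) \<Rightarrow> nat" where
  "prime_power \<alpha> = (\<Prod>j\<in>Poly_Mapping.keys \<alpha>. nth_prime j ^ Poly_Mapping.lookup \<alpha> j)"

definition monomial :: "(nat \<Rightarrow>\<^sub>0 nat) \<Rightarrow> (nat \<Rightarrow> complex) \<Rightarrow> complex" where
  "monomial \<alpha> z = (\<Prod>j\<in>Poly_Mapping.keys \<alpha>. z j ^ Poly_Mapping.lookup \<alpha> j)"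

definition prime_weight :: "nat \<Rightarrow> nat \<Rightarrow> real" where
  "prime_weight k j = real (nth_prime j) powr (1 / real k)"

section \<open>The topology defined by a sequence of seminorms\<close>

text \<open>The seminorms are indexed by \<open>k = 1, 2, \<dots>\<close>; linear operations on complex-valued functions
  are pointwise.\<close>

definition seminorm_topology ::
    "('x \<Rightarrow> complex) set \<Rightarrow> (nat \<Rightarrow> ('x \<Rightarrow> complex) \<Rightarrow> real) \<Rightarrow> ('x \<Rightarrow> complex) topology" where
  "seminorm_topology V p = topology_generated_by
     {{g \<in> V. p k (\<lambda>x. g x - f x) < \<epsilon>} | k f \<epsilon>. 1 \<le> k \<and> f \<in> V \<and> 0 < \<epsilon>}"

lemma topspace_seminorm_topology:
  assumes "p 1 (\<lambda>x. 0) = 0"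
  shows "topspace (seminorm_topology V p) = V"
proof -
  let ?B = "{{g \<in> V. p k (\<lambda>x. g x - f x) < \<epsilon>} | k f \<epsilon>. 1 \<le> k \<and> f \<in> V \<and> 0 < \<epsilon>}"
  have "f \<in> \<Union>?B" if "f \<in> V" for f
  proof (rule UnionI)
    show "{g \<in> V. p 1 (\<lambda>x. g x - f x) < 1} \<in> ?B"
      using that zero_less_one order_refl by blast
    show "f \<in> {g \<in> V. p 1 (\<lambda>x. g x - f x) < 1}"
      using that assms by simp
  qed
  moreover have "\<Union>?B \<subseteq> V" by blast
  ultimately show ?thesis
    unfolding seminorm_topology_def topology_generated_by_topspace by blast
qed

section \<open>The space of Dirichlet series\<close>

text \<open>A Dirichlet series \<open>\<Sum>n\<ge>1. a n * n powr (-s)\<close> is represented by its coefficient sequence,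
  normalised by \<open>a 0 = 0\<close>.\<close>

definition dirichlet_norm :: "nat \<Rightarrow> (nat \<Rightarrow> complex) \<Rightarrow> real" where
  "dirichlet_norm k a = sqrt (suminf (\<lambda>n. (cmod (a n))\<^sup>2 * real n powr (- 2 / real k)))"

definition H_plus :: "(nat \<Rightarrow> complex) set" where
  "H_plus = {a. a 0 = 0 \<and> (\<forall>k\<ge>1. summable (\<lambda>n. (cmod (a n))\<^sup>2 * real n powr (- 2 / real k)))}"

definition H_plus_topology :: "(nat \<Rightarrow> complex) topology" where
  "H_plus_topology = seminorm_topology H_plus dirichlet_norm"

lemma topspace_H_plus_topology: "topspace H_plus_topology = H_plus"
  unfolding H_plus_topology_def by (rule topspace_seminorm_topology) (simp add: dirichlet_norm_def)

section \<open>Weighted sequence spaces\<close>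

definition ell2 :: "nat \<Rightarrow> (nat \<Rightarrow> complex) set" where
  "ell2 k = {z. summable (\<lambda>j. (cmod (z j * of_real (prime_weight k j)))\<^sup>2)}"

definition ell2_norm :: "nat \<Rightarrow> (nat \<Rightarrow> complex) \<Rightarrow> real" where
  "ell2_norm k z = sqrt (suminf (\<lambda>j. (cmod (z j * of_real (prime_weight k j)))\<^sup>2))"

definition ell_infty :: "nat \<Rightarrow> (nat \<Rightarrow> complex) set" where
  "ell_infty k = {z. bdd_above (range (\<lambda>j. cmod (z j * of_real (prime_weight k j))))}"

definition ell_infty_norm :: "nat \<Rightarrow> (nat \<Rightarrow> complex) \<Rightarrow> real" where
  "ell_infty_norm k z = (SUP j. cmod (z j * of_real (prime_weight k j)))"

definition R_dom :: "nat \<Rightarrow> (nat \<Rightarrow> complex) set" where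
  "R_dom k = ell2 k \<inter> {z \<in> ell_infty k. ell_infty_norm k z < 1}"

section \<open>Holomorphic functions on \<open>R_dom k\<close>\<close>

definition bounded_linear_functional :: "nat \<Rightarrow> ((nat \<Rightarrow> complex) \<Rightarrow> complex) \<Rightarrow> bool" where
  "bounded_linear_functional k L \<longleftrightarrow>
     (\<forall>g\<in>ell2 k. \<forall>h\<in>ell2 k. L (\<lambda>j. g j + h j) = L g + L h) \<and>
     (\<forall>c. \<forall>h\<in>ell2 k. L (\<lambda>j. c * h j) = c * L h) \<and>
     (\<exists>C. \<forall>h\<in>ell2 k. cmod (L h) \<le> C * ell2_norm k h)"

definition frechet_differentiable_at ::
    "nat \<Rightarrow> ((nat \<Rightarrow> complex) \<Rightarrow> complex) \<Rightarrow> (nat \<Rightarrow> complex) \<Rightarrow> bool" where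
  "frechet_differentiable_at k f z \<longleftrightarrow>
     (\<exists>L. bounded_linear_functional k L \<and>
       (\<forall>\<epsilon>>0. \<exists>\<delta>>0. \<forall>h\<in>ell2 k. (\<lambda>j. z j + h j) \<in> R_dom k \<and> ell2_norm k h < \<delta> \<longrightarrow>
          cmod (f (\<lambda>j. z j + h j) - f z - L h) \<le> \<epsilon> * ell2_norm k h))"

definition holomorphic_on_R :: "nat \<Rightarrow> ((nat \<Rightarrow> complex) \<Rightarrow> complex) \<Rightarrow> bool" where
  "holomorphic_on_R k f \<longleftrightarrow> (\<forall>z\<in>R_dom k. frechet_differentiable_at k f z)"

text \<open>The points of \<open>R_dom k\<close> supported in the first \<open>N\<close> coordinates, a polydisc in
  \<open>N\<close> complex variables.\<close>

definition polydisc :: "nat \<Rightarrow> nat \<Rightarrow> (nat \<Rightarrow> complex) set" where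
  "polydisc k N = {z. (\<forall>j<N. cmod (z j) < 1 / prime_weight k j) \<and> (\<forall>j\<ge>N. z j = 0)}"

definition power_series_expansion ::
    "nat \<Rightarrow> nat \<Rightarrow> ((nat \<Rightarrow> complex) \<Rightarrow> complex) \<Rightarrow> ((nat \<Rightarrow>\<^sub>0 nat) \<Rightarrow> complex) \<Rightarrow> bool" where
  "power_series_expansion k N f c \<longleftrightarrow>
     (\<forall>z\<in>polydisc k N. ((\<lambda>\<alpha>. c \<alpha> * monomial \<alpha> z) has_sum f z) {\<alpha>. Poly_Mapping.keys \<alpha> \<subseteq> {..<N}})"

text \<open>For holomorphic \<open>f\<close> the value is independent of the choice of \<open>N\<close>.\<close>

definition monomial_coeff ::
    "nat \<Rightarrow> ((nat \<Rightarrow> complex) \<Rightarrow> complex) \<Rightarrow> (nat \<Rightarrow>\<^sub>0 nat) \<Rightarrow> complex" where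
  "monomial_coeff k f \<alpha> =
     (THE w. \<exists>N c. Poly_Mapping.keys \<alpha> \<subseteq> {..<N} \<and> power_series_expansion k N f c \<and> c \<alpha> = w)"

section \<open>The Hardy spaces and their projective limit\<close>

text \<open>Normalised Lebesgue measure on the \<open>N\<close>-torus, in the angular coordinates
  \<open>z j = cis (t j)\<close> with \<open>0 \<le> t j < 2 * pi\<close>.\<close>

definition torus_measure :: "nat \<Rightarrow> (nat \<Rightarrow> real) measure" where
  "torus_measure N = PiM {..<N} (\<lambda>_. uniform_measure lborel {0..<2 * pi})"

definition torus_point :: "nat \<Rightarrow> (nat \<Rightarrow> real) \<Rightarrow> (nat \<Rightarrow> real) \<Rightarrow> nat \<Rightarrow> complex" where
  "torus_point N r t = (\<lambda>j. if j < N then of_real (r j) * cis (t j) else 0)"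

definition torus_mean :: "nat \<Rightarrow> (nat \<Rightarrow> real) \<Rightarrow> ((nat \<Rightarrow> complex) \<Rightarrow> complex) \<Rightarrow> real" where
  "torus_mean N r f = sqrt (LINT t|torus_measure N. (cmod (f (torus_point N r t)))\<^sup>2)"

definition torus_means :: "nat \<Rightarrow> ((nat \<Rightarrow> complex) \<Rightarrow> complex) \<Rightarrow> real set" where
  "torus_means k f =
     {torus_mean N r f | N r. 1 \<le> N \<and> (\<forall>j<N. 0 < r j \<and> r j < 1 / prime_weight k j)}"

definition H2_norm :: "nat \<Rightarrow> ((nat \<Rightarrow> complex) \<Rightarrow> complex) \<Rightarrow> real" where
  "H2_norm k f = Sup (torus_means k f)"

text \<open>A function on a subset is represented by its extension by \<open>undefined\<close>.\<close>

definition H2 :: "nat \<Rightarrow> ((nat \<Rightarrow> complex) \<Rightarrow> complex) set" where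
  "H2 k = {f \<in> extensional (R_dom k). holomorphic_on_R k f \<and> bdd_above (torus_means k f)}"

definition R_union :: "(nat \<Rightarrow> complex) set" where
  "R_union = (\<Union>k\<in>{1..}. R_dom k)"

definition H2_limit :: "((nat \<Rightarrow> complex) \<Rightarrow> complex) set" where
  "H2_limit = {f \<in> extensional R_union. \<forall>k\<ge>1. restrict f (R_dom k) \<in> H2 k}"

definition H2_limit_topology :: "((nat \<Rightarrow> complex) \<Rightarrow> complex) topology" where
  "H2_limit_topology = seminorm_topology H2_limit (\<lambda>k f. H2_norm k (restrict f (R_dom k)))"

lemma prime_weight_pos: "0 < prime_weight k j"
proof -
  have "prime (nth_prime j)"
    unfolding nth_prime_def using enumerate_in_set[OF primes_infinite] by auto
  then show ?thesis
    unfolding prime_weight_def using prime_gt_0_nat by simp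
qed

lemma torus_point_in_R_dom:
  assumes "\<forall>j<N. 0 < r j \<and> r j < 1 / prime_weight k j"
  shows "torus_point N r t \<in> R_dom k"
proof -
  let ?g = "\<lambda>j. cmod (torus_point N r t j * of_real (prime_weight k j))"
  have g: "?g j = (if j < N then r j * prime_weight k j else 0)" for j
  proof (cases "j < N")
    case True
    then have "0 < r j" using assms by blast
    with True prime_weight_pos[of k j] show ?thesis
      by (simp add: torus_point_def norm_mult)
  qed (simp add: torus_point_def)
  have lt1: "?g j < 1" for j
  proof (cases "j < N")
    case True
    then have "r j < 1 / prime_weight k j" using assms by blast
    with True prime_weight_pos[of k j] show ?thesis
      unfolding g by (simp add: pos_less_divide_eq)
  qed (simp add: g)
  have "summable (\<lambda>j. (?g j)\<^sup>2)"
    by (rule summable_finite[of "{..<N}"]) (simp_all add: g)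
  moreover have fin: "finite (range ?g)"
  proof (rule finite_subset)
    show "range ?g \<subseteq> insert 0 (?g ` {..<N})"
    proof
      fix x assume "x \<in> range ?g"
      then obtain j where j: "x = ?g j" by blast
      show "x \<in> insert 0 (?g ` {..<N})"
      proof (cases "j < N")
        case True
        with j show ?thesis by blast
      next
        case False
        with j g[of j] show ?thesis by simp
      qed
    qed
  qed simp
  moreover have "(SUP j. ?g j) < 1"
  proof -
    have "Max (range ?g) \<in> range ?g" using fin by (intro Max_in) simp_all
    then obtain j where "Max (range ?g) = ?g j" by blast
    moreover have "(SUP j. ?g j) = Max (range ?g)" using fin by (intro cSup_eq_Max) simp_all
    ultimately show ?thesis using lt1[of j] by simp
  qed
  ultimately show ?thesis
    unfolding R_dom_def ell2_def ell_infty_def ell_infty_norm_def Int_iff mem_Collect_eq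
    by (intro conjI bdd_above_finite)
qed

lemma topspace_H2_limit_topology: "topspace H2_limit_topology = H2_limit"
proof -
  let ?o = "restrict (\<lambda>_. 0) (R_dom 1) :: (nat \<Rightarrow> complex) \<Rightarrow> complex"
  have zero: "torus_mean N r ?o = 0"
    if "\<forall>j<N. 0 < r j \<and> r j < 1 / prime_weight 1 j" for N r
    using torus_point_in_R_dom[OF that] by (simp add: torus_mean_def)
  have r: "\<forall>j<1. 0 < 1 / (2 * prime_weight 1 j) \<and> 1 / (2 * prime_weight 1 j) < 1 / prime_weight 1 j"
    using prime_weight_pos[of 1] by (simp add: field_simps)
  have "torus_means 1 ?o = {0}"
  proof
    show "torus_means 1 ?o \<subseteq> {0}"
      unfolding torus_means_def using zero by blast
    have "torus_mean 1 (\<lambda>j. 1 / (2 * prime_weight 1 j)) ?o \<in> torus_means 1 ?o"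
      unfolding torus_means_def using r order_refl[of "1::nat"] by blast
    then show "{0} \<subseteq> torus_means 1 ?o"
      using zero[OF r] by simp
  qed
  then show ?thesis
    unfolding H2_limit_topology_def
    by (intro topspace_seminorm_topology) (simp add: H2_norm_def)
qed

end

theory Submission
  imports Defs "HOL-Complex_Analysis.Cauchy_Integral_Formula" "HOL-Probability.Infinite_Product_Measure"
begin

text \<open>
  Put \<open>c \<alpha> = a (prime_power \<alpha>)\<close>. By Cauchy--Schwarz, \<open>\<Sum> c \<alpha> z\<^sup>\<alpha>\<close> converges on
  \<open>R_dom k\<close> as soon as \<open>\<Sum> \<bar>c \<alpha>\<bar>\<^sup>2 n powr (-2/k) < \<infinity>\<close> for \<open>n = prime_power \<alpha>\<close>, since
  \<open>\<Sum> n powr (2/k) \<bar>z\<^sup>\<alpha>\<bar>\<^sup>2 = \<Prod> 1 / (1 - (prime_weight k j \<bar>z j\<bar>)\<^sup>2)\<close> is finite there, locally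
  uniformly. Conversely, a function in \<open>H2 k\<close> has monomial coefficients by Cauchy's formula on
  finite-dimensional polydiscs, Parseval's identity on the torus identifies \<open>H2_norm k\<close> with
  \<open>dirichlet_norm k\<close>, and the function is determined by its values at finitely supported points,
  which are dense in \<open>R_dom k\<close>. So the identification is isometric for every \<open>k\<close>.
\<close>

section \<open>Monomials and prime powers\<close>

text \<open>The two conditions defining \<open>R_dom k\<close> have separate tasks. The supremum
  bound supplies one s < 1 with \<open>cmod (z j) * prime_weight k j \<le> s\<close> for all j, so
  every factor of the product stays bounded; square summability makes the infinite product finite.
  Both survive a small perturbation in \<open>ell2 k\<close>, and this is how differentiability is
  obtained: the remainder of each monomial is dominated by the same monomial at a slightly larger
  point, times the square of the relative size of the increment, so the Cauchy-Schwarz bound applies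
  to the remainders as well.

  Infinite sums and torus integrals are never interchanged directly. A finite partial sum is
  integrated termwise, and the error is at most a constant times the tail of a numerical series
  independent of the angles.

  The limit space adds one difficulty: a single coefficient family must serve all k. The polydiscs
  of \<open>R_dom 1\<close> lie in those of every \<open>R_dom k\<close>, so uniqueness of
  expansions there forces the families to agree. Once every seminorm is preserved exactly,
  continuity in both directions is a comparison of balls.\<close>

abbreviation indices_below :: "nat \<Rightarrow> (nat \<Rightarrow>\<^sub>0 nat) set" where
  "indices_below N \<equiv> {\<alpha>. Poly_Mapping.keys \<alpha> \<subseteq> {..<N}}"

text \<open>Polymorphic in the values, so that the same rules serve primes in the naturals, real
  radii and complex points.\<close>

definition mpow :: "(nat \<Rightarrow>\<^sub>0 nat) \<Rightarrow> (nat \<Rightarrow> 'a::comm_monoid_mult) \<Rightarrow> 'a" where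
  "mpow \<alpha> x = (\<Prod>j\<in>Poly_Mapping.keys \<alpha>. x j ^ Poly_Mapping.lookup \<alpha> j)"

lemma monomial_eq_mpow: "monomial = mpow"
  by (simp add: monomial_def mpow_def fun_eq_iff)

lemma prime_power_eq_mpow: "prime_power \<alpha> = mpow \<alpha> nth_prime"
  by (simp add: prime_power_def mpow_def)

lemma mpow_superset:
  assumes "finite A" "Poly_Mapping.keys \<alpha> \<subseteq> A"
  shows "mpow \<alpha> x = (\<Prod>j\<in>A. x j ^ Poly_Mapping.lookup \<alpha> j)"
  unfolding mpow_def using assms by (intro prod.mono_neutral_left) (auto simp: in_keys_iff)

lemma mpow_0 [simp]: "mpow 0 x = 1"
  by (simp add: mpow_def)

lemma mpow_single [simp]: "mpow (Poly_Mapping.single j n) x = x j ^ n"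
  by (simp add: mpow_def)

lemma mpow_add: "mpow (\<alpha> + \<beta>) x = mpow \<alpha> x * mpow \<beta> x"
proof -
  let ?A = "Poly_Mapping.keys \<alpha> \<union> Poly_Mapping.keys \<beta>"
  have "mpow (\<alpha> + \<beta>) x = (\<Prod>j\<in>?A. x j ^ Poly_Mapping.lookup (\<alpha> + \<beta>) j)"
    by (rule mpow_superset) (simp_all add: Poly_Mapping.keys_add)
  moreover have "mpow \<alpha> x = (\<Prod>j\<in>?A. x j ^ Poly_Mapping.lookup \<alpha> j)"
    by (rule mpow_superset) auto
  moreover have "mpow \<beta> x = (\<Prod>j\<in>?A. x j ^ Poly_Mapping.lookup \<beta> j)"
    by (rule mpow_superset) auto
  ultimately show ?thesis by (simp add: lookup_add power_add prod.distrib)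
qed

lemma mpow_mult: "mpow \<alpha> (\<lambda>j. x j * y j) = mpow \<alpha> x * mpow \<alpha> y"
  by (simp add: mpow_def power_mult_distrib prod.distrib)

lemma norm_mpow:
  fixes x :: "nat \<Rightarrow> 'a::real_normed_field"
  shows "norm (mpow \<alpha> x) = mpow \<alpha> (\<lambda>j. norm (x j))"
  by (simp add: mpow_def prod_norm [symmetric] norm_power)

lemma of_real_mpow:
  "of_real (mpow \<alpha> x) = (mpow \<alpha> (\<lambda>j. of_real (x j)) :: 'a::real_normed_field)"
  by (simp add: mpow_def)

lemma mpow_nonneg: "(\<And>j. 0 \<le> x j) \<Longrightarrow> 0 \<le> (mpow \<alpha> x :: real)"
  by (simp add: mpow_def prod_nonneg)

lemma mpow_pos: "(\<And>j. 0 < x j) \<Longrightarrow> 0 < (mpow \<alpha> x :: real)"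
  by (simp add: mpow_def prod_pos)

lemma mpow_mono:
  fixes x y :: "nat \<Rightarrow> real"
  assumes "\<And>j. 0 \<le> x j" "\<And>j. x j \<le> y j"
  shows "mpow \<alpha> x \<le> mpow \<alpha> y"
  unfolding mpow_def using assms by (intro prod_mono conjI power_mono) auto

lemma mpow_cong: "(\<And>j. j \<in> Poly_Mapping.keys \<alpha> \<Longrightarrow> x j = y j) \<Longrightarrow> mpow \<alpha> x = mpow \<alpha> y"
  by (simp add: mpow_def)

text \<open>A key at or beyond N contributes a positive power of zero. This reduces sums over all
  multi-indices to \<open>indices_below N\<close> at points with finite support.\<close>

lemma mpow_eq_0:
  fixes x :: "nat \<Rightarrow> 'a::idom"
  assumes "\<alpha> \<notin> indices_below N" "\<And>j. j \<ge> N \<Longrightarrow> x j = 0"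
  shows "mpow \<alpha> x = 0"
proof -
  from assms(1) obtain j where "j \<in> Poly_Mapping.keys \<alpha>" "j \<ge> N"
    by (auto simp: subset_iff not_less)
  then show ?thesis
    unfolding mpow_def using assms(2)
    by (intro prod_zero) (auto simp: in_keys_iff power_0_left intro!: bexI[of _ j])
qed

text \<open>Induction on the total degree: a nonzero multi-index loses one unit at any of its keys.
  Raising one exponent by one multiplies the monomial by one variable, so inductive steps become
  product rules.\<close>

lemma multi_index_induct [case_names 0 add]:
  fixes P :: "(nat \<Rightarrow>\<^sub>0 nat) \<Rightarrow> bool"
  assumes "P 0" "\<And>\<alpha> j. P \<alpha> \<Longrightarrow> P (\<alpha> + Poly_Mapping.single j 1)"
  shows "P \<alpha>"
proof (induction "\<Sum>j\<in>Poly_Mapping.keys \<alpha>. Poly_Mapping.lookup \<alpha> j" arbitrary: \<alpha> rule: less_induct)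
  case less
  show ?case
  proof (cases "\<alpha> = 0")
    case False
    then obtain i where i: "i \<in> Poly_Mapping.keys \<alpha>"
      by fastforce
    define \<beta> where "\<beta> = \<alpha> - Poly_Mapping.single i 1"
    have lb: "Poly_Mapping.lookup \<beta> j = Poly_Mapping.lookup \<alpha> j - (if j = i then 1 else 0)" for j
      by (auto simp: \<beta>_def lookup_minus lookup_single when_def)
    have pos: "Poly_Mapping.lookup \<alpha> i > 0"
      using i by (simp add: in_keys_iff)
    have \<alpha>: "\<alpha> = \<beta> + Poly_Mapping.single i 1"
      by (rule poly_mapping_eqI) (use pos in \<open>auto simp: lookup_add lb lookup_single when_def\<close>)
    have keys: "Poly_Mapping.keys \<beta> \<subseteq> Poly_Mapping.keys \<alpha>"
      using pos by (auto simp: in_keys_iff lb split: if_splits)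
    have "(\<Sum>j\<in>Poly_Mapping.keys \<beta>. Poly_Mapping.lookup \<beta> j)
        \<le> (\<Sum>j\<in>Poly_Mapping.keys \<alpha>. Poly_Mapping.lookup \<beta> j)"
      by (rule sum_mono2) (use keys in auto)
    also have "\<dots> < (\<Sum>j\<in>Poly_Mapping.keys \<alpha>. Poly_Mapping.lookup \<alpha> j)"
      by (rule sum_strict_mono_ex1) (use i pos in \<open>auto simp: lb intro!: bexI[of _ i]\<close>)
    finally have "P \<beta>" by (rule less)
    then show ?thesis using assms(2) \<alpha> by metis
  qed (use assms(1) in simp)
qed

section \<open>Prime factorisation as a bijection between multi-indices and positive
  integers\<close>

lemma bij_nth_prime: "bij_betw nth_prime UNIV {p. prime p}"
  unfolding nth_prime_def by (rule bij_enumerate) (rule primes_infinite)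

lemma prime_nth_prime: "prime (nth_prime j)"
  using bij_nth_prime by (auto simp: bij_betw_def)

lemma inj_nth_prime: "inj nth_prime"
  using bij_nth_prime by (auto simp: bij_betw_def)

lemma prime_power_pos: "prime_power \<alpha> > 0"
  unfolding prime_power_def
  by (intro prod_pos) (use prime_gt_0_nat[OF prime_nth_prime] in auto)

lemma mpow_prime_weight: "mpow \<alpha> (prime_weight k) = real (prime_power \<alpha>) powr (1 / real k)"
proof (induction \<alpha> rule: multi_index_induct)
  case 0
  show ?case by (simp add: prime_power_eq_mpow)
next
  case (add \<alpha> j)
  then show ?case
    by (simp add: mpow_add prime_power_eq_mpow powr_mult prime_weight_def)
qed

lemma mpow_prime_weight_sq:
  "(mpow \<alpha> (prime_weight k))\<^sup>2 = inverse (real (prime_power \<alpha>) powr (- 2 / real k))"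
proof -
  have "(mpow \<alpha> (prime_weight k))\<^sup>2 = real (prime_power \<alpha>) powr (2 * (1 / real k))"
    unfolding mpow_prime_weight power2_eq_square
    by (simp add: powr_add [symmetric] add_divide_distrib [symmetric])
  then show ?thesis by (simp add: powr_minus)
qed

lemma multiplicity_prime_power:
  "multiplicity (nth_prime j) (prime_power \<alpha>) = Poly_Mapping.lookup \<alpha> j"
proof (induction \<alpha> rule: multi_index_induct)
  case 0
  show ?case by (simp add: prime_power_eq_mpow)
next
  case (add \<alpha> i)
  have "prime_power (\<alpha> + Poly_Mapping.single i 1) = prime_power \<alpha> * nth_prime i"
    by (simp add: prime_power_eq_mpow mpow_add)
  also have "multiplicity (nth_prime j) \<dots> =
      multiplicity (nth_prime j) (prime_power \<alpha>) + multiplicity (nth_prime j) (nth_prime i)"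
    using prime_power_pos[of \<alpha>] prime_nth_prime prime_gt_0_nat[OF prime_nth_prime[of i]]
    by (intro prime_elem_multiplicity_mult_distrib) auto
  also have "multiplicity (nth_prime j) (nth_prime i) = (if i = j then 1 else 0)"
    using prime_nth_prime[of j] prime_nth_prime[of i] injD[OF inj_nth_prime, of i j]
      prime_multiplicity_other[of "nth_prime j" "nth_prime i"] prime_gt_1_nat[of "nth_prime j"]
    by (cases "i = j") (simp, metis)
  finally show ?case using add by (auto simp: lookup_add lookup_single when_def)
qed

text \<open>Unique factorisation. Injectivity holds because the exponents are recovered as
  multiplicities; surjectivity is an induction over prime divisors in which each new prime raises
  one exponent.\<close>

lemma bij_prime_power: "bij_betw prime_power UNIV {0<..}"
proof (rule bij_betwI')
  show "(prime_power \<alpha> = prime_power \<beta>) = (\<alpha> = \<beta>)" for \<alpha> \<beta>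
    by (metis multiplicity_prime_power poly_mapping_eqI)
  show "prime_power \<alpha> \<in> {0<..}" for \<alpha>
    using prime_power_pos by simp
  show "\<exists>\<alpha>\<in>UNIV. n = prime_power \<alpha>" if "n \<in> {0<..}" for n
  proof -
    have "n > 0" using that by simp
    then have "\<exists>\<alpha>. n = prime_power \<alpha>"
    proof (induction n rule: prime_divisors_induct)
      case (unit n)
      then have "n = prime_power 0" by (simp add: prime_power_eq_mpow)
      then show ?case ..
    next
      case (factor p n)
      then obtain \<alpha> where "n = prime_power \<alpha>" by auto
      moreover obtain j where "p = nth_prime j"
        using factor(1) bij_nth_prime by (auto simp: bij_betw_def)
      ultimately have "p * n = prime_power (\<alpha> + Poly_Mapping.single j 1)"
        by (simp add: prime_power_eq_mpow mpow_add)
      then show ?case ..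
    qed simp
    then show ?thesis by blast
  qed
qed

text \<open>Induction on the number of variables: a multi-index below \<open>Suc N\<close> is one
  below N together with the exponent of variable N, so the series factors into the N-variable series
  and a geometric series. Absolute summability is carried along because it justifies summing over
  the product set.\<close>

lemma geometric_multi_series:
  fixes x :: "nat \<Rightarrow> 'a::{banach, real_normed_field}"
  assumes "\<And>j. j < N \<Longrightarrow> norm (x j) < 1"
  shows "(\<lambda>\<alpha>. norm (mpow \<alpha> x)) summable_on indices_below N"
    and "((\<lambda>\<alpha>. mpow \<alpha> x) has_sum (\<Prod>j<N. 1 / (1 - x j))) (indices_below N)"
proof -
  have "(\<lambda>\<alpha>. norm (mpow \<alpha> x)) summable_on indices_below N \<and>
    ((\<lambda>\<alpha>. mpow \<alpha> x) has_sum (\<Prod>j<N. 1 / (1 - x j))) (indices_below N)"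
    using assms
  proof (induction N)
    case 0
    have "indices_below 0 = {0}" by auto
    then show ?case by (simp add: has_sum_finite_iff)
  next
    case (Suc N)
    define h :: "(nat \<Rightarrow>\<^sub>0 nat) \<times> nat \<Rightarrow> (nat \<Rightarrow>\<^sub>0 nat)" where "h = (\<lambda>(\<alpha>, i). \<alpha> + Poly_Mapping.single N i)"
    define g :: "(nat \<Rightarrow>\<^sub>0 nat) \<times> nat \<Rightarrow> 'a" where "g = (\<lambda>(\<alpha>, i). mpow \<alpha> x * x N ^ i)"
    have bij: "bij_betw h (indices_below N \<times> UNIV) (indices_below (Suc N))"
    \<comment> \<open>The inverse splits off the exponent at N; updating it to 0 deletes that
      key.\<close>
    proof (rule bij_betwI[where g = "\<lambda>\<alpha>. (Poly_Mapping.update N 0 \<alpha>, Poly_Mapping.lookup \<alpha> N)"])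
      show "h \<in> indices_below N \<times> UNIV \<rightarrow> indices_below (Suc N)"
      proof
        fix z :: "(nat \<Rightarrow>\<^sub>0 nat) \<times> nat"
        assume z: "z \<in> indices_below N \<times> UNIV"
        obtain \<alpha> i where "z = (\<alpha>, i)" by force
        with z show "h z \<in> indices_below (Suc N)"
          using Poly_Mapping.keys_add[of \<alpha> "Poly_Mapping.single N i"]
          by (auto simp: h_def split: if_splits)
      qed
      show "(\<lambda>\<alpha>. (Poly_Mapping.update N 0 \<alpha>, Poly_Mapping.lookup \<alpha> N))
          \<in> indices_below (Suc N) \<rightarrow> indices_below N \<times> UNIV"
        by (auto simp: keys_update)
      show "(Poly_Mapping.update N 0 (h z), Poly_Mapping.lookup (h z) N) = z"
        if "z \<in> indices_below N \<times> UNIV" for z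
      proof -
        obtain \<alpha> i where z: "z = (\<alpha>, i)" by force
        have 0: "Poly_Mapping.lookup \<alpha> N = 0"
          using that z by (auto simp: in_keys_iff subset_iff)
        then have "Poly_Mapping.update N 0 (h z) = \<alpha>"
          by (intro poly_mapping_eqI) (auto simp: z h_def lookup_update lookup_add lookup_single when_def)
        then show ?thesis using 0 by (simp add: z h_def lookup_add)
      qed
      show "h (Poly_Mapping.update N 0 \<alpha>, Poly_Mapping.lookup \<alpha> N) = \<alpha>" for \<alpha>
        by (rule poly_mapping_eqI) (auto simp: h_def lookup_update lookup_add lookup_single when_def)
    qed
    have gh: "mpow (h z) x = g z" for z
      by (cases z) (simp add: g_def h_def mpow_add)
    have xN: "norm (x N) < 1" using Suc.prems by simp
    have IH: "(\<lambda>\<alpha>. norm (mpow \<alpha> x)) summable_on indices_below N"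
      "((\<lambda>\<alpha>. mpow \<alpha> x) has_sum (\<Prod>j<N. 1 / (1 - x j))) (indices_below N)"
      using Suc by auto
    have geo: "((\<lambda>i. x N ^ i) has_sum (1 / (1 - x N))) UNIV"
      using xN by (intro norm_summable_imp_has_sum geometric_sums) (simp add: norm_power summable_geometric)
    have geon: "((\<lambda>i. norm (x N) ^ i) has_sum (1 / (1 - norm (x N)))) UNIV"
      using xN by (intro norm_summable_imp_has_sum geometric_sums) (simp_all add: norm_power summable_geometric)
    have geoa: "((\<lambda>i. norm (g (\<alpha>, i))) has_sum (norm (mpow \<alpha> x) * (1 / (1 - norm (x N))))) UNIV" for \<alpha>
      using has_sum_cmult_right[OF geon, of "norm (mpow \<alpha> x)"] by (simp add: g_def norm_mult norm_power)
    have "(\<lambda>z. norm (g z)) summable_on indices_below N \<times> UNIV"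
    proof (rule iffD2[OF Infinite_Sum.abs_summable_on_Sigma_iff [where f = g]], intro conjI ballI)
      show "(\<lambda>i. norm (g (\<alpha>, i))) summable_on UNIV" for \<alpha>
        using geoa by (rule has_sum_imp_summable)
      have "(\<lambda>\<alpha>. norm (mpow \<alpha> x) * (1 / (1 - norm (x N)))) summable_on indices_below N"
        using IH(1) by (rule summable_on_cmult_left)
      then show "(\<lambda>\<alpha>. norm (\<Sum>\<^sub>\<infinity>i. norm (g (\<alpha>, i)))) summable_on indices_below N"
        unfolding infsumI[OF geoa] by (rule summable_on_iff_abs_summable_on_real [THEN iffD1])
    qed
    note abs = this
    have "(g has_sum (\<Prod>j<N. 1 / (1 - x j)) * (1 / (1 - x N))) (indices_below N \<times> UNIV)"
    proof (rule has_sum_SigmaI)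
      show "((\<lambda>i. g (\<alpha>, i)) has_sum mpow \<alpha> x * (1 / (1 - x N))) UNIV" for \<alpha>
        using has_sum_cmult_right[OF geo, of "mpow \<alpha> x"] by (simp add: g_def)
      show "((\<lambda>\<alpha>. mpow \<alpha> x * (1 / (1 - x N))) has_sum (\<Prod>j<N. 1 / (1 - x j)) * (1 / (1 - x N)))
          (indices_below N)"
        using IH(2) by (rule has_sum_cmult_left)
      show "g summable_on indices_below N \<times> UNIV"
        using abs by (rule abs_summable_summable)
    qed
    moreover have "((\<lambda>z. mpow (h z) x) has_sum S) (indices_below N \<times> UNIV) \<longleftrightarrow>
        ((\<lambda>\<alpha>. mpow \<alpha> x) has_sum S) (indices_below (Suc N))" for S
      by (rule has_sum_reindex_bij_betw[OF bij])
    moreover have "(\<lambda>z. norm (mpow (h z) x)) summable_on (indices_below N \<times> UNIV) \<longleftrightarrow>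
        (\<lambda>\<alpha>. norm (mpow \<alpha> x)) summable_on (indices_below (Suc N))"
      by (rule summable_on_reindex_bij_betw[OF bij])
    ultimately show ?case using abs by (simp add: gh lessThan_Suc)
  qed
  then show "(\<lambda>\<alpha>. norm (mpow \<alpha> x)) summable_on indices_below N"
    and "((\<lambda>\<alpha>. mpow \<alpha> x) has_sum (\<Prod>j<N. 1 / (1 - x j))) (indices_below N)"
    by blast+
qed

section \<open>Differentiability of power series\<close>

text \<open>Turns estimates over finite sets, the form in which Cauchy-Schwarz and the majorants
  deliver them, into statements about infinite sums.\<close>

lemma bounded_finite_sums:
  fixes g :: "'a \<Rightarrow> 'b::banach"
  assumes "\<And>F. finite F \<Longrightarrow> F \<subseteq> A \<Longrightarrow> (\<Sum>x\<in>F. norm (g x)) \<le> K"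
  shows "(\<lambda>x. norm (g x)) summable_on A" "norm (infsum g A) \<le> K"
proof -
  show s: "(\<lambda>x. norm (g x)) summable_on A"
    by (rule nonneg_bdd_above_summable_on) (use assms in \<open>auto intro!: bdd_aboveI[of _ K]\<close>)
  have "norm (infsum g A) \<le> (\<Sum>\<^sub>\<infinity>x\<in>A. norm (g x))"
    by (rule norm_infsum_bound[OF s])
  also have "\<dots> \<le> K"
    by (rule infsum_le_finite_sums[OF s]) (use assms in auto)
  finally show "norm (infsum g A) \<le> K" .
qed

lemma finite_multi_indices_below:
  assumes "finite F"
  obtains N where "N \<ge> 1" "F \<subseteq> indices_below N"
proof -
  have "finite (\<Union>\<alpha>\<in>F. Poly_Mapping.keys \<alpha>)" using assms by simp
  then obtain N where "(\<Union>\<alpha>\<in>F. Poly_Mapping.keys \<alpha>) \<subseteq> {..<N}"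
    using finite_nat_iff_bounded by metis
  \<comment> \<open>Passing to \<open>Suc N\<close> secures N \<ge> 1, since
    \<open>torus_means\<close> admits only tori of positive dimension.\<close>
  then have "F \<subseteq> indices_below (Suc N)" by force
  then show ?thesis using that[of "Suc N"] by simp
qed

text \<open>The squares are monomials at the points \<open>(y j)\<^sup>2\<close>, so a finite sum is
  at most a finite product of geometric series. The bound s keeps the denominators away from zero,
  and 1 + x \<le> exp x turns the product into the exponential of a sum. The result depends on y
  only through s and B, not on the number of variables.\<close>

lemma sum_mpow_sq_le:
  fixes y :: "nat \<Rightarrow> real"
  assumes y: "\<And>j. 0 \<le> y j" "\<And>j. y j \<le> s" and s: "s < 1"
    and B: "\<And>N. (\<Sum>j<N. (y j)\<^sup>2) \<le> B" and F: "finite F"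
  shows "(\<Sum>\<alpha>\<in>F. (mpow \<alpha> y)\<^sup>2) \<le> exp (B / (1 - s\<^sup>2))"
proof -
  obtain N where N: "F \<subseteq> indices_below N"
    using finite_multi_indices_below[OF F] by blast
  have s0: "0 \<le> s" using y[of 0] by linarith
  have s2: "s\<^sup>2 < 1" using s s0 by (simp add: power_less_one_iff)
  have ys: "(y j)\<^sup>2 \<le> s\<^sup>2" for j using y by (intro power_mono) auto
  have geo: "((\<lambda>\<alpha>. mpow \<alpha> (\<lambda>j. (y j)\<^sup>2)) has_sum (\<Prod>j<N. 1 / (1 - (y j)\<^sup>2))) (indices_below N)"
    by (rule geometric_multi_series) (use ys s2 le_less_trans in auto)
  have "(\<Sum>\<alpha>\<in>F. (mpow \<alpha> y)\<^sup>2) = (\<Sum>\<alpha>\<in>F. mpow \<alpha> (\<lambda>j. (y j)\<^sup>2))"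
    by (simp add: power2_eq_square mpow_mult)
  also have "\<dots> \<le> (\<Prod>j<N. 1 / (1 - (y j)\<^sup>2))"
    using geo F N by (intro finite_sum_le_has_sum[OF geo]) (auto intro: mpow_nonneg)
  also have "\<dots> \<le> (\<Prod>j<N. exp ((y j)\<^sup>2 / (1 - s\<^sup>2)))"
  proof (intro prod_mono conjI)
    fix j
    have u: "(y j)\<^sup>2 < 1" using ys s2 le_less_trans by blast
    then show "0 \<le> 1 / (1 - (y j)\<^sup>2)" by simp
    have "1 / (1 - (y j)\<^sup>2) = 1 + (y j)\<^sup>2 / (1 - (y j)\<^sup>2)"
      using u by (simp add: field_simps)
    also have "\<dots> \<le> 1 + (y j)\<^sup>2 / (1 - s\<^sup>2)"
      using u s2 ys[of j] by (intro add_left_mono divide_left_mono mult_pos_pos) auto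
    also have "\<dots> \<le> exp ((y j)\<^sup>2 / (1 - s\<^sup>2))" by (rule exp_ge_add_one_self)
    finally show "1 / (1 - (y j)\<^sup>2) \<le> exp ((y j)\<^sup>2 / (1 - s\<^sup>2))" .
  qed
  also have "\<dots> = exp ((\<Sum>j<N. (y j)\<^sup>2) / (1 - s\<^sup>2))"
    by (simp add: exp_sum sum_divide_distrib)
  also have "\<dots> \<le> exp (B / (1 - s\<^sup>2))"
    using B[of N] s2 by (simp add: divide_right_mono)
  finally show ?thesis .
qed

text \<open>Dividing by \<open>mpow \<alpha> (prime_weight k)\<close> is multiplying by the monomial
  at the limiting radii of the polydisc, so these are the coefficients whose Parseval sum stays
  finite up to the boundary.\<close>

definition hardy_coeffs :: "nat \<Rightarrow> ((nat \<Rightarrow>\<^sub>0 nat) \<Rightarrow> complex) \<Rightarrow> bool" where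
  "hardy_coeffs k c \<longleftrightarrow> (\<lambda>\<alpha>. (norm (c \<alpha>) / mpow \<alpha> (prime_weight k))\<^sup>2) summable_on UNIV"

text \<open>The weight is divided out of c and multiplied into x; Cauchy-Schwarz then separates a
  factor depending only on c from one controlled by \<open>sum_mpow_sq_le\<close>.\<close>

lemma sum_coeff_mpow_le:
  assumes c: "hardy_coeffs k c"
    and x: "\<And>j. 0 \<le> x j" "\<And>j. x j * prime_weight k j \<le> s" and s: "s < 1"
    and B: "\<And>N. (\<Sum>j<N. (x j * prime_weight k j)\<^sup>2) \<le> B" and F: "finite F"
  shows "(\<Sum>\<alpha>\<in>F. norm (c \<alpha>) * mpow \<alpha> x) \<le>
    sqrt (\<Sum>\<^sub>\<infinity>\<alpha>. (norm (c \<alpha>) / mpow \<alpha> (prime_weight k))\<^sup>2) * sqrt (exp (B / (1 - s\<^sup>2)))"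
proof -
  let ?w = "\<lambda>\<alpha>. mpow \<alpha> (prime_weight k)"
  have w: "?w \<alpha> > 0" for \<alpha> by (rule mpow_pos) (rule prime_weight_pos)
  have "(\<Sum>\<alpha>\<in>F. norm (c \<alpha>) * mpow \<alpha> x) =
      (\<Sum>\<alpha>\<in>F. \<bar>norm (c \<alpha>) / ?w \<alpha>\<bar> * \<bar>mpow \<alpha> (\<lambda>j. x j * prime_weight k j)\<bar>)"
  proof (rule sum.cong)
    fix \<alpha>
    show "norm (c \<alpha>) * mpow \<alpha> x = \<bar>norm (c \<alpha>) / ?w \<alpha>\<bar> * \<bar>mpow \<alpha> (\<lambda>j. x j * prime_weight k j)\<bar>"
      using w[of \<alpha>] mpow_nonneg[of x \<alpha>] x(1) by (simp add: mpow_mult abs_mult)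
  qed simp
  also have "\<dots> \<le> L2_set (\<lambda>\<alpha>. norm (c \<alpha>) / ?w \<alpha>) F * L2_set (\<lambda>\<alpha>. mpow \<alpha> (\<lambda>j. x j * prime_weight k j)) F"
    by (rule L2_set_mult_ineq)
  also have "\<dots> \<le> sqrt (\<Sum>\<^sub>\<infinity>\<alpha>. (norm (c \<alpha>) / ?w \<alpha>)\<^sup>2) * sqrt (exp (B / (1 - s\<^sup>2)))"
  proof (intro mult_mono)
    show "L2_set (\<lambda>\<alpha>. norm (c \<alpha>) / ?w \<alpha>) F \<le> sqrt (\<Sum>\<^sub>\<infinity>\<alpha>. (norm (c \<alpha>) / ?w \<alpha>)\<^sup>2)"
      unfolding L2_set_def
      by (intro real_sqrt_le_mono finite_sum_le_infsum) (use c F in \<open>auto simp: hardy_coeffs_def\<close>)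
    show "L2_set (\<lambda>\<alpha>. mpow \<alpha> (\<lambda>j. x j * prime_weight k j)) F \<le> sqrt (exp (B / (1 - s\<^sup>2)))"
      unfolding L2_set_def
      by (intro real_sqrt_le_mono sum_mpow_sq_le)
        (use x s B F less_imp_le[OF prime_weight_pos] in auto)
  qed (auto intro!: infsum_nonneg)
  finally show ?thesis .
qed

section \<open>Weighted sequence spaces and their domain\<close>

lemma ell2_iff: "z \<in> ell2 k \<longleftrightarrow> summable (\<lambda>j. (cmod (z j) * prime_weight k j)\<^sup>2)"
  by (simp add: ell2_def norm_mult abs_of_pos[OF prime_weight_pos])

lemma ell2_norm_sq:
  assumes "z \<in> ell2 k"
  shows "(ell2_norm k z)\<^sup>2 = suminf (\<lambda>j. (cmod (z j) * prime_weight k j)\<^sup>2)"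
  using assms unfolding ell2_norm_def ell2_iff
  by (simp add: norm_mult abs_of_pos[OF prime_weight_pos] suminf_nonneg)

lemma ell2_norm_nonneg: "z \<in> ell2 k \<Longrightarrow> 0 \<le> ell2_norm k z"
  by (simp add: ell2_norm_def ell2_def suminf_nonneg)

lemma ell2_sum_le:
  assumes "z \<in> ell2 k"
  shows "(\<Sum>j<N. (cmod (z j) * prime_weight k j)\<^sup>2) \<le> (ell2_norm k z)\<^sup>2"
  using assms unfolding ell2_norm_sq[OF assms] ell2_iff by (intro sum_le_suminf) auto

lemma coordinate_le_ell2_norm:
  assumes "z \<in> ell2 k"
  shows "cmod (z j) * prime_weight k j \<le> ell2_norm k z"
proof (rule power2_le_imp_le)
  have "(cmod (z j) * prime_weight k j)\<^sup>2 \<le> (\<Sum>j<Suc j. (cmod (z j) * prime_weight k j)\<^sup>2)"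
    by (rule member_le_sum) auto
  also have "\<dots> \<le> (ell2_norm k z)\<^sup>2" by (rule ell2_sum_le[OF assms])
  finally show "(cmod (z j) * prime_weight k j)\<^sup>2 \<le> (ell2_norm k z)\<^sup>2" .
qed (rule ell2_norm_nonneg[OF assms])

text \<open>Trades the supremum norm for a witness s, the form in which the bound enters the
  geometric series estimates.\<close>

lemma R_dom_iff:
  "z \<in> R_dom k \<longleftrightarrow> z \<in> ell2 k \<and> (\<exists>s<1. \<forall>j. cmod (z j) * prime_weight k j \<le> s)"
proof
  let ?g = "\<lambda>j. cmod (z j * of_real (prime_weight k j))"
  have g: "?g j = cmod (z j) * prime_weight k j" for j
    by (simp add: norm_mult abs_of_pos[OF prime_weight_pos])
  {
    assume z: "z \<in> R_dom k"
    have "?g j \<le> ell_infty_norm k z" for j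
      unfolding ell_infty_norm_def
      by (rule cSUP_upper) (use z in \<open>auto simp: R_dom_def ell_infty_def\<close>)
    with z show "z \<in> ell2 k \<and> (\<exists>s<1. \<forall>j. cmod (z j) * prime_weight k j \<le> s)"
      unfolding g by (auto simp: R_dom_def)
  }
  {
    assume z: "z \<in> ell2 k \<and> (\<exists>s<1. \<forall>j. cmod (z j) * prime_weight k j \<le> s)"
    then obtain s where s: "s < 1" "\<And>j. ?g j \<le> s" by (auto simp: g)
    have "ell_infty_norm k z \<le> s"
      unfolding ell_infty_norm_def by (rule cSUP_least) (use s in auto)
    then show "z \<in> R_dom k"
      using z s by (auto simp: R_dom_def ell_infty_def intro!: bdd_aboveI[of _ s])
  }
qed

lemma ell2_add:
  assumes "g \<in> ell2 k" "h \<in> ell2 k"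
  shows "(\<lambda>j. g j + h j) \<in> ell2 k"
proof -
  have b: "norm ((cmod (g j + h j) * prime_weight k j)\<^sup>2) \<le>
      2 * (cmod (g j) * prime_weight k j)\<^sup>2 + 2 * (cmod (h j) * prime_weight k j)\<^sup>2" for j
  proof -
    have "(cmod (g j + h j) * prime_weight k j)\<^sup>2 \<le>
        (cmod (g j) * prime_weight k j + cmod (h j) * prime_weight k j)\<^sup>2"
      unfolding distrib_right[symmetric] using prime_weight_pos[of k j]
      by (intro power_mono mult_right_mono norm_triangle_ineq) auto
    also have "\<dots> \<le> 2 * (cmod (g j) * prime_weight k j)\<^sup>2 + 2 * (cmod (h j) * prime_weight k j)\<^sup>2"
      using sum_squares_bound[of "cmod (g j) * prime_weight k j" "cmod (h j) * prime_weight k j"]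
      by (simp add: power2_sum)
    finally show ?thesis by simp
  qed
  have s: "summable (\<lambda>j. 2 * (cmod (g j) * prime_weight k j)\<^sup>2 + 2 * (cmod (h j) * prime_weight k j)\<^sup>2)"
    using summable_add [OF summable_mult [OF assms(1) [unfolded ell2_iff], of 2]
        summable_mult [OF assms(2) [unfolded ell2_iff], of 2]] .
  show ?thesis
    unfolding ell2_iff by (rule summable_comparison_test'[OF s]) (rule b)
qed

text \<open>
  \<open>D\<close> is the derivative of the monomial at \<open>z\<close>. Majorising by the monomial at \<open>\<bar>z\<bar> + y\<close>, where
  \<open>\<bar>h\<bar> \<le> t y\<close>, yields bounds with explicit factors \<open>t\<close> and \<open>t\<^sup>2\<close>, so they can be summed over \<open>\<alpha>\<close>.
\<close>

definition monomial_derivative ::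
    "(nat \<Rightarrow> complex) \<Rightarrow> (nat \<Rightarrow>\<^sub>0 nat) \<Rightarrow> ((nat \<Rightarrow> complex) \<Rightarrow> complex) \<Rightarrow> bool" where
  "monomial_derivative z \<alpha> D \<longleftrightarrow>
    (\<forall>g h. D (\<lambda>j. g j + h j) = D g + D h) \<and> (\<forall>a h. D (\<lambda>j. a * h j) = a * D h) \<and>
    (\<forall>h y t. 0 \<le> t \<longrightarrow> (\<forall>j. 0 \<le> y j \<and> cmod (h j) \<le> t * y j) \<longrightarrow>
      cmod (D h) \<le> t * mpow \<alpha> (\<lambda>j. cmod (z j) + y j) \<and>
      (t \<le> 1 \<longrightarrow> cmod (mpow \<alpha> (\<lambda>j. z j + h j) - mpow \<alpha> z) \<le> t * mpow \<alpha> (\<lambda>j. cmod (z j) + y j) \<and>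
        cmod (mpow \<alpha> (\<lambda>j. z j + h j) - mpow \<alpha> z - D h) \<le> t\<^sup>2 * mpow \<alpha> (\<lambda>j. cmod (z j) + y j)))"

lemma monomial_derivativeD:
  assumes "monomial_derivative z \<alpha> D"
  shows "D (\<lambda>j. g j + h j) = D g + D h"
    and "D (\<lambda>j. a * h j) = a * D h"
    and "0 \<le> t \<Longrightarrow> (\<And>j. 0 \<le> y j \<and> cmod (h j) \<le> t * y j) \<Longrightarrow>
      cmod (D h) \<le> t * mpow \<alpha> (\<lambda>j. cmod (z j) + y j)"
    and "0 \<le> t \<Longrightarrow> (\<And>j. 0 \<le> y j \<and> cmod (h j) \<le> t * y j) \<Longrightarrow> t \<le> 1 \<Longrightarrow>
      cmod (mpow \<alpha> (\<lambda>j. z j + h j) - mpow \<alpha> z) \<le> t * mpow \<alpha> (\<lambda>j. cmod (z j) + y j)"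
    and "0 \<le> t \<Longrightarrow> (\<And>j. 0 \<le> y j \<and> cmod (h j) \<le> t * y j) \<Longrightarrow> t \<le> 1 \<Longrightarrow>
      cmod (mpow \<alpha> (\<lambda>j. z j + h j) - mpow \<alpha> z - D h) \<le> t\<^sup>2 * mpow \<alpha> (\<lambda>j. cmod (z j) + y j)"
  using assms unfolding monomial_derivative_def by simp_all

text \<open>Product rule along \<open>multi_index_induct\<close>. The new variable i multiplies the
  majorant by \<open>cmod (z i) + y i\<close>: the first summand carries the old bound, the second
  the new increment. The new remainder is z i times the old remainder plus h i times the increment
  of the old monomial; the latter is a product of two first-order quantities, hence of order t^2.
  This is why the first-order bound on the increment belongs to the induction.\<close>

lemma ex_monomial_derivative: "\<exists>D. monomial_derivative z \<alpha> D"
proof (induction \<alpha> rule: multi_index_induct)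
  case 0
  show ?case by (rule exI[of _ "\<lambda>_. 0"], unfold monomial_derivative_def, intro conjI allI impI) simp_all
next
  case (add \<alpha> i)
  then obtain D where "monomial_derivative z \<alpha> D" by blast
  note D = monomial_derivativeD [OF this]
  define D' where "D' h = h i * mpow \<alpha> z + z i * D h" for h
  show ?case
  proof (rule exI[of _ D'], unfold monomial_derivative_def, intro conjI allI impI)
    show "D' (\<lambda>j. g j + h j) = D' g + D' h" for g h
      by (simp add: D'_def D(1,2) algebra_simps)
    show "D' (\<lambda>j. a * h j) = a * D' h" for a h
      by (simp add: D'_def D(1,2) algebra_simps)
    fix h :: "nat \<Rightarrow> complex" and y :: "nat \<Rightarrow> real" and t :: real
    assume t: "0 \<le> t" and y: "\<forall>j. 0 \<le> y j \<and> cmod (h j) \<le> t * y j"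
    let ?M = "mpow \<alpha> (\<lambda>j. cmod (z j) + y j)"
    have M: "0 \<le> ?M" using y by (intro mpow_nonneg) auto
    have mz: "cmod (mpow \<alpha> z) \<le> ?M"
      unfolding norm_mpow using y by (intro mpow_mono) auto
    have y': "0 \<le> y j \<and> cmod (h j) \<le> t * y j" for j using y by blast
    note b = D(3-5) [OF t, of y h, OF y']
    have hi: "cmod (h i) \<le> t * y i" "0 \<le> y i" using y by auto
    have "cmod (D' h) \<le> cmod (h i) * cmod (mpow \<alpha> z) + cmod (z i) * cmod (D h)"
      unfolding D'_def by (rule norm_triangle_le) (simp add: norm_mult)
    also have "\<dots> \<le> (t * y i) * ?M + cmod (z i) * (t * ?M)"
      using b hi mz t M by (intro add_mono mult_mono) auto
    finally show "cmod (D' h) \<le> t * mpow (\<alpha> + Poly_Mapping.single i 1) (\<lambda>j. cmod (z j) + y j)"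
      by (simp add: mpow_add algebra_simps)
    assume t1: "t \<le> 1"
    let ?\<Delta> = "mpow \<alpha> (\<lambda>j. z j + h j) - mpow \<alpha> z"
    \<comment> \<open>Here t \<le> 1 enters: the displaced point z + h stays under the majorising
      point.\<close>
    have hy: "cmod (h j) \<le> y j" for j
      using y t1 t mult_left_le_one_le[of "y j" t] by (meson order_trans)
    have mzh: "cmod (mpow \<alpha> (\<lambda>j. z j + h j)) \<le> ?M"
      unfolding norm_mpow using hy by (intro mpow_mono) (auto intro!: norm_triangle_le)
    have "mpow (\<alpha> + Poly_Mapping.single i 1) (\<lambda>j. z j + h j) - mpow (\<alpha> + Poly_Mapping.single i 1) z =
        z i * ?\<Delta> + h i * mpow \<alpha> (\<lambda>j. z j + h j)"
      by (simp add: mpow_add algebra_simps)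
    also have "cmod \<dots> \<le> cmod (z i) * cmod ?\<Delta> + cmod (h i) * cmod (mpow \<alpha> (\<lambda>j. z j + h j))"
      by (rule norm_triangle_le) (simp add: norm_mult)
    also have "\<dots> \<le> cmod (z i) * (t * ?M) + (t * y i) * ?M"
      using b t1 hi mzh t M by (intro add_mono mult_mono) auto
    finally show "cmod (mpow (\<alpha> + Poly_Mapping.single i 1) (\<lambda>j. z j + h j) -
        mpow (\<alpha> + Poly_Mapping.single i 1) z) \<le>
        t * mpow (\<alpha> + Poly_Mapping.single i 1) (\<lambda>j. cmod (z j) + y j)"
      by (simp add: mpow_add algebra_simps)
    have "mpow (\<alpha> + Poly_Mapping.single i 1) (\<lambda>j. z j + h j) - mpow (\<alpha> + Poly_Mapping.single i 1) z - D' h =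
        z i * (?\<Delta> - D h) + h i * ?\<Delta>"
      by (simp add: D'_def mpow_add algebra_simps)
    also have "cmod \<dots> \<le> cmod (z i) * cmod (?\<Delta> - D h) + cmod (h i) * cmod ?\<Delta>"
      by (rule norm_triangle_le) (simp add: norm_mult)
    also have "\<dots> \<le> cmod (z i) * (t\<^sup>2 * ?M) + (t * y i) * (t * ?M)"
      using b t1 hi t M by (intro add_mono mult_mono) auto
    finally show "cmod (mpow (\<alpha> + Poly_Mapping.single i 1) (\<lambda>j. z j + h j) -
        mpow (\<alpha> + Poly_Mapping.single i 1) z - D' h) \<le>
        t\<^sup>2 * mpow (\<alpha> + Poly_Mapping.single i 1) (\<lambda>j. cmod (z j) + y j)"
      by (simp add: mpow_add algebra_simps power2_eq_square)
  qed
qed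

section \<open>Convergence and differentiability of the full power series\<close>

definition power_series :: "((nat \<Rightarrow>\<^sub>0 nat) \<Rightarrow> complex) \<Rightarrow> (nat \<Rightarrow> complex) \<Rightarrow> complex" where
  "power_series c z = (\<Sum>\<^sub>\<infinity>\<alpha>. c \<alpha> * mpow \<alpha> z)"

text \<open>One constant K serves a whole \<open>ell2 k\<close> ball around z. The norm of
  \<open>ell2 k\<close> dominates every weighted coordinate, so adding y raises the uniform bound
  from s to at most s + \<rho> and keeps the square sum bounded.\<close>

lemma power_series_majorant:
  assumes c: "hardy_coeffs k c" and z: "z \<in> R_dom k"
  shows "\<exists>\<rho> K. 0 < \<rho> \<and> 0 \<le> K \<and>
    (\<forall>h\<in>ell2 k. ell2_norm k h \<le> \<rho> \<longrightarrow> (\<lambda>j. z j + h j) \<in> R_dom k) \<and>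
    (\<forall>y\<in>ell2 k. ell2_norm k y \<le> \<rho> \<longrightarrow> (\<forall>F. finite F \<longrightarrow>
       (\<Sum>\<alpha>\<in>F. cmod (c \<alpha>) * mpow \<alpha> (\<lambda>j. cmod (z j) + cmod (y j))) \<le> K))"
proof -
  obtain s where s: "s < 1" "\<And>j. cmod (z j) * prime_weight k j \<le> s" and z2: "z \<in> ell2 k"
    using z unfolding R_dom_iff by blast
  \<comment> \<open>Half of the gap between s and 1, so that s + \<rho> is still below 1.\<close>
  define \<rho> where "\<rho> = (1 - s) / 2"
  \<comment> \<open>From (a + b)^2 \<le> 2 a^2 + 2 b^2, applied in each coordinate.\<close>
  define B where "B = 2 * (ell2_norm k z)\<^sup>2 + 2 * \<rho>\<^sup>2"
  have \<rho>: "0 < \<rho>" "s + \<rho> < 1" using s by (auto simp: \<rho>_def field_simps)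
  have le: "(cmod (z j) + cmod (h j)) * prime_weight k j \<le> s + \<rho>"
    if "h \<in> ell2 k" "ell2_norm k h \<le> \<rho>" for h j
    using coordinate_le_ell2_norm[OF that(1), of j] that(2) s(2)[of j] by (simp add: distrib_right)
  show ?thesis
  proof (intro exI conjI ballI impI allI)
    show "0 < \<rho>" by fact
    show "0 \<le> sqrt (\<Sum>\<^sub>\<infinity>\<alpha>. (norm (c \<alpha>) / mpow \<alpha> (prime_weight k))\<^sup>2) * sqrt (exp (B / (1 - (s + \<rho>)\<^sup>2)))"
      by (auto intro!: infsum_nonneg mult_nonneg_nonneg)
    show "(\<lambda>j. z j + h j) \<in> R_dom k" if h: "h \<in> ell2 k" "ell2_norm k h \<le> \<rho>" for h
      unfolding R_dom_iff
    proof (intro conjI exI[of _ "s + \<rho>"] allI)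
      fix j
      have "cmod (z j + h j) * prime_weight k j \<le> (cmod (z j) + cmod (h j)) * prime_weight k j"
        using prime_weight_pos[of k j] by (intro mult_right_mono norm_triangle_ineq) auto
      then show "cmod (z j + h j) * prime_weight k j \<le> s + \<rho>"
        using le[OF h, of j] by linarith
    qed (use \<rho> z2 h ell2_add in auto)
    show "(\<Sum>\<alpha>\<in>F. cmod (c \<alpha>) * mpow \<alpha> (\<lambda>j. cmod (z j) + cmod (y j))) \<le>
        sqrt (\<Sum>\<^sub>\<infinity>\<alpha>. (norm (c \<alpha>) / mpow \<alpha> (prime_weight k))\<^sup>2) * sqrt (exp (B / (1 - (s + \<rho>)\<^sup>2)))"
      if y: "y \<in> ell2 k" "ell2_norm k y \<le> \<rho>" and F: "finite F" for y F
    proof (rule sum_coeff_mpow_le[OF c _ _ \<rho>(2) _ F])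
      show "(cmod (z j) + cmod (y j)) * prime_weight k j \<le> s + \<rho>" for j
        by (rule le[OF y])
      show "(\<Sum>j<N. ((cmod (z j) + cmod (y j)) * prime_weight k j)\<^sup>2) \<le> B" for N
      proof -
        have "(\<Sum>j<N. ((cmod (z j) + cmod (y j)) * prime_weight k j)\<^sup>2) \<le>
          (\<Sum>j<N. 2 * (cmod (z j) * prime_weight k j)\<^sup>2 + 2 * (cmod (y j) * prime_weight k j)\<^sup>2)"
        proof (rule sum_mono)
          fix j
          show "((cmod (z j) + cmod (y j)) * prime_weight k j)\<^sup>2 \<le>
            2 * (cmod (z j) * prime_weight k j)\<^sup>2 + 2 * (cmod (y j) * prime_weight k j)\<^sup>2"
            using sum_squares_bound[of "cmod (z j) * prime_weight k j" "cmod (y j) * prime_weight k j"]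
            by (simp add: power2_sum distrib_right)
        qed
        also have "\<dots> = 2 * (\<Sum>j<N. (cmod (z j) * prime_weight k j)\<^sup>2) +
            2 * (\<Sum>j<N. (cmod (y j) * prime_weight k j)\<^sup>2)"
          by (simp add: sum.distrib sum_distrib_left)
        also have "\<dots> \<le> 2 * (ell2_norm k z)\<^sup>2 + 2 * (ell2_norm k y)\<^sup>2"
          using ell2_sum_le[OF z2, of N] ell2_sum_le[OF y(1), of N] by linarith
        also have "\<dots> \<le> B"
          unfolding B_def using y ell2_norm_nonneg[OF y(1)] power_mono by auto
        finally show ?thesis .
      qed
    qed auto
  qed
qed

lemma power_series_has_sum:
  assumes c: "hardy_coeffs k c" and z: "z \<in> R_dom k"
  shows "((\<lambda>\<alpha>. c \<alpha> * mpow \<alpha> z) has_sum power_series c z) UNIV"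
proof -
  obtain \<rho> K where \<rho>: "0 < \<rho>" and "0 \<le> K"
    and "\<And>h. h \<in> ell2 k \<Longrightarrow> ell2_norm k h \<le> \<rho> \<Longrightarrow> (\<lambda>j. z j + h j) \<in> R_dom k"
    and K: "\<And>y F. y \<in> ell2 k \<Longrightarrow> ell2_norm k y \<le> \<rho> \<Longrightarrow> finite F \<Longrightarrow>
       (\<Sum>\<alpha>\<in>F. cmod (c \<alpha>) * mpow \<alpha> (\<lambda>j. cmod (z j) + cmod (y j))) \<le> K"
    using power_series_majorant[OF c z] by blast
  \<comment> \<open>The majorant with zero increment is already absolute convergence at z.\<close>
  have 0: "(\<lambda>_. 0) \<in> ell2 k" "ell2_norm k (\<lambda>_. 0) \<le> \<rho>"
    using \<rho> by (auto simp: ell2_def ell2_norm_def)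
  have "(\<Sum>\<alpha>\<in>F. norm (c \<alpha> * mpow \<alpha> z)) \<le> K" if "finite F" for F
    using K[OF 0 that] by (simp add: norm_mult norm_mpow)
  then have "(\<lambda>\<alpha>. norm (c \<alpha> * mpow \<alpha> z)) summable_on UNIV"
    by (intro bounded_finite_sums(1)) auto
  then show ?thesis
    unfolding power_series_def by (rule has_sum_infsum [OF abs_summable_summable])
qed

lemma ell2_mult:
  assumes "h \<in> ell2 k"
  shows "(\<lambda>j. a * h j) \<in> ell2 k" "ell2_norm k (\<lambda>j. a * h j) = cmod a * ell2_norm k h"
proof -
  have eq: "(\<lambda>j. (cmod (a * h j * of_real (prime_weight k j)))\<^sup>2) =
      (\<lambda>j. (cmod a)\<^sup>2 * (cmod (h j * of_real (prime_weight k j)))\<^sup>2)"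
    by (simp add: norm_mult power_mult_distrib mult_ac)
  show "(\<lambda>j. a * h j) \<in> ell2 k"
    using assms unfolding ell2_def mem_Collect_eq eq by (rule summable_mult)
  show "ell2_norm k (\<lambda>j. a * h j) = cmod a * ell2_norm k h"
    using assms unfolding ell2_norm_def ell2_def mem_Collect_eq eq
    by (subst suminf_mult) (simp_all add: real_sqrt_mult)
qed

text \<open>Termwise differentiation. An increment h of norm at most t * \<rho> is t times a point y
  of the ball of radius \<rho>, so the bounds for single monomials sum to t * K for the derivative
  and t^2 * K for the remainder. Taking t as the norm of h divided by \<rho> gives boundedness of L
  and a quadratic remainder. Agreement of f with the series is asked on \<open>R_dom k\<close> alone
  because functions are extended by \<open>undefined\<close> outside their domain.\<close>

lemma power_series_frechet_differentiable:
  assumes c: "hardy_coeffs k c" and z: "z \<in> R_dom k"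
    and f: "\<And>w. w \<in> R_dom k \<Longrightarrow> f w = power_series c w"
  shows "frechet_differentiable_at k f z"
proof -
  obtain \<rho> K where \<rho>: "0 < \<rho>" and K0: "0 \<le> K"
    and R: "\<And>h. h \<in> ell2 k \<Longrightarrow> ell2_norm k h \<le> \<rho> \<Longrightarrow> (\<lambda>j. z j + h j) \<in> R_dom k"
    and K: "\<And>y F. y \<in> ell2 k \<Longrightarrow> ell2_norm k y \<le> \<rho> \<Longrightarrow> finite F \<Longrightarrow>
       (\<Sum>\<alpha>\<in>F. cmod (c \<alpha>) * mpow \<alpha> (\<lambda>j. cmod (z j) + cmod (y j))) \<le> K"
    using power_series_majorant[OF c z] by blast
  obtain D where "\<And>\<alpha>. monomial_derivative z \<alpha> (D \<alpha>)"
    using choice [of "monomial_derivative z"] ex_monomial_derivative by blast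
  then have D: "monomial_derivative z \<alpha> (D \<alpha>)" for \<alpha> .
  note D_add = monomial_derivativeD(1) [OF D] and D_mult = monomial_derivativeD(2) [OF D]
  define L where "L h = (\<Sum>\<^sub>\<infinity>\<alpha>. c \<alpha> * D \<alpha> h)" for h
  have scaled: "\<exists>y. y \<in> ell2 k \<and> ell2_norm k y \<le> \<rho> \<and> (\<forall>j. 0 \<le> cmod (y j) \<and> cmod (h j) \<le> t * cmod (y j))"
    if h: "h \<in> ell2 k" and t: "0 < t" "ell2_norm k h \<le> t * \<rho>" for h t
  proof (intro exI conjI)
    show "(\<lambda>j. of_real (1 / t) * h j) \<in> ell2 k" by (rule ell2_mult[OF h])
    show "ell2_norm k (\<lambda>j. of_real (1 / t) * h j) \<le> \<rho>"
      unfolding ell2_mult(2)[OF h] using t by (simp add: norm_divide field_simps)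
    show "\<forall>j. 0 \<le> cmod (of_real (1 / t) * h j) \<and> cmod (h j) \<le> t * cmod (of_real (1 / t) * h j)"
      using t by (auto simp: norm_mult norm_divide)
  qed
  have L: "(\<lambda>\<alpha>. norm (c \<alpha> * D \<alpha> h)) summable_on UNIV" "norm (L h) \<le> t * K"
    if h: "h \<in> ell2 k" and t: "0 < t" "ell2_norm k h \<le> t * \<rho>" for h t
  proof -
    obtain y where y: "y \<in> ell2 k" "ell2_norm k y \<le> \<rho>"
      "\<forall>j. 0 \<le> cmod (y j) \<and> cmod (h j) \<le> t * cmod (y j)"
      using scaled[OF h t] by blast
    have "(\<Sum>\<alpha>\<in>F. norm (c \<alpha> * D \<alpha> h)) \<le> t * K" if "finite F" for F
    proof -
      have "(\<Sum>\<alpha>\<in>F. norm (c \<alpha> * D \<alpha> h)) \<le>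
          (\<Sum>\<alpha>\<in>F. t * (cmod (c \<alpha>) * mpow \<alpha> (\<lambda>j. cmod (z j) + cmod (y j))))"
      proof (rule sum_mono)
        fix \<alpha>
        have "cmod (D \<alpha> h) \<le> t * mpow \<alpha> (\<lambda>j. cmod (z j) + cmod (y j))"
          by (rule monomial_derivativeD(3) [OF D]) (use t y(3) in auto)
        from mult_left_mono [OF this norm_ge_zero [of "c \<alpha>"]] show "norm (c \<alpha> * D \<alpha> h) \<le> t * (cmod (c \<alpha>) * mpow \<alpha> (\<lambda>j. cmod (z j) + cmod (y j)))"
          by (simp add: norm_mult mult_ac)
      qed
      also have "\<dots> \<le> t * K"
        unfolding sum_distrib_left[symmetric] using K[OF y(1,2) that] t by (intro mult_left_mono) auto
      finally show ?thesis .
    qed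
    then show "(\<lambda>\<alpha>. norm (c \<alpha> * D \<alpha> h)) summable_on UNIV" "norm (L h) \<le> t * K"
      unfolding L_def by (auto intro!: bounded_finite_sums)
  qed
  have Ls: "(\<lambda>\<alpha>. c \<alpha> * D \<alpha> h) summable_on UNIV" if h: "h \<in> ell2 k" for h
  proof (rule abs_summable_summable, rule L(1)[OF h])
    \<comment> \<open>The added \<rho> keeps the scaling factor positive even when h has norm
      zero.\<close>
    show "0 < (ell2_norm k h + \<rho>) / \<rho>"
      using \<rho> ell2_norm_nonneg[OF h] by simp
    show "ell2_norm k h \<le> (ell2_norm k h + \<rho>) / \<rho> * \<rho>" using \<rho> by simp
  qed
  \<comment> \<open>Increments of norm zero are treated apart, since the factor t must be
    positive.\<close>
  have L_0: "L h = 0" "(\<lambda>j. z j + h j) = z" if "h \<in> ell2 k" "ell2_norm k h = 0" for h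
  proof -
    have "cmod (h j) = 0" for j
      using coordinate_le_ell2_norm[OF that(1), of j] that(2) prime_weight_pos[of k j]
      by (simp add: mult_le_0_iff)
    then have h: "h j = 0" for j by simp
    then show "(\<lambda>j. z j + h j) = z" by simp
    have "h = (\<lambda>j. 0 * h j)" using h by auto
    then have "D \<alpha> h = 0" for \<alpha> using D_mult [of \<alpha> 0 h] by simp
    then show "L h = 0" by (simp add: L_def)
  qed
  have blf: "bounded_linear_functional k L"
    unfolding bounded_linear_functional_def
  proof (intro conjI ballI allI exI[of _ "K / \<rho>"])
    show "L (\<lambda>j. g j + h j) = L g + L h" if "g \<in> ell2 k" "h \<in> ell2 k" for g h
      unfolding L_def D_add distrib_left using Ls that by (intro infsum_add) auto
    show "L (\<lambda>j. a * h j) = a * L h" if "h \<in> ell2 k" for a h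
      unfolding L_def D_mult mult.left_commute[of _ a] using Ls that by (intro infsum_cmult_right) auto
    show "cmod (L h) \<le> K / \<rho> * ell2_norm k h" if h: "h \<in> ell2 k" for h
    proof (cases "ell2_norm k h = 0")
      case False
      then have "0 < ell2_norm k h / \<rho>"
        using ell2_norm_nonneg[OF h] \<rho> by simp
      from L(2)[OF h this] show ?thesis using \<rho> by (simp add: mult_ac)
    qed (use L_0 h in simp)
  qed
  have rem: "cmod (f (\<lambda>j. z j + h j) - f z - L h) \<le> t\<^sup>2 * K"
    if h: "h \<in> ell2 k" and t: "0 < t" "ell2_norm k h \<le> t * \<rho>" and t1: "t \<le> 1" for h t
  proof -
    obtain y where y: "y \<in> ell2 k" "ell2_norm k y \<le> \<rho>"
      "\<forall>j. 0 \<le> cmod (y j) \<and> cmod (h j) \<le> t * cmod (y j)"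
      using scaled[OF h t] by blast
    have "t * \<rho> \<le> 1 * \<rho>" using t1 \<rho> by (intro mult_right_mono) auto
    then have zh: "(\<lambda>j. z j + h j) \<in> R_dom k" using R[OF h] t by simp
    have "((\<lambda>\<alpha>. c \<alpha> * mpow \<alpha> (\<lambda>j. z j + h j) + - (c \<alpha> * mpow \<alpha> z) + - (c \<alpha> * D \<alpha> h)) has_sum
        (f (\<lambda>j. z j + h j) + - f z + - L h)) UNIV"
      unfolding f [OF zh] f [OF z] L_def
      by (intro has_sum_add has_sum_uminusI power_series_has_sum [OF c] zh z has_sum_infsum Ls h)
    from infsumI [OF this] have "f (\<lambda>j. z j + h j) - f z - L h =
        (\<Sum>\<^sub>\<infinity>\<alpha>. c \<alpha> * (mpow \<alpha> (\<lambda>j. z j + h j) - mpow \<alpha> z - D \<alpha> h))"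
      by (simp add: algebra_simps)
    also have "norm \<dots> \<le> t\<^sup>2 * K"
    proof (rule bounded_finite_sums(2))
      fix F :: "(nat \<Rightarrow>\<^sub>0 nat) set" assume F: "finite F"
      have "(\<Sum>\<alpha>\<in>F. norm (c \<alpha> * (mpow \<alpha> (\<lambda>j. z j + h j) - mpow \<alpha> z - D \<alpha> h))) \<le>
          (\<Sum>\<alpha>\<in>F. t\<^sup>2 * (cmod (c \<alpha>) * mpow \<alpha> (\<lambda>j. cmod (z j) + cmod (y j))))"
      proof (rule sum_mono)
        fix \<alpha>
        have "cmod (mpow \<alpha> (\<lambda>j. z j + h j) - mpow \<alpha> z - D \<alpha> h) \<le>
            t\<^sup>2 * mpow \<alpha> (\<lambda>j. cmod (z j) + cmod (y j))"
          by (rule monomial_derivativeD(5) [OF D]) (use t t1 y(3) in auto)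
        from mult_left_mono [OF this norm_ge_zero [of "c \<alpha>"]] show "norm (c \<alpha> * (mpow \<alpha> (\<lambda>j. z j + h j) - mpow \<alpha> z - D \<alpha> h)) \<le>
            t\<^sup>2 * (cmod (c \<alpha>) * mpow \<alpha> (\<lambda>j. cmod (z j) + cmod (y j)))"
          by (simp add: norm_mult mult_ac)
      qed
      also have "\<dots> \<le> t\<^sup>2 * K"
        unfolding sum_distrib_left[symmetric] using K[OF y(1,2) F] by (intro mult_left_mono) auto
      finally show "(\<Sum>\<alpha>\<in>F. norm (c \<alpha> * (mpow \<alpha> (\<lambda>j. z j + h j) - mpow \<alpha> z - D \<alpha> h))) \<le> t\<^sup>2 * K" .
    qed
    finally show ?thesis .
  qed
  show ?thesis
    unfolding frechet_differentiable_at_def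
  proof (intro exI[of _ L] conjI allI impI blf)
    fix \<epsilon> :: real assume \<epsilon>: "0 < \<epsilon>"
    \<comment> \<open>The first entry makes t \<le> 1, the second makes the quadratic remainder at
      most \<epsilon> times the norm of h. Using K + 1 avoids a division by zero.\<close>
    define \<delta> where "\<delta> = min \<rho> (\<epsilon> * \<rho>\<^sup>2 / (K + 1))"
    have \<delta>: "0 < \<delta>" using \<epsilon> \<rho> K0 by (simp add: \<delta>_def)
    show "\<exists>\<delta>>0. \<forall>h\<in>ell2 k. (\<lambda>j. z j + h j) \<in> R_dom k \<and> ell2_norm k h < \<delta> \<longrightarrow>
        cmod (f (\<lambda>j. z j + h j) - f z - L h) \<le> \<epsilon> * ell2_norm k h"
    proof (intro exI[of _ \<delta>] conjI \<delta> ballI impI)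
      fix h assume h: "h \<in> ell2 k" and hd: "(\<lambda>j. z j + h j) \<in> R_dom k \<and> ell2_norm k h < \<delta>"
      show "cmod (f (\<lambda>j. z j + h j) - f z - L h) \<le> \<epsilon> * ell2_norm k h"
      proof (cases "ell2_norm k h = 0")
        case False
        then have h0: "0 < ell2_norm k h" using ell2_norm_nonneg[OF h] by simp
        have "cmod (f (\<lambda>j. z j + h j) - f z - L h) \<le> (ell2_norm k h / \<rho>)\<^sup>2 * K"
          using h0 hd \<rho> by (intro rem h) (auto simp: \<delta>_def)
        also have "\<dots> \<le> (ell2_norm k h / \<rho>)\<^sup>2 * (K + 1)"
          by (intro mult_left_mono) auto
        also have "\<dots> = ell2_norm k h * (ell2_norm k h * (K + 1) / \<rho>\<^sup>2)"
          by (simp add: power2_eq_square)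
        also have "\<dots> \<le> ell2_norm k h * \<epsilon>"
        proof (intro mult_left_mono)
          have "ell2_norm k h \<le> \<epsilon> * \<rho>\<^sup>2 / (K + 1)" using hd by (simp add: \<delta>_def)
          then show "ell2_norm k h * (K + 1) / \<rho>\<^sup>2 \<le> \<epsilon>"
            using \<rho> K0 by (simp add: field_simps)
        qed (use h0 in simp)
        finally show ?thesis by (simp add: mult.commute)
      qed (use L_0[OF h] in simp)
    qed
  qed
qed

section \<open>Integration over the torus\<close>

abbreviation circle_measure :: "real measure" where
  "circle_measure \<equiv> uniform_measure lborel {0..<2 * pi}"

lemma emeasure_circle: "emeasure lborel {0..<2 * pi} = ennreal (2 * pi)"
  by simp

lemma prob_space_circle: "prob_space circle_measure"
  by (rule prob_space_uniform_measure) (simp_all add: emeasure_circle)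

lemma sets_circle [measurable_cong]: "sets circle_measure = sets borel"
  by (simp add: uniform_measure_def)

lemma prob_space_torus: "prob_space (torus_measure N)"
  unfolding torus_measure_def by (intro prob_space_PiM prob_space_circle)

text \<open>Bridges the gauge integral over a closed interval, which contour integrals produce, and
  the normalised measure on the half-open interval; the two differ by the endpoint, a null
  set.\<close>

lemma integral_circle:
  fixes \<phi> :: "real \<Rightarrow> complex"
  assumes cont: "continuous_on UNIV \<phi>" and I: "(\<phi> has_integral I) {0..2 * pi}"
  shows "(LINT s|circle_measure. \<phi> s) = I / of_real (2 * pi)"
proof -
  have meas [measurable]: "\<phi> \<in> borel_measurable borel"
    using cont by (rule borel_measurable_continuous_onI)
  have dens: "circle_measure = density lborel (\<lambda>s. ennreal (indicator {0..<2 * pi} s / (2 * pi)))"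
    unfolding uniform_measure_def emeasure_circle
    by (rule density_cong) (auto simp: divide_ennreal [symmetric] indicator_def ennreal_1 [symmetric]
        simp del: ennreal_1)
  have "(LINT s|circle_measure. \<phi> s) =
      (LINT s|lborel. (indicator {0..<2 * pi} s / (2 * pi)) *\<^sub>R \<phi> s)"
    unfolding dens by (rule integral_density) auto
  also have "\<dots> = (LINT s|lborel. (1 / (2 * pi)) *\<^sub>R (indicator {0..2 * pi} s *\<^sub>R \<phi> s))"
  proof (rule integral_cong_AE)
    have "AE s in lborel. s \<noteq> 2 * pi" by (rule AE_lborel_singleton)
    then show "AE s in lborel. (indicator {0..<2 * pi} s / (2 * pi)) *\<^sub>R \<phi> s =
        (1 / (2 * pi)) *\<^sub>R (indicator {0..2 * pi} s *\<^sub>R \<phi> s)"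
      by eventually_elim (auto simp: indicator_def)
  qed auto
  also have "(LINT s|lborel. (1 / (2 * pi)) *\<^sub>R (indicator {0..2 * pi} s *\<^sub>R \<phi> s)) =
      (1 / (2 * pi)) *\<^sub>R (LINT s:{0..2 * pi}|lborel. \<phi> s)"
    unfolding set_lebesgue_integral_def by (rule integral_scaleR_right)
  also have "(LINT s:{0..2 * pi}|lborel. \<phi> s) = integral {0..2 * pi} \<phi>"
    by (rule set_borel_integral_eq_integral)
      (rule borel_integrable_atLeastAtMost', rule continuous_on_subset[OF cont], simp)
  also have "\<dots> = I" using I by (rule integral_unique)
  finally show ?thesis by (simp add: scaleR_conv_of_real field_simps)
qed

text \<open>With u = r * cis s one has du = i u ds, so the Cauchy kernel du / (u - w) becomes i ds /
  (1 - w / u). In this shape the kernel is the sum of a geometric series in w / u.\<close>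

lemma cauchy_circle:
  assumes g: "g holomorphic_on ball 0 R" and r: "0 < r" "r < R" and w: "cmod w < r"
  shows "(LINT s|circle_measure. g (of_real r * cis s) * (1 / (1 - w / (of_real r * cis s)))) = g w"
proof -
  have ne: "of_real r * cis s \<noteq> w" for s
  proof
    assume "of_real r * cis s = w"
    then have "cmod (of_real r * cis s) = cmod w" by simp
    then show False using r w by (simp add: norm_mult)
  qed
  have ne0: "of_real r * cis s \<noteq> 0" for s using r by simp
  have ball: "of_real r * cis s \<in> ball 0 R" for s using r by (simp add: norm_mult)
  have "((\<lambda>u. g u / (u - w)) has_contour_integral (2 * of_real pi * \<i> * g w)) (circlepath 0 r)"
  proof (rule Cauchy_integral_circlepath_simple)
    show "g holomorphic_on cball 0 r" using g r by (auto intro: holomorphic_on_subset)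
    show "norm (w - 0) < r" using w by simp
  qed
  then have "((\<lambda>s. g (of_real r * cis s) / (of_real r * cis s - w) * r * \<i> * cis s) has_integral
      (2 * of_real pi * \<i> * g w)) {0..2 * pi}"
    unfolding circlepath_def by (subst (asm) has_contour_integral_part_circlepath_iff) auto
  then have "((\<lambda>s. (g (of_real r * cis s) / (of_real r * cis s - w) * r * \<i> * cis s) * (1 / \<i>)) has_integral
      (2 * of_real pi * \<i> * g w) * (1 / \<i>)) {0..2 * pi}"
    by (rule has_integral_mult_left)
  also have "(2 * of_real pi * \<i> * g w) * (1 / \<i>) = 2 * of_real pi * g w"
    by simp
  also have "(\<lambda>s. (g (of_real r * cis s) / (of_real r * cis s - w) * r * \<i> * cis s) * (1 / \<i>)) =
      (\<lambda>s. g (of_real r * cis s) * (1 / (1 - w / (of_real r * cis s))))"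
  proof
    fix s
    have "1 - w / (of_real r * cis s) = (of_real r * cis s - w) / (of_real r * cis s)"
      using ne0[of s] by (simp add: diff_divide_distrib)
    then show "(g (of_real r * cis s) / (of_real r * cis s - w) * r * \<i> * cis s) * (1 / \<i>) =
      g (of_real r * cis s) * (1 / (1 - w / (of_real r * cis s)))"
      by (simp add: mult_ac)
  qed
  finally have I: "((\<lambda>s. g (of_real r * cis s) * (1 / (1 - w / (of_real r * cis s)))) has_integral
      (2 * of_real pi * g w)) {0..2 * pi}" .
  have "continuous_on UNIV (\<lambda>s. g (of_real r * cis s) * (1 / (1 - w / (of_real r * cis s))))"
  proof (intro continuous_intros)
    show "continuous_on UNIV (\<lambda>s. g (of_real r * cis s))"
      by (rule continuous_on_compose2[OF holomorphic_on_imp_continuous_on[OF g]])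
        (use ball in \<open>auto intro!: continuous_intros\<close>)
    show "\<forall>s\<in>UNIV. of_real r * cis s \<noteq> 0" using ne0 by simp
    show "\<forall>s\<in>UNIV. 1 - w / (of_real r * cis s) \<noteq> 0" using ne ne0 by (auto simp: field_simps)
  qed
  from integral_circle[OF this I] show ?thesis by simp
qed

text \<open>Positive powers integrate to zero by the Cauchy formula at the centre; conjugation
  exchanges the cases n < m and m < n.\<close>

lemma circle_orthogonality:
  "(LINT s|circle_measure. cis s ^ m * cnj (cis s ^ n)) = (if m = n then 1 else 0)"
proof -
  interpret prob_space circle_measure by (rule prob_space_circle)
  have unit: "cis s ^ m * cnj (cis s ^ m) = 1" for s m
    by (simp add: complex_norm_square [symmetric] norm_power del: complex_cnj_power)
  have pos: "(LINT s|circle_measure. cis s ^ d) = 0" if "d > 0" for d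
  proof -
    have "(\<lambda>u. u ^ d) holomorphic_on ball 0 2" by (intro holomorphic_intros)
    from cauchy_circle[OF this, of 1 0] show ?thesis using that by simp
  qed
  have lt: "(LINT s|circle_measure. cis s ^ m * cnj (cis s ^ n)) = 0" if "n < m" for m n
  proof -
    have "cis s ^ m * cnj (cis s ^ n) = cis s ^ (m - n)" for s
    proof -
      have "cis s ^ m = cis s ^ (m - n) * cis s ^ n" using that by (simp flip: power_add)
      then show ?thesis using unit[of s n] by (simp add: mult.assoc)
    qed
    then show ?thesis using pos[of "m - n"] that by simp
  qed
  consider "m = n" | "n < m" | "m < n" by linarith
  then show ?thesis
  proof cases
    case 1
    then show ?thesis using unit prob_space by simp
  next
    case 2
    then show ?thesis using lt by simp
  next
    case 3
    have "(LINT s|circle_measure. cis s ^ m * cnj (cis s ^ n)) =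
        (LINT s|circle_measure. cnj (cis s ^ n * cnj (cis s ^ m)))"
      by (simp add: mult.commute)
    also have "\<dots> = cnj (LINT s|circle_measure. cis s ^ n * cnj (cis s ^ m))"
      by (rule Bochner_Integration.integral_cnj)
    also have "\<dots> = 0" using lt[OF 3] by simp
    finally show ?thesis using 3 by simp
  qed
qed

text \<open>The torus measure lives on functions indexed by \<open>{..<N}\<close>, whereas
  continuity refers to the product topology over all indices. Resetting the coordinates from N on to
  0 is measurable between the two, and by the dependence hypothesis it leaves F unchanged.\<close>

lemma torus_borel_measurable:
  fixes F :: "(nat \<Rightarrow> real) \<Rightarrow> complex"
  assumes cont: "continuous_on UNIV F"
    and dep: "\<And>t t'. (\<And>j. j < N \<Longrightarrow> t j = t' j) \<Longrightarrow> F t = F t'"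
  shows "F \<in> borel_measurable (torus_measure N)"
proof -
  have "(\<lambda>t j. if j < N then t j else 0) \<in> borel_measurable (torus_measure N)"
  proof (rule measurable_coordinatewise_then_product)
    show "(\<lambda>t. if j < N then t j else 0) \<in> borel_measurable (torus_measure N)" for j
      by (cases "j < N") (simp_all add: torus_measure_def)
  qed
  from measurable_compose[OF this borel_measurable_continuous_onI[OF cont]]
  have "(\<lambda>t. F (\<lambda>j. if j < N then t j else 0)) \<in> borel_measurable (torus_measure N)" .
  moreover have "F (\<lambda>j. if j < N then t j else 0) = F t" for t
    by (rule dep) simp
  ultimately show ?thesis by simp
qed

lemma (in prob_space) bounded_integral:
  fixes F :: "'a \<Rightarrow> 'b::{banach, second_countable_topology}"
  assumes "F \<in> borel_measurable M" "\<And>x. x \<in> space M \<Longrightarrow> norm (F x) \<le> B"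
  shows "integrable M F" "norm (integral\<^sup>L M F) \<le> B"
proof -
  show int: "integrable M F"
    by (rule integrable_const_bound[where B = B]) (use assms in auto)
  have "norm (integral\<^sup>L M F) \<le> (LINT x|M. norm (F x))"
    by (rule integral_norm_bound)
  also have "\<dots> \<le> (LINT x|M. B)"
    using int assms by (intro integral_mono) auto
  finally show "norm (integral\<^sup>L M F) \<le> B" by (simp add: prob_space)
qed

text \<open>The integral of a product over independent coordinates is the product of the circle
  integrals; one coordinate with different exponents makes it vanish.\<close>

lemma torus_orthogonality:
  assumes "Poly_Mapping.keys \<alpha> \<subseteq> {..<N}" "Poly_Mapping.keys \<beta> \<subseteq> {..<N}"
  shows "(LINT t|torus_measure N. mpow \<alpha> (\<lambda>j. cis (t j)) * cnj (mpow \<beta> (\<lambda>j. cis (t j)))) =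
    (if \<alpha> = \<beta> then 1 else 0)"
proof -
  interpret product_prob_space "\<lambda>_. circle_measure" "{..<N}"
    by (simp add: product_prob_space_def product_prob_space_axioms_def product_sigma_finite_def
        prob_space_circle prob_space_imp_sigma_finite)
  have "(LINT t|torus_measure N. mpow \<alpha> (\<lambda>j. cis (t j)) * cnj (mpow \<beta> (\<lambda>j. cis (t j)))) =
    (LINT t|torus_measure N. (\<Prod>j<N. cis (t j) ^ Poly_Mapping.lookup \<alpha> j *
      cnj (cis (t j) ^ Poly_Mapping.lookup \<beta> j)))"
    using assms by (simp add: mpow_superset[of "{..<N}"] prod.distrib)
  also have "\<dots> = (\<Prod>j<N. (LINT s|circle_measure. cis s ^ Poly_Mapping.lookup \<alpha> j *
      cnj (cis s ^ Poly_Mapping.lookup \<beta> j)))"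
    unfolding torus_measure_def
  proof (rule product_integral_prod)
    show "integrable circle_measure (\<lambda>s. cis s ^ m * cnj (cis s ^ n))" for m n
    proof (rule prob_space.bounded_integral(1)[OF prob_space_circle, where B = 1])
      have "continuous_on UNIV (\<lambda>s. cis s ^ m * cnj (cis s ^ n))"
        by (intro continuous_intros)
      from borel_measurable_continuous_onI[OF this]
      show "(\<lambda>s. cis s ^ m * cnj (cis s ^ n)) \<in> borel_measurable circle_measure"
        by simp
    qed (simp add: norm_mult norm_power)
  qed simp
  also have "\<dots> = (\<Prod>j<N. if Poly_Mapping.lookup \<alpha> j = Poly_Mapping.lookup \<beta> j then 1 else 0)"
    by (simp only: circle_orthogonality)
  also have "\<dots> = (if \<alpha> = \<beta> then 1 else 0)"
  proof (cases "\<alpha> = \<beta>")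
    case False
    then obtain j where j: "Poly_Mapping.lookup \<alpha> j \<noteq> Poly_Mapping.lookup \<beta> j"
      by (meson poly_mapping_eqI)
    then have "j < N"
      using assms by (metis in_keys_iff lessThan_iff subsetD)
    then show ?thesis using j False by (auto intro!: prod_zero bexI[of _ j])
  qed simp
  finally show ?thesis .
qed

section \<open>Parseval's identity\<close>

text \<open>Arbitrary radii replace those of \<open>polydisc\<close>, because expansions are first
  obtained on strictly smaller polydiscs and then extended.\<close>

definition open_polydisc :: "(nat \<Rightarrow> real) \<Rightarrow> nat \<Rightarrow> (nat \<Rightarrow> complex) set" where
  "open_polydisc R N = {z. (\<forall>j<N. cmod (z j) < R j) \<and> (\<forall>j\<ge>N. z j = 0)}"

definition expands_on ::
    "(nat \<Rightarrow> real) \<Rightarrow> nat \<Rightarrow> ((nat \<Rightarrow> complex) \<Rightarrow> complex) \<Rightarrow> ((nat \<Rightarrow>\<^sub>0 nat) \<Rightarrow> complex) \<Rightarrow> bool" where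
  "expands_on R N f c \<longleftrightarrow>
    (\<forall>z\<in>open_polydisc R N. ((\<lambda>\<alpha>. c \<alpha> * mpow \<alpha> z) has_sum f z) (indices_below N))"

lemma mpow_torus_point:
  assumes "\<alpha> \<in> indices_below N"
  shows "mpow \<alpha> (torus_point N r t) = of_real (mpow \<alpha> r) * mpow \<alpha> (\<lambda>j. cis (t j))"
proof -
  have "mpow \<alpha> (torus_point N r t) = mpow \<alpha> (\<lambda>j. of_real (r j) * cis (t j))"
    using assms by (intro mpow_cong) (auto simp: torus_point_def)
  then show ?thesis by (simp only: mpow_mult of_real_mpow)
qed

lemma continuous_on_mpow_cis: "continuous_on UNIV (\<lambda>t. mpow \<alpha> (\<lambda>j. cis (t j)))"
  unfolding mpow_def by (intro continuous_intros continuous_on_product_coordinates)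

lemma norm_mpow_cis: "cmod (mpow \<alpha> (\<lambda>j. cis (t j))) = 1"
  unfolding norm_mpow by (simp add: mpow_def)

lemma measurable_mpow_cis:
  assumes "\<alpha> \<in> indices_below N"
  shows "(\<lambda>t. mpow \<alpha> (\<lambda>j. cis (t j))) \<in> borel_measurable (torus_measure N)"
  by (rule torus_borel_measurable[OF continuous_on_mpow_cis]) (use assms in \<open>auto intro!: mpow_cong\<close>)

lemma parseval_finite:
  assumes F: "finite F" "F \<subseteq> indices_below N"
  shows "(LINT t|torus_measure N. (cmod (\<Sum>\<alpha>\<in>F. u \<alpha> * mpow \<alpha> (\<lambda>j. cis (t j))))\<^sup>2) =
    (\<Sum>\<alpha>\<in>F. (cmod (u \<alpha>))\<^sup>2)"
proof -
  interpret prob_space "torus_measure N" by (rule prob_space_torus)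
  let ?e = "\<lambda>\<alpha> t. mpow \<alpha> (\<lambda>j. cis (t j))"
  have int: "integrable (torus_measure N) (\<lambda>t. u \<alpha> * cnj (u \<beta>) * (?e \<alpha> t * cnj (?e \<beta> t)))"
    if "\<alpha> \<in> F" "\<beta> \<in> F" for \<alpha> \<beta>
  proof -
    have "(\<lambda>t. ?e \<alpha> t * cnj (?e \<beta> t)) \<in> borel_measurable (torus_measure N)"
    proof (rule torus_borel_measurable)
      show "continuous_on UNIV (\<lambda>t. ?e \<alpha> t * cnj (?e \<beta> t))"
        by (intro continuous_intros continuous_on_mpow_cis)
      fix t t' :: "nat \<Rightarrow> real" assume eq: "\<And>j. j < N \<Longrightarrow> t j = t' j"
      have "?e \<gamma> t = ?e \<gamma> t'" if "\<gamma> \<in> F" for \<gamma>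
      proof (rule mpow_cong)
        fix j assume "j \<in> Poly_Mapping.keys \<gamma>"
        with that F(2) have "j < N" by auto
        then show "cis (t j) = cis (t' j)" using eq by simp
      qed
      then show "?e \<alpha> t * cnj (?e \<beta> t) = ?e \<alpha> t' * cnj (?e \<beta> t')"
        using \<open>\<alpha> \<in> F\<close> \<open>\<beta> \<in> F\<close> by metis
    qed
    then have "integrable (torus_measure N) (\<lambda>t. ?e \<alpha> t * cnj (?e \<beta> t))"
      by (rule bounded_integral(1)[where B = 1]) (simp add: norm_mult norm_mpow_cis)
    then show ?thesis by (rule integrable_mult_right)
  qed
  have "complex_of_real (LINT t|torus_measure N. (cmod (\<Sum>\<alpha>\<in>F. u \<alpha> * ?e \<alpha> t))\<^sup>2) =
      (LINT t|torus_measure N. complex_of_real ((cmod (\<Sum>\<alpha>\<in>F. u \<alpha> * ?e \<alpha> t))\<^sup>2))"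
    by (rule integral_complex_of_real [symmetric])
  also have "\<dots> = (LINT t|torus_measure N. (\<Sum>\<alpha>\<in>F. \<Sum>\<beta>\<in>F. u \<alpha> * cnj (u \<beta>) * (?e \<alpha> t * cnj (?e \<beta> t))))"
    by (simp add: complex_norm_square sum_product mult_ac del: of_real_power)
  also have "\<dots> = (\<Sum>\<alpha>\<in>F. \<Sum>\<beta>\<in>F. LINT t|torus_measure N. u \<alpha> * cnj (u \<beta>) * (?e \<alpha> t * cnj (?e \<beta> t)))"
    using int by (simp add: integral_sum integrable_sum)
  also have "\<dots> = (\<Sum>\<alpha>\<in>F. \<Sum>\<beta>\<in>F. if \<alpha> = \<beta> then u \<alpha> * cnj (u \<beta>) else 0)"
  proof (intro sum.cong refl)
    fix \<alpha> \<beta> assume "\<alpha> \<in> F" "\<beta> \<in> F"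
    then have "(LINT t|torus_measure N. ?e \<alpha> t * cnj (?e \<beta> t)) = (if \<alpha> = \<beta> then 1 else 0)"
      using F by (intro torus_orthogonality) auto
    then show "(LINT t|torus_measure N. u \<alpha> * cnj (u \<beta>) * (?e \<alpha> t * cnj (?e \<beta> t))) =
        (if \<alpha> = \<beta> then u \<alpha> * cnj (u \<beta>) else 0)"
      by simp
  qed
  also have "\<dots> = (\<Sum>\<alpha>\<in>F. u \<alpha> * cnj (u \<alpha>))"
    using F(1) by (simp add: sum.delta)
  also have "\<dots> = complex_of_real (\<Sum>\<alpha>\<in>F. (cmod (u \<alpha>))\<^sup>2)"
    by (simp add: complex_norm_square del: of_real_power)
  finally show ?thesis by (simp only: of_real_eq_iff)
qed

text \<open>When the norms of the terms are the same at every angle, this error bound is uniform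
  over the torus and can be integrated. It carries the passage to the limit both in Parseval's
  identity and in the expansion of the Cauchy kernel.\<close>

lemma has_sum_tail_bound:
  fixes f :: "'a \<Rightarrow> 'b::banach"
  assumes f: "(f has_sum s) A" and n: "((\<lambda>x. norm (f x)) has_sum S) A" and F: "finite F" "F \<subseteq> A"
  shows "norm (s - sum f F) \<le> S - (\<Sum>x\<in>F. norm (f x))"
proof -
  have "(f has_sum (s - sum f F)) (A - F)"
    by (rule has_sum_Diff[OF f has_sum_finite[OF F(1)] F(2)])
  moreover have "((\<lambda>x. norm (f x)) has_sum (S - (\<Sum>x\<in>F. norm (f x)))) (A - F)"
    by (rule has_sum_Diff[OF n has_sum_finite[OF F(1)] F(2)])
  ultimately show ?thesis
    by (metis norm_infsum_bound has_sum_imp_summable infsumI)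
qed

text \<open>The difference of the two sides for a finite partial sum is at most \<open>2 S\<close> times the tail of
  the absolutely convergent series, where \<open>S\<close> bounds all partial sums.\<close>

lemma parseval:
  assumes meas: "(\<lambda>t. f (torus_point N r t)) \<in> borel_measurable (torus_measure N)"
    and r: "\<And>j. 0 \<le> r j"
    and f: "\<And>t. ((\<lambda>\<alpha>. c \<alpha> * mpow \<alpha> (torus_point N r t)) has_sum f (torus_point N r t)) (indices_below N)"
  shows "((\<lambda>\<alpha>. (cmod (c \<alpha>) * mpow \<alpha> r)\<^sup>2) has_sum
    (LINT t|torus_measure N. (cmod (f (torus_point N r t)))\<^sup>2)) (indices_below N)"
proof -
  interpret prob_space "torus_measure N" by (rule prob_space_torus)
  define u where "u \<alpha> = c \<alpha> * of_real (mpow \<alpha> r)" for \<alpha>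
  define e where "e \<alpha> t = mpow \<alpha> (\<lambda>j. cis (t j))" for \<alpha> and t :: "nat \<Rightarrow> real"
  define g where "g t = f (torus_point N r t)" for t
  have norm_e: "cmod (e \<alpha> t) = 1" for \<alpha> t by (simp add: e_def norm_mpow_cis)
  have g: "((\<lambda>\<alpha>. u \<alpha> * e \<alpha> t) has_sum g t) (indices_below N)" for t
  proof -
    have "c \<alpha> * mpow \<alpha> (torus_point N r t) = u \<alpha> * e \<alpha> t" if "\<alpha> \<in> indices_below N" for \<alpha>
      using mpow_torus_point[OF that] by (simp add: u_def e_def)
    then have "((\<lambda>\<alpha>. c \<alpha> * mpow \<alpha> (torus_point N r t)) has_sum g t) (indices_below N) \<longleftrightarrow>
        ((\<lambda>\<alpha>. u \<alpha> * e \<alpha> t) has_sum g t) (indices_below N)"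
      by (rule has_sum_cong)
    with f[of t] show ?thesis unfolding g_def by blast
  qed
  have norm_u: "cmod (u \<alpha>) = cmod (c \<alpha>) * mpow \<alpha> r" for \<alpha>
    using mpow_nonneg[of r \<alpha>] r by (simp add: u_def norm_mult)
  \<comment> \<open>A single angle suffices: summability of complex families is absolute, and
    \<open>e\<close> has modulus 1, so the coefficients u themselves are absolutely
    summable.\<close>
  have "(\<lambda>\<alpha>. norm (u \<alpha> * e \<alpha> (\<lambda>_. 0))) summable_on indices_below N"
    using has_sum_imp_summable[OF g] by (simp only: summable_on_iff_abs_summable_on_complex)
  then have "(\<lambda>\<alpha>. cmod (u \<alpha>)) summable_on indices_below N"
    by (simp add: norm_mult norm_e)
  then obtain S where S: "((\<lambda>\<alpha>. cmod (u \<alpha>)) has_sum S) (indices_below N)"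
    by (auto simp: summable_on_def)
  have Se: "((\<lambda>\<alpha>. cmod (u \<alpha> * e \<alpha> t)) has_sum S) (indices_below N)" for t
    using S by (simp add: norm_mult norm_e)
  define I where "I = (LINT t|torus_measure N. (cmod (g t))\<^sup>2)"
  have close: "norm ((\<Sum>\<alpha>\<in>F. (cmod (u \<alpha>))\<^sup>2) - I) \<le> 2 * S * (S - (\<Sum>\<alpha>\<in>F. cmod (u \<alpha>)))"
    if F: "finite F" "F \<subseteq> indices_below N" for F
  proof -
    define h where "h t = (\<Sum>\<alpha>\<in>F. u \<alpha> * e \<alpha> t)" for t
    have gS: "cmod (g t) \<le> S" for t
      using has_sum_tail_bound[OF g Se, of "{}"] by simp
    have FS: "(\<Sum>\<alpha>\<in>F. cmod (u \<alpha>)) \<le> S"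
      by (rule finite_sum_le_has_sum[OF S F]) simp
    have hS: "cmod (h t) \<le> S" for t
    proof -
      have "cmod (h t) \<le> (\<Sum>\<alpha>\<in>F. cmod (u \<alpha> * e \<alpha> t))" unfolding h_def by (rule norm_sum)
      then show ?thesis using FS by (simp add: norm_mult norm_e)
    qed
    have gh: "cmod (g t - h t) \<le> S - (\<Sum>\<alpha>\<in>F. cmod (u \<alpha>))" for t
      using has_sum_tail_bound[OF g Se F] by (simp add: h_def norm_mult norm_e)
    have S0: "0 \<le> S" using gS[of undefined] norm_ge_zero order_trans by blast
    have [measurable]: "g \<in> borel_measurable (torus_measure N)"
      using meas unfolding g_def [abs_def] .
    have [measurable]: "h \<in> borel_measurable (torus_measure N)"
      unfolding h_def [abs_def] e_def
      by (intro borel_measurable_sum borel_measurable_times borel_measurable_const measurable_mpow_cis) (use F in auto)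
    have sq: "norm ((cmod w)\<^sup>2) \<le> S\<^sup>2" if "cmod w \<le> S" for w
      using that by (simp add: power_mono)
    have "(\<Sum>\<alpha>\<in>F. (cmod (u \<alpha>))\<^sup>2) - I = (LINT t|torus_measure N. (cmod (h t))\<^sup>2) - I"
      using parseval_finite[OF F, of u] by (simp add: h_def e_def)
    also have "\<dots> = (LINT t|torus_measure N. (cmod (h t))\<^sup>2 - (cmod (g t))\<^sup>2)"
      unfolding I_def
      by (intro Bochner_Integration.integral_diff [symmetric] bounded_integral(1)[where B = "S\<^sup>2"] sq hS gS)
        auto
    also have "norm \<dots> \<le> 2 * S * (S - (\<Sum>\<alpha>\<in>F. cmod (u \<alpha>)))"
    proof (rule bounded_integral(2))
      fix t
      have "norm ((cmod (h t))\<^sup>2 - (cmod (g t))\<^sup>2) = (cmod (h t) + cmod (g t)) * \<bar>cmod (h t) - cmod (g t)\<bar>"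
        by (simp add: power2_eq_square square_diff_square_factored abs_mult)
      also have "\<dots> \<le> (2 * S) * cmod (g t - h t)"
        using hS[of t] gS[of t] S0 norm_triangle_ineq3[of "h t" "g t"]
        by (intro mult_mono) (auto simp: norm_minus_commute)
      also have "\<dots> \<le> 2 * S * (S - (\<Sum>\<alpha>\<in>F. cmod (u \<alpha>)))"
        using gh[of t] S0 by (intro mult_left_mono) auto
      finally show "norm ((cmod (h t))\<^sup>2 - (cmod (g t))\<^sup>2) \<le> 2 * S * (S - (\<Sum>\<alpha>\<in>F. cmod (u \<alpha>)))" .
    qed simp
    finally show ?thesis .
  qed
  have "((\<lambda>F. 2 * S * (S - (\<Sum>\<alpha>\<in>F. cmod (u \<alpha>)))) \<longlongrightarrow> 2 * S * (S - S))
      (finite_subsets_at_top (indices_below N))"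
    using S unfolding has_sum_def by (intro tendsto_intros)
  then have "((\<lambda>F. (\<Sum>\<alpha>\<in>F. (cmod (u \<alpha>))\<^sup>2) - I) \<longlongrightarrow> 0) (finite_subsets_at_top (indices_below N))"
    by (intro Lim_null_comparison[OF eventually_finite_subsets_at_top_weakI[OF close]]) auto
  then have "((\<lambda>\<alpha>. (cmod (u \<alpha>))\<^sup>2) has_sum I) (indices_below N)"
    unfolding has_sum_def by (rule iffD2 [OF Lim_null])
  then show ?thesis by (simp add: norm_u I_def g_def)
qed

lemma continuous_on_torus_point: "continuous_on UNIV (torus_point N r)"
proof (rule continuous_on_coordinatewise_then_product)
  show "continuous_on UNIV (\<lambda>t. torus_point N r t j)" for j
    by (cases "j < N") (auto simp: torus_point_def intro!: continuous_intros continuous_on_product_coordinates)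
qed

lemma torus_point_in_open_polydisc:
  assumes "\<And>j. j < N \<Longrightarrow> 0 \<le> r j \<and> r j < R j"
  shows "torus_point N r t \<in> open_polydisc R N"
  using assms by (simp add: open_polydisc_def torus_point_def norm_mult)

text \<open>The difference of the two families expands the zero function, so by Parseval its
  weighted squares sum to zero.\<close>

lemma expands_on_unique:
  assumes R: "\<And>j. j < N \<Longrightarrow> 0 < R j"
    and c: "expands_on R N f c" and d: "expands_on R N f d" and \<alpha>: "\<alpha> \<in> indices_below N"
  shows "c \<alpha> = d \<alpha>"
proof -
  \<comment> \<open>Half the radii keep the torus inside the polydisc; the value 1 from N on makes r
    positive at every index.\<close>
  define r where "r j = (if j < N then R j / 2 else 1)" for j
  have r: "0 < r j" for j using R by (simp add: r_def)
  have in_disc: "torus_point N r t \<in> open_polydisc R N" for t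
    by (rule torus_point_in_open_polydisc) (use R in \<open>auto simp: r_def less_imp_le\<close>)
  have "((\<lambda>\<alpha>. (cmod (c \<alpha> - d \<alpha>) * mpow \<alpha> r)\<^sup>2) has_sum
      (LINT t|torus_measure N. (cmod ((\<lambda>_. 0) (torus_point N r t)))\<^sup>2)) (indices_below N)"
  proof (rule parseval)
    fix t
    have "((\<lambda>\<alpha>. c \<alpha> * mpow \<alpha> (torus_point N r t) + - (d \<alpha> * mpow \<alpha> (torus_point N r t))) has_sum
        (f (torus_point N r t) + - f (torus_point N r t))) (indices_below N)"
      using c d in_disc[of t] unfolding expands_on_def by (intro has_sum_add has_sum_uminusI) auto
    then show "((\<lambda>\<alpha>. (c \<alpha> - d \<alpha>) * mpow \<alpha> (torus_point N r t)) has_sum 0) (indices_below N)"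
      by (simp add: left_diff_distrib)
  qed (use r less_imp_le in auto)
  then have "((\<lambda>\<alpha>. (cmod (c \<alpha> - d \<alpha>) * mpow \<alpha> r)\<^sup>2) has_sum 0) (indices_below N)"
    by simp
  then have "(cmod (c \<alpha> - d \<alpha>) * mpow \<alpha> r)\<^sup>2 = 0"
    by (rule nonneg_has_sum_le_0D) (use \<alpha> in auto)
  then show ?thesis using mpow_pos[of r \<alpha>] r by simp
qed

text \<open>The closed polydisc is a product of closed discs and, from N on, of singletons, hence
  compact. The bound covers all of it because \<open>torus_cauchy\<close> also evaluates f where
  only some coordinates lie on their circles.\<close>

lemma bounded_on_torus:
  assumes cont: "continuous_on (open_polydisc R N) f" and r: "\<And>j. j < N \<Longrightarrow> r j < R j"
  obtains M where "0 \<le> M" "\<And>z. (\<And>j. j < N \<Longrightarrow> cmod (z j) \<le> r j) \<Longrightarrow> (\<And>j. j \<ge> N \<Longrightarrow> z j = 0) \<Longrightarrow> cmod (f z) \<le> M"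
proof -
  define K where "K = (\<Pi>\<^sub>E j\<in>UNIV. if j < N then cball (0::complex) (r j) else {0})"
  have "compactin euclidean K"
    unfolding K_def euclidean_product_topology [symmetric] compactin_PiE by simp
  then have "compact K" by simp
  moreover have "K \<subseteq> open_polydisc R N"
  proof
    fix z assume "z \<in> K"
    then have z: "z j \<in> (if j < N then cball 0 (r j) else {0})" for j
      by (simp add: K_def PiE_iff)
    show "z \<in> open_polydisc R N"
      unfolding open_polydisc_def
    proof (intro CollectI conjI allI impI)
      show "cmod (z j) < R j" if "j < N" for j
        using z[of j] r[OF that] that by simp
      show "z j = 0" if "N \<le> j" for j
        using z[of j] that by simp
    qed
  qed
  ultimately have "compact (f ` K)"
    using cont by (intro compact_continuous_image continuous_on_subset[OF cont])
  then obtain M where "\<And>w. w \<in> f ` K \<Longrightarrow> cmod w \<le> M"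
    using compact_imp_bounded bounded_iff by metis
  then have "cmod (f z) \<le> max M 0" if "\<And>j. j < N \<Longrightarrow> cmod (z j) \<le> r j" "\<And>j. j \<ge> N \<Longrightarrow> z j = 0" for z
    using that by (force simp: K_def PiE_iff le_max_iff_disj)
  then show ?thesis using that[of "max M 0"] by simp
qed

section \<open>Cauchy's formula on polydiscs\<close>

text \<open>Joint continuity is included because it supplies the measurability and the bounds for
  the iterated integrals.\<close>

definition separately_holomorphic :: "(nat \<Rightarrow> real) \<Rightarrow> nat \<Rightarrow> ((nat \<Rightarrow> complex) \<Rightarrow> complex) \<Rightarrow> bool" where
  "separately_holomorphic R N f \<longleftrightarrow> continuous_on (open_polydisc R N) f \<and>
    (\<forall>z\<in>open_polydisc R N. \<forall>j<N. (\<lambda>w. f (z(j := w))) holomorphic_on ball 0 (R j))"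

text \<open>The coordinates are moved to the circle one at a time by the one-variable Cauchy formula.\<close>

lemma torus_cauchy:
  assumes f: "separately_holomorphic R N f"
    and r: "\<And>j. j < N \<Longrightarrow> 0 < r j \<and> r j < R j"
    and z: "z \<in> open_polydisc r N" and "n \<le> N"
  shows "f z = (LINT t|torus_measure n. f (\<lambda>j. if j < n then of_real (r j) * cis (t j) else z j) *
    (\<Prod>j<n. 1 / (1 - z j / (of_real (r j) * cis (t j)))))"
  using \<open>n \<le> N\<close>
proof (induction n)
  case 0
  interpret prob_space "torus_measure 0" by (rule prob_space_torus)
  show ?case by (simp add: prob_space)
next
  case (Suc n)
  interpret prob_space "torus_measure (Suc n)" by (rule prob_space_torus)
  interpret P: product_sigma_finite "\<lambda>_::nat. circle_measure"
    by (simp add: product_sigma_finite_def prob_space_circle prob_space_imp_sigma_finite)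
  have cont: "continuous_on (open_polydisc R N) f"
    and hol: "\<And>z j. z \<in> open_polydisc R N \<Longrightarrow> j < N \<Longrightarrow> (\<lambda>w. f (z(j := w))) holomorphic_on ball 0 (R j)"
    using f by (auto simp: separately_holomorphic_def)
  have zr: "\<And>j. j < N \<Longrightarrow> cmod (z j) < r j" "\<And>j. j \<ge> N \<Longrightarrow> z j = 0"
    using z by (auto simp: open_polydisc_def)
  \<comment> \<open>The intermediate point: the first m coordinates are on their circles, the others
    still at z.\<close>
  define Q where "Q m t j = (if j < m then of_real (r j) * cis (t j) else z j)" for m and t :: "nat \<Rightarrow> real" and j
  define k where "k j s = 1 / (1 - z j / (of_real (r j) * cis s))" for j s
  have Q_le: "cmod (Q m t j) \<le> r j" if "j < N" for m t j
    using r[OF that] zr(1)[OF that] by (auto simp: Q_def norm_mult)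
  have Q_0: "Q m t j = 0" if "N \<le> j" "m \<le> N" for m t j
    using that zr(2)[OF that(1)] by (auto simp: Q_def)
  have Q_in: "Q m t \<in> open_polydisc R N" if "m \<le> N" for m t
    unfolding open_polydisc_def
  proof (intro CollectI conjI allI impI)
    show "cmod (Q m t j) < R j" if "j < N" for j
      using Q_le[OF that, of m t] r[OF that] by linarith
  qed (rule Q_0[OF _ that])
  obtain M where M: "0 \<le> M"
    "\<And>z. (\<And>j. j < N \<Longrightarrow> cmod (z j) \<le> r j) \<Longrightarrow> (\<And>j. j \<ge> N \<Longrightarrow> z j = 0) \<Longrightarrow> cmod (f z) \<le> M"
    using bounded_on_torus[OF cont, of r] r by blast
  have ratio: "cmod (z j / (of_real (r j) * cis s)) = cmod (z j) / r j" "cmod (z j) / r j < 1"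
    "of_real (r j) * cis s \<noteq> 0"
    if "j < N" for j s
    using r[OF that] zr(1)[OF that] by (auto simp: norm_divide norm_mult)
  have ne: "1 - z j / (of_real (r j) * cis s) \<noteq> 0" if "j < N" for j s
    using ratio(1)[OF that, of s] ratio(2)[OF that] by auto
  have k_le: "cmod (k j s) \<le> 1 / (1 - cmod (z j) / r j)" if "j < N" for j s
  proof -
    have "1 - cmod (z j) / r j \<le> cmod (1 - z j / (of_real (r j) * cis s))"
      using norm_triangle_ineq2[of 1 "z j / (of_real (r j) * cis s)"] ratio(1)[OF that, of s] ratio(2)[OF that] by simp
    then show ?thesis
      using ratio(2)[OF that] unfolding k_def norm_divide by (auto intro!: divide_left_mono mult_pos_pos)
  qed
  have k_cont: "continuous_on UNIV (\<lambda>t. k j (t j))" if "j < N" for j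
    unfolding k_def using ne[OF that] ratio(3)[OF that]
    by (intro continuous_intros continuous_on_product_coordinates) auto
  have Q_cont: "continuous_on UNIV (\<lambda>t. Q m t)" for m
  proof (rule continuous_on_coordinatewise_then_product)
    show "continuous_on UNIV (\<lambda>t. Q m t j)" for j
      by (cases "j < m") (auto simp: Q_def intro!: continuous_intros continuous_on_product_coordinates)
  qed
  let ?H = "\<lambda>t. f (Q (Suc n) t) * (\<Prod>j<Suc n. k j (t j))"
  have int: "integrable (torus_measure (Suc n)) ?H"
  proof (rule bounded_integral(1))
    show "?H \<in> borel_measurable (torus_measure (Suc n))"
    proof (rule torus_borel_measurable)
      have "continuous_on UNIV (\<lambda>t. f (Q (Suc n) t))"
        by (rule continuous_on_compose2[OF cont Q_cont]) (use Q_in[OF Suc.prems] in auto)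
      then show "continuous_on UNIV ?H"
        using Suc.prems by (intro continuous_on_mult continuous_on_prod k_cont) auto
      fix t t' :: "nat \<Rightarrow> real" assume "\<And>j. j < Suc n \<Longrightarrow> t j = t' j"
      then have "Q (Suc n) t = Q (Suc n) t'" "(\<Prod>j<Suc n. k j (t j)) = (\<Prod>j<Suc n. k j (t' j))"
        by (auto simp: Q_def fun_eq_iff intro!: prod.cong)
      then show "?H t = ?H t'" by simp
    qed
    show "norm (?H t) \<le> M * (\<Prod>j<Suc n. 1 / (1 - cmod (z j) / r j))" for t
      unfolding norm_mult prod_norm [symmetric] using M(1) k_le Suc.prems Q_le Q_0[OF _ Suc.prems]
      by (intro mult_mono prod_mono prod_nonneg M(2)) auto
  qed
  have split: "?H (x(n := s)) = (\<Prod>j<n. k j (x j)) * (f ((Q n x)(n := of_real (r n) * cis s)) * k n s)" for x s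
  proof -
    have "Q (Suc n) (x(n := s)) = (Q n x)(n := of_real (r n) * cis s)"
      by (auto simp: Q_def fun_eq_iff less_Suc_eq)
    moreover have "(\<Prod>j<Suc n. k j ((x(n := s)) j)) = (\<Prod>j<n. k j (x j)) * k n s"
      by simp
    ultimately show ?thesis by simp
  qed
  \<comment> \<open>This is Cauchy's formula with w = z n; setting coordinate n of
    \<open>Q n x\<close> to z n changes nothing.\<close>
  have inner: "(LINT s|circle_measure. ?H (x(n := s))) = f (Q n x) * (\<Prod>j<n. k j (x j))" for x
  proof -
    have "(LINT s|circle_measure. f ((Q n x)(n := of_real (r n) * cis s)) * k n s) = f ((Q n x)(n := z n))"
      unfolding k_def
      by (rule cauchy_circle[OF hol]) (use Suc.prems r zr Q_in in auto)
    moreover have "(Q n x)(n := z n) = Q n x"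
      by (auto simp: Q_def fun_eq_iff)
    ultimately show ?thesis
      unfolding split by simp
  qed
  have "(LINT t|torus_measure (Suc n). ?H t) =
      (LINT x|torus_measure n. LINT s|circle_measure. ?H (x(n := s)))"
    using int unfolding torus_measure_def lessThan_Suc
    by (intro P.product_integral_insert) auto
  also have "\<dots> = (LINT x|torus_measure n. f (Q n x) * (\<Prod>j<n. k j (x j)))"
    by (simp only: inner)
  also have "\<dots> = f z"
    using Suc by (simp add: Q_def [abs_def] k_def)
  finally show ?case by (simp add: Q_def [abs_def] k_def)
qed

text \<open>Each factor of the kernel in \<open>torus_cauchy\<close> is a geometric series in z j /
  (r j * cis (t j)). The modulus of this ratio does not depend on t, so the error of a partial sum
  is at most M times the tail of a numerical series, uniformly on the torus.\<close>

lemma expansion_at_radius: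
  assumes f: "separately_holomorphic R N f"
    and r: "\<And>j. j < N \<Longrightarrow> 0 < r j \<and> r j < R j"
  shows "\<exists>c. expands_on r N f c"
proof -
  interpret prob_space "torus_measure N" by (rule prob_space_torus)
  define \<phi> where "\<phi> t = f (torus_point N r t)" for t
  \<comment> \<open>Cauchy's coefficient integral. It does not mention z, so one family serves the
    whole polydisc.\<close>
  define c where "c \<alpha> = (LINT t|torus_measure N. \<phi> t * mpow \<alpha> (\<lambda>j. 1 / (of_real (r j) * cis (t j))))" for \<alpha>
  have cont: "continuous_on (open_polydisc R N) f"
    using f by (simp add: separately_holomorphic_def)
  obtain M where M: "0 \<le> M"
    "\<And>z. (\<And>j. j < N \<Longrightarrow> cmod (z j) \<le> r j) \<Longrightarrow> (\<And>j. j \<ge> N \<Longrightarrow> z j = 0) \<Longrightarrow> cmod (f z) \<le> M"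
    using bounded_on_torus[OF cont, of r] r by blast
  have r': "0 \<le> r j \<and> r j < R j" if "j < N" for j
    using r[OF that] by simp
  have \<phi>_le: "cmod (\<phi> t) \<le> M" for t
    unfolding \<phi>_def by (rule M(2)) (use r' in \<open>auto simp: torus_point_def norm_mult\<close>)
  have \<phi>_meas [measurable]: "\<phi> \<in> borel_measurable (torus_measure N)"
  proof (rule torus_borel_measurable)
    show "continuous_on UNIV \<phi>"
      unfolding \<phi>_def [abs_def]
      by (rule continuous_on_compose2[OF cont continuous_on_torus_point])
        (use r' in \<open>auto intro!: torus_point_in_open_polydisc\<close>)
    show "\<phi> t = \<phi> t'" if "\<And>j. j < N \<Longrightarrow> t j = t' j" for t t'
      using that by (simp add: \<phi>_def torus_point_def cong: if_cong)
  qed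
  have "((\<lambda>\<alpha>. c \<alpha> * mpow \<alpha> z) has_sum f z) (indices_below N)" if z: "z \<in> open_polydisc r N" for z
  proof -
    have zr: "\<And>j. j < N \<Longrightarrow> cmod (z j) < r j" "\<And>j. j \<ge> N \<Longrightarrow> z j = 0"
      using z by (auto simp: open_polydisc_def)
    define w where "w t j = z j / (of_real (r j) * cis (t j))" for t :: "nat \<Rightarrow> real" and j
    define K where "K t = (\<Prod>j<N. 1 / (1 - w t j))" for t
    define \<rho> where "\<rho> j = cmod (z j) / r j" for j
    have \<rho>: "norm (\<rho> j) < 1" if "j < N" for j
      using zr(1)[OF that] r[OF that] by (simp add: \<rho>_def)
    then have \<rho>': "\<rho> j < 1" if "j < N" for j
      using that abs_less_iff by (metis real_norm_def)
    have w_norm: "cmod (w t j) = \<rho> j" if "j < N" for t j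
      using r[OF that] by (simp add: w_def \<rho>_def norm_divide norm_mult)
    have K: "((\<lambda>\<alpha>. mpow \<alpha> (w t)) has_sum K t) (indices_below N)" for t
      unfolding K_def by (rule geometric_multi_series) (use \<rho>' w_norm in auto)
    have norm_w: "norm (mpow \<alpha> (w t)) = mpow \<alpha> \<rho>" if "\<alpha> \<in> indices_below N" for \<alpha> t
      unfolding norm_mpow using that w_norm by (intro mpow_cong) auto
    define S where "S = (\<Prod>j<N. 1 / (1 - \<rho> j))"
    have S: "((\<lambda>\<alpha>. mpow \<alpha> \<rho>) has_sum S) (indices_below N)"
      unfolding S_def by (rule geometric_multi_series) (use \<rho> in auto)
    have Sw: "((\<lambda>\<alpha>. norm (mpow \<alpha> (w t))) has_sum S) (indices_below N)" for t
    proof -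
      have "((\<lambda>\<alpha>. norm (mpow \<alpha> (w t))) has_sum S) (indices_below N) \<longleftrightarrow>
          ((\<lambda>\<alpha>. mpow \<alpha> \<rho>) has_sum S) (indices_below N)"
        by (rule has_sum_cong) (rule norm_w)
      then show ?thesis using S by simp
    qed
    have w_meas: "(\<lambda>t. mpow \<alpha> (w t)) \<in> borel_measurable (torus_measure N)" if "\<alpha> \<in> indices_below N" for \<alpha>
    proof (rule torus_borel_measurable)
      show "continuous_on UNIV (\<lambda>t. mpow \<alpha> (w t))"
        unfolding mpow_def w_def
      proof (intro continuous_intros continuous_on_product_coordinates ballI)
        fix j and t :: "nat \<Rightarrow> real" assume "j \<in> Poly_Mapping.keys \<alpha>"
        then have "r j > 0" using that r by auto
        then show "complex_of_real (r j) * cis (t j) \<noteq> 0" by simp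
      qed
      fix t t' :: "nat \<Rightarrow> real" assume eq: "\<And>j. j < N \<Longrightarrow> t j = t' j"
      show "mpow \<alpha> (w t) = mpow \<alpha> (w t')"
      proof (rule mpow_cong)
        fix j assume "j \<in> Poly_Mapping.keys \<alpha>"
        with that have "j < N" by auto
        then show "w t j = w t' j" using eq by (simp add: w_def)
      qed
    qed
    have c_eq: "c \<alpha> * mpow \<alpha> z = (LINT t|torus_measure N. \<phi> t * mpow \<alpha> (w t))" for \<alpha>
    proof -
      have "mpow \<alpha> (w t) = mpow \<alpha> z * mpow \<alpha> (\<lambda>j. 1 / (of_real (r j) * cis (t j)))" for t
        unfolding mpow_mult [symmetric] by (simp add: w_def [abs_def])
      then have "(LINT t|torus_measure N. \<phi> t * mpow \<alpha> (w t)) =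
          (LINT t|torus_measure N. (\<phi> t * mpow \<alpha> (\<lambda>j. 1 / (of_real (r j) * cis (t j)))) * mpow \<alpha> z)"
        by (simp add: mult_ac)
      then show ?thesis by (simp add: c_def)
    qed
    have int: "integrable (torus_measure N) (\<lambda>t. \<phi> t * mpow \<alpha> (w t))" if "\<alpha> \<in> indices_below N" for \<alpha>
    proof (rule bounded_integral(1))
      show "(\<lambda>t. \<phi> t * mpow \<alpha> (w t)) \<in> borel_measurable (torus_measure N)"
        using \<phi>_meas w_meas[OF that] by (rule borel_measurable_times)
      show "norm (\<phi> t * mpow \<alpha> (w t)) \<le> M * mpow \<alpha> \<rho>" for t
        unfolding norm_mult norm_w[OF that]
        using \<phi>_le norm_w[OF that, of t, symmetric] by (intro mult_right_mono) auto
    qed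
    have fz: "f z = (LINT t|torus_measure N. \<phi> t * K t)"
    proof -
      have "(\<lambda>j. if j < N then of_real (r j) * cis (t j) else z j) = torus_point N r t" for t
        using zr(2) by (auto simp: torus_point_def)
      then show ?thesis
        using torus_cauchy[OF f r z order_refl] by (simp add: \<phi>_def K_def w_def)
    qed
    have K_meas: "K \<in> borel_measurable (torus_measure N)"
    proof (rule torus_borel_measurable)
      show "continuous_on UNIV K"
        unfolding K_def [abs_def] w_def
      proof (intro continuous_intros continuous_on_product_coordinates ballI)
        fix j and t :: "nat \<Rightarrow> real" assume "j \<in> {..<N}"
        then have j: "j < N" by simp
        show "complex_of_real (r j) * cis (t j) \<noteq> 0" using r[OF j] by simp
        show "1 - z j / (complex_of_real (r j) * cis (t j)) \<noteq> 0"
          using w_norm[OF j, of t] \<rho>'[OF j] by (auto simp: w_def)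
      qed
      show "K t = K t'" if "\<And>j. j < N \<Longrightarrow> t j = t' j" for t t'
        using that by (simp add: K_def w_def)
    qed
    have K_int: "integrable (torus_measure N) (\<lambda>t. \<phi> t * K t)"
    proof (rule bounded_integral(1))
      show "(\<lambda>t. \<phi> t * K t) \<in> borel_measurable (torus_measure N)"
        using \<phi>_meas K_meas by (rule borel_measurable_times)
      have "cmod (K t) \<le> S" for t
        using has_sum_tail_bound[OF K Sw, of "{}"] by simp
      then show "norm (\<phi> t * K t) \<le> M * S" for t
        unfolding norm_mult using \<phi>_le M(1) by (intro mult_mono) auto
    qed
    have close: "norm ((\<Sum>\<alpha>\<in>F. c \<alpha> * mpow \<alpha> z) - f z) \<le> M * (S - (\<Sum>\<alpha>\<in>F. mpow \<alpha> \<rho>))"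
      if F: "finite F" "F \<subseteq> indices_below N" for F
    proof -
      have Fint: "integrable (torus_measure N) (\<lambda>t. \<Sum>\<alpha>\<in>F. \<phi> t * mpow \<alpha> (w t))"
        using int F by (intro Bochner_Integration.integrable_sum) auto
      have "(\<Sum>\<alpha>\<in>F. c \<alpha> * mpow \<alpha> z) = (LINT t|torus_measure N. (\<Sum>\<alpha>\<in>F. \<phi> t * mpow \<alpha> (w t)))"
        unfolding c_eq using int F by (intro Bochner_Integration.integral_sum [symmetric]) auto
      then have "(\<Sum>\<alpha>\<in>F. c \<alpha> * mpow \<alpha> z) - f z =
          (LINT t|torus_measure N. (\<Sum>\<alpha>\<in>F. \<phi> t * mpow \<alpha> (w t)) - \<phi> t * K t)"
        unfolding fz using Fint K_int by simp
      also have "norm \<dots> \<le> M * (S - (\<Sum>\<alpha>\<in>F. mpow \<alpha> \<rho>))"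
      proof (rule bounded_integral(2))
        show "(\<lambda>t. (\<Sum>\<alpha>\<in>F. \<phi> t * mpow \<alpha> (w t)) - \<phi> t * K t) \<in> borel_measurable (torus_measure N)"
          using Fint K_int by (intro borel_measurable_diff borel_measurable_integrable)
        fix t
        have "norm ((\<Sum>\<alpha>\<in>F. \<phi> t * mpow \<alpha> (w t)) - \<phi> t * K t) =
            cmod (\<phi> t) * cmod (K t - (\<Sum>\<alpha>\<in>F. mpow \<alpha> (w t)))"
          by (simp add: norm_mult [symmetric] right_diff_distrib sum_distrib_left norm_minus_commute)
        also have "\<dots> \<le> M * (S - (\<Sum>\<alpha>\<in>F. norm (mpow \<alpha> (w t))))"
          using \<phi>_le M(1) has_sum_tail_bound[OF K Sw F] by (intro mult_mono) auto
        also have "(\<Sum>\<alpha>\<in>F. norm (mpow \<alpha> (w t))) = (\<Sum>\<alpha>\<in>F. mpow \<alpha> \<rho>)"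
          using norm_w F by (intro sum.cong) auto
        finally show "norm ((\<Sum>\<alpha>\<in>F. \<phi> t * mpow \<alpha> (w t)) - \<phi> t * K t) \<le> M * (S - (\<Sum>\<alpha>\<in>F. mpow \<alpha> \<rho>))" .
      qed
      finally show ?thesis .
    qed
    have "((\<lambda>F. M * (S - (\<Sum>\<alpha>\<in>F. mpow \<alpha> \<rho>))) \<longlongrightarrow> M * (S - S)) (finite_subsets_at_top (indices_below N))"
      using S unfolding has_sum_def by (intro tendsto_intros)
    then have "((\<lambda>F. (\<Sum>\<alpha>\<in>F. c \<alpha> * mpow \<alpha> z) - f z) \<longlongrightarrow> 0) (finite_subsets_at_top (indices_below N))"
      by (intro Lim_null_comparison[OF eventually_finite_subsets_at_top_weakI[OF close]]) auto
    then show ?thesis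
      unfolding has_sum_def by (rule iffD2 [OF Lim_null])
  qed
  then show ?thesis unfolding expands_on_def by blast
qed

lemma expands_on_subset:
  assumes "expands_on R N f c" "\<And>j. j < N \<Longrightarrow> r j \<le> R j"
  shows "expands_on r N f c"
proof -
  have "open_polydisc r N \<subseteq> open_polydisc R N"
    using assms(2) by (force simp: open_polydisc_def)
  then show ?thesis using assms(1) by (auto simp: expands_on_def)
qed

text \<open>The coefficients obtained at different radii agree by uniqueness.\<close>

lemma polydisc_expansion:
  assumes f: "separately_holomorphic R N f" and R: "\<And>j. j < N \<Longrightarrow> 0 < R j"
  shows "\<exists>c. expands_on R N f c"
proof -
  define r0 where "r0 j = R j / 2" for j
  have r0: "0 < r0 j \<and> r0 j < R j" if "j < N" for j
    using R[OF that] by (simp add: r0_def)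
  obtain c where c: "expands_on r0 N f c"
    using expansion_at_radius[OF f r0] by blast
  have "((\<lambda>\<alpha>. c \<alpha> * mpow \<alpha> z) has_sum f z) (indices_below N)" if z: "z \<in> open_polydisc R N" for z
  proof -
    \<comment> \<open>Midway between R and the larger of the modulus of z j and r0 j: the polydisc
      of these radii contains z and the reference polydisc on which c was found.\<close>
    define r where "r j = (max (cmod (z j)) (r0 j) + R j) / 2" for j
    have zR: "cmod (z j) < R j" if "j < N" for j
      using z that by (simp add: open_polydisc_def)
    have r: "0 < r j \<and> r j < R j" "r0 j \<le> r j" "cmod (z j) < r j" if "j < N" for j
      using r0[OF that] zR[OF that] by (auto simp: r_def)
    obtain d where d: "expands_on r N f d"
      using expansion_at_radius[OF f r(1)] by blast
    have "c \<alpha> = d \<alpha>" if "\<alpha> \<in> indices_below N" for \<alpha>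
      by (rule expands_on_unique[OF _ c expands_on_subset[OF d] that]) (use r0 r(2) in auto)
    then have "((\<lambda>\<alpha>. c \<alpha> * mpow \<alpha> z) has_sum f z) (indices_below N) \<longleftrightarrow>
        ((\<lambda>\<alpha>. d \<alpha> * mpow \<alpha> z) has_sum f z) (indices_below N)"
      by (intro has_sum_cong) simp
    moreover have "z \<in> open_polydisc r N"
      using z r(3) by (auto simp: open_polydisc_def)
    ultimately show ?thesis using d by (simp add: expands_on_def)
  qed
  then show ?thesis unfolding expands_on_def by blast
qed

section \<open>Coefficients and Hardy norms\<close>

definition polyradius :: "nat \<Rightarrow> nat \<Rightarrow> real" where
  "polyradius k j = 1 / prime_weight k j"

lemma polyradius_pos: "0 < polyradius k j"
  by (simp add: polyradius_def prime_weight_pos)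

lemma less_polyradius_iff: "x < polyradius k j \<longleftrightarrow> x * prime_weight k j < 1"
  using prime_weight_pos[of k j] by (simp add: polyradius_def pos_less_divide_eq)

lemma polyradius_mono: "1 \<le> k \<Longrightarrow> polyradius 1 j \<le> polyradius k j"
proof -
  assume k: "1 \<le> k"
  have "prime_weight k j \<le> prime_weight 1 j"
    unfolding prime_weight_def using k prime_ge_1_nat[OF prime_nth_prime[of j]]
    by (intro powr_mono) (auto simp: field_simps)
  then show ?thesis
    unfolding polyradius_def using prime_weight_pos by (intro divide_left_mono) auto
qed

lemma mpow_polyradius: "mpow \<alpha> (polyradius k) = 1 / mpow \<alpha> (prime_weight k)"
  by (simp add: mpow_def polyradius_def prod_dividef power_one_over)

lemma power_series_expansion_iff:
  "power_series_expansion k N f c \<longleftrightarrow> expands_on (polyradius k) N f c"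
proof -
  have "polydisc k N = open_polydisc (polyradius k) N"
    by (auto simp: polydisc_def open_polydisc_def polyradius_def)
  then show ?thesis
    by (simp add: power_series_expansion_def expands_on_def monomial_eq_mpow)
qed

section \<open>Finitely supported points and restriction to polydiscs\<close>

lemma finite_support_ell2:
  assumes "\<And>j. j \<ge> N \<Longrightarrow> z j = 0"
  shows "z \<in> ell2 k" "ell2_norm k z = sqrt (\<Sum>j<N. (cmod (z j) * prime_weight k j)\<^sup>2)"
proof -
  have sums: "(\<lambda>j. (cmod (z j) * prime_weight k j)\<^sup>2) sums (\<Sum>j<N. (cmod (z j) * prime_weight k j)\<^sup>2)"
    by (rule sums_finite) (use assms in \<open>auto simp: not_less\<close>)
  then show 2: "z \<in> ell2 k" by (auto simp: ell2_iff sums_iff)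
  have "(ell2_norm k z)\<^sup>2 = (\<Sum>j<N. (cmod (z j) * prime_weight k j)\<^sup>2)"
    unfolding ell2_norm_sq[OF 2] using sums by (simp add: sums_iff)
  then show "ell2_norm k z = sqrt (\<Sum>j<N. (cmod (z j) * prime_weight k j)\<^sup>2)"
    using ell2_norm_nonneg[OF 2] by (metis real_sqrt_unique)
qed

lemma open_polydisc_in_R_dom: "open_polydisc (polyradius k) N \<subseteq> R_dom k"
proof
  fix z assume z: "z \<in> open_polydisc (polyradius k) N"
  define s where "s = Max (insert 0 ((\<lambda>j. cmod (z j) * prime_weight k j) ` {..<N}))"
  have "cmod (z j) * prime_weight k j \<le> s" for j
  proof (cases "j < N")
    case True
    then show ?thesis unfolding s_def by (intro Max_ge) auto
  next
    case False
    then show ?thesis using z unfolding s_def by (simp add: open_polydisc_def)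
  qed
  moreover have "s < 1"
    unfolding s_def using z by (subst Max_less_iff) (auto simp: open_polydisc_def less_polyradius_iff)
  moreover have "z \<in> ell2 k"
    by (rule finite_support_ell2[of N]) (use z in \<open>auto simp: open_polydisc_def\<close>)
  ultimately show "z \<in> R_dom k" unfolding R_dom_iff by blast
qed

lemma frechet_differentiable_imp_continuous:
  assumes "frechet_differentiable_at k f z" "0 < \<epsilon>"
  shows "\<exists>\<delta>>0. \<forall>h\<in>ell2 k. (\<lambda>j. z j + h j) \<in> R_dom k \<and> ell2_norm k h < \<delta> \<longrightarrow>
    cmod (f (\<lambda>j. z j + h j) - f z) < \<epsilon>"
proof -
  obtain L where "bounded_linear_functional k L" and L: "\<forall>\<epsilon>>0. \<exists>\<delta>>0. \<forall>h\<in>ell2 k.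
      (\<lambda>j. z j + h j) \<in> R_dom k \<and> ell2_norm k h < \<delta> \<longrightarrow>
      cmod (f (\<lambda>j. z j + h j) - f z - L h) \<le> \<epsilon> * ell2_norm k h"
    using assms(1) unfolding frechet_differentiable_at_def by blast
  then obtain C where C: "\<And>h. h \<in> ell2 k \<Longrightarrow> cmod (L h) \<le> C * ell2_norm k h"
    unfolding bounded_linear_functional_def by blast
  obtain \<delta> where \<delta>: "\<delta> > 0" "\<And>h. h \<in> ell2 k \<Longrightarrow> (\<lambda>j. z j + h j) \<in> R_dom k \<Longrightarrow> ell2_norm k h < \<delta> \<Longrightarrow>
      cmod (f (\<lambda>j. z j + h j) - f z - L h) \<le> 1 * ell2_norm k h"
    using L[rule_format, of 1] by auto
  \<comment> \<open>The increment of f is at most (1 + C) times the norm of h;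
    \<open>\<bar>C\<bar> + 2\<close> is a positive upper bound for 1 + C whatever the sign of
    C.\<close>
  define \<eta> where "\<eta> = min \<delta> (\<epsilon> / (\<bar>C\<bar> + 2))"
  have "\<eta> > 0" using \<delta>(1) assms(2) by (simp add: \<eta>_def)
  moreover have "cmod (f (\<lambda>j. z j + h j) - f z) < \<epsilon>"
    if h: "h \<in> ell2 k" "(\<lambda>j. z j + h j) \<in> R_dom k" "ell2_norm k h < \<eta>" for h
  proof -
    have "cmod (f (\<lambda>j. z j + h j) - f z) \<le> cmod (f (\<lambda>j. z j + h j) - f z - L h) + cmod (L h)"
      using norm_triangle_ineq[of "f (\<lambda>j. z j + h j) - f z - L h" "L h"] by simp
    also have "\<dots> \<le> 1 * ell2_norm k h + C * ell2_norm k h"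
      using h by (intro add_mono \<delta>(2) C) (auto simp: \<eta>_def)
    also have "\<dots> \<le> (\<bar>C\<bar> + 2) * ell2_norm k h"
      unfolding distrib_right [symmetric] using ell2_norm_nonneg[OF h(1)]
      by (intro mult_right_mono) auto
    also have "\<dots> < (\<bar>C\<bar> + 2) * (\<epsilon> / (\<bar>C\<bar> + 2))"
      using h(3) by (intro mult_strict_left_mono) (auto simp: \<eta>_def)
    also have "\<dots> = \<epsilon>" by (simp add: field_simps)
    finally show ?thesis .
  qed
  ultimately show ?thesis by blast
qed

text \<open>On differences supported in the first N coordinates the norm of \<open>ell2 k\<close> is
  a finite weighted Euclidean norm, so coordinatewise convergence suffices for continuity. The
  derivative in one variable is the Frechet derivative applied to a unit vector.\<close>

lemma holomorphic_imp_separately_holomorphic: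
  assumes f: "holomorphic_on_R k f"
  shows "separately_holomorphic (polyradius k) N f"
  unfolding separately_holomorphic_def
proof (intro conjI ballI allI impI)
  let ?P = "open_polydisc (polyradius k) N"
  have frechet: "frechet_differentiable_at k f z" if "z \<in> ?P" for z
    using f that open_polydisc_in_R_dom unfolding holomorphic_on_R_def by blast
  show "continuous_on ?P f"
    unfolding continuous_on_def
  proof
    fix z assume z: "z \<in> ?P"
    have coord: "((\<lambda>x. x j) \<longlongrightarrow> z j) (at z within ?P)" for j
    proof (rule tendsto_within_subset [OF _ subset_UNIV])
      have "continuous_on UNIV (\<lambda>x::nat \<Rightarrow> complex. x j)" by simp
      then show "((\<lambda>x. x j) \<longlongrightarrow> z j) (at z)" unfolding continuous_on_def by blast
    qed
    have "((\<lambda>x. sqrt (\<Sum>j<N. (cmod (x j - z j) * prime_weight k j)\<^sup>2)) \<longlongrightarrow>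
        sqrt (\<Sum>j<N. (cmod (z j - z j) * prime_weight k j)\<^sup>2)) (at z within ?P)"
      by (intro tendsto_intros coord)
    then have small: "((\<lambda>x. sqrt (\<Sum>j<N. (cmod (x j - z j) * prime_weight k j)\<^sup>2)) \<longlongrightarrow> 0) (at z within ?P)"
      by simp
    show "(f \<longlongrightarrow> f z) (at z within ?P)"
    proof (rule tendstoI)
      fix \<epsilon> :: real assume "0 < \<epsilon>"
      then obtain \<delta> where \<delta>: "\<delta> > 0" "\<And>h. h \<in> ell2 k \<Longrightarrow> (\<lambda>j. z j + h j) \<in> R_dom k \<Longrightarrow>
          ell2_norm k h < \<delta> \<Longrightarrow> cmod (f (\<lambda>j. z j + h j) - f z) < \<epsilon>"
        using frechet_differentiable_imp_continuous[OF frechet[OF z]] by blast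
      have "eventually (\<lambda>x. x \<in> ?P) (at z within ?P)"
        by (simp add: eventually_at_filter)
      moreover have "eventually (\<lambda>x. sqrt (\<Sum>j<N. (cmod (x j - z j) * prime_weight k j)\<^sup>2) < \<delta>) (at z within ?P)"
        using small \<delta>(1) by (rule order_tendstoD(2))
      ultimately show "eventually (\<lambda>x. dist (f x) (f z) < \<epsilon>) (at z within ?P)"
      proof eventually_elim
        case (elim x)
        have zero: "\<And>j. N \<le> j \<Longrightarrow> x j - z j = 0"
          using elim(1) z by (simp add: open_polydisc_def)
        note fs = finite_support_ell2[of N "\<lambda>j. x j - z j" k, OF zero]
        have "cmod (f (\<lambda>j. z j + (x j - z j)) - f z) < \<epsilon>"
          using fs elim open_polydisc_in_R_dom by (intro \<delta>(2)) auto
        then show ?case by (simp add: dist_norm)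
      qed
    qed
  qed
  fix z j assume z: "z \<in> ?P" and j: "j < N"
  show "(\<lambda>w. f (z(j := w))) holomorphic_on ball 0 (polyradius k j)"
  proof (rule holomorphic_onI)
    fix w :: complex assume w: "w \<in> ball 0 (polyradius k j)"
    have in_P: "z(j := y) \<in> ?P" if "cmod y < polyradius k j" for y
      using z that j by (auto simp: open_polydisc_def)
    obtain L where bl: "bounded_linear_functional k L" and L: "\<And>\<epsilon>. \<epsilon> > 0 \<Longrightarrow> \<exists>\<delta>>0. \<forall>h\<in>ell2 k.
        (\<lambda>i. (z(j := w)) i + h i) \<in> R_dom k \<and> ell2_norm k h < \<delta> \<longrightarrow>
        cmod (f (\<lambda>i. (z(j := w)) i + h i) - f (z(j := w)) - L h) \<le> \<epsilon> * ell2_norm k h"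
      using frechet[OF in_P[of w]] w unfolding frechet_differentiable_at_def by auto
    \<comment> \<open>The multiple \<eta> of unit vector j; its norm is the modulus of \<eta> times
      the weight.\<close>
    define h where "h \<eta> i = (if i = j then \<eta> else 0)" for \<eta> :: complex and i
    have h: "h \<eta> \<in> ell2 k" "ell2_norm k (h \<eta>) = cmod \<eta> * prime_weight k j" for \<eta>
    proof -
      have zero: "\<And>i. N \<le> i \<Longrightarrow> h \<eta> i = 0" using j by (simp add: h_def)
      show "h \<eta> \<in> ell2 k" by (rule finite_support_ell2[OF zero])
      have "(\<Sum>i<N. (cmod (h \<eta> i) * prime_weight k i)\<^sup>2) =
          (\<Sum>i<N. if i = j then (cmod \<eta> * prime_weight k j)\<^sup>2 else 0)"
        by (rule sum.cong) (auto simp: h_def)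
      also have "\<dots> = (cmod \<eta> * prime_weight k j)\<^sup>2" using j by (simp add: sum.delta')
      finally show "ell2_norm k (h \<eta>) = cmod \<eta> * prime_weight k j"
        using finite_support_ell2(2)[of N "h \<eta>" k, OF zero] prime_weight_pos[of k j] by simp
    qed
    have L_h: "L (h \<eta>) = L (h 1) * \<eta>" for \<eta>
    proof -
      have "h \<eta> = (\<lambda>i. \<eta> * h 1 i)" by (simp add: h_def fun_eq_iff)
      then show ?thesis using bl h(1)[of 1] by (simp add: bounded_linear_functional_def)
    qed
    have shift: "(\<lambda>i. (z(j := w)) i + h (y - w) i) = z(j := y)" for y
      by (auto simp: h_def fun_eq_iff)
    have "((\<lambda>y. f (z(j := y))) has_field_derivative L (h 1)) (at w)"
      unfolding has_field_derivative_def has_derivative_at_alt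
    proof (intro conjI allI impI bounded_linear_mult_right)
      fix \<epsilon> :: real assume \<epsilon>: "0 < \<epsilon>"
      then have "\<epsilon> / prime_weight k j > 0" using prime_weight_pos[of k j] by simp
      from L[OF this] obtain \<delta> where \<delta>: "\<delta> > 0" "\<And>h. h \<in> ell2 k \<Longrightarrow>
        (\<lambda>i. (z(j := w)) i + h i) \<in> R_dom k \<Longrightarrow> ell2_norm k h < \<delta> \<Longrightarrow>
        cmod (f (\<lambda>i. (z(j := w)) i + h i) - f (z(j := w)) - L h) \<le> (\<epsilon> / prime_weight k j) * ell2_norm k h"
        by blast
      \<comment> \<open>The first entry makes the norm of the increment smaller than \<delta>, the
        second keeps y in the disc.\<close>
      define d where "d = min (\<delta> / prime_weight k j) (polyradius k j - cmod w)"
      have "d > 0" using \<delta>(1) w prime_weight_pos[of k j] by (simp add: d_def)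
      moreover have "cmod (f (z(j := y)) - f (z(j := w)) - L (h 1) * (y - w)) \<le> \<epsilon> * cmod (y - w)"
        if y: "cmod (y - w) < d" for y
      proof -
        have "cmod y \<le> cmod (y - w) + cmod w" using norm_triangle_ineq[of "y - w" w] by simp
        then have "cmod y < polyradius k j" using y by (simp add: d_def)
        then have "z(j := y) \<in> R_dom k" using in_P open_polydisc_in_R_dom by blast
        moreover have "cmod (y - w) * prime_weight k j < \<delta>"
          using y prime_weight_pos[of k j] by (simp add: d_def pos_less_divide_eq)
        ultimately have "cmod (f (z(j := y)) - f (z(j := w)) - L (h (y - w))) \<le>
            (\<epsilon> / prime_weight k j) * (cmod (y - w) * prime_weight k j)"
          using \<delta>(2)[OF h(1)[of "y - w"], unfolded shift h(2)] by blast
        also have "\<dots> = \<epsilon> * cmod (y - w)" using prime_weight_pos[of k j] by simp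
        finally show ?thesis unfolding L_h [of "y - w"] .
      qed
      ultimately show "\<exists>d>0. \<forall>y. cmod (y - w) < d \<longrightarrow>
          cmod (f (z(j := y)) - f (z(j := w)) - L (h 1) * (y - w)) \<le> \<epsilon> * cmod (y - w)"
        by blast
    qed
    then show "(\<lambda>w. f (z(j := w))) field_differentiable at w within ball 0 (polyradius k j)"
      using field_differentiable_at_within field_differentiable_def by blast
  qed
qed

text \<open>Padding with zeros puts the smaller polydisc into the larger one, where monomials
  involving later variables vanish. Expansions in different numbers of variables thereby become
  comparable.\<close>

lemma expands_on_fewer_variables:
  assumes "expands_on R N' f c" "N \<le> N'" and R: "\<And>j. j < N' \<Longrightarrow> 0 < R j"
  shows "expands_on R N f c"
  unfolding expands_on_def
proof
  fix z assume z: "z \<in> open_polydisc R N"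
  have "cmod (z j) < R j" if "j < N'" for j
    using z R[OF that] by (cases "j < N") (auto simp: open_polydisc_def)
  then have "z \<in> open_polydisc R N'"
    using z assms(2) by (auto simp: open_polydisc_def)
  then have "((\<lambda>\<alpha>. c \<alpha> * mpow \<alpha> z) has_sum f z) (indices_below N')"
    using assms(1) by (simp add: expands_on_def)
  moreover have "c \<alpha> * mpow \<alpha> z = 0" if "\<alpha> \<notin> indices_below N" for \<alpha>
    using mpow_eq_0[OF that, of z] z by (simp add: open_polydisc_def)
  moreover have "indices_below N \<subseteq> indices_below N'" using assms(2) by auto
  ultimately show "((\<lambda>\<alpha>. c \<alpha> * mpow \<alpha> z) has_sum f z) (indices_below N)"
    using has_sum_cong_neutral[of "indices_below N'" "indices_below N" "\<lambda>\<alpha>. c \<alpha> * mpow \<alpha> z" "\<lambda>\<alpha>. c \<alpha> * mpow \<alpha> z"]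
    by blast
qed

lemma expands_on_coeff_eq:
  assumes c: "expands_on (polyradius k) N f c" and d: "expands_on (polyradius k) N' f d"
    and "\<alpha> \<in> indices_below N" "\<alpha> \<in> indices_below N'"
  shows "c \<alpha> = d \<alpha>"
proof -
  have "expands_on (polyradius k) (min N N') f c" "expands_on (polyradius k) (min N N') f d"
    using c d polyradius_pos by (auto intro: expands_on_fewer_variables)
  moreover have "\<alpha> \<in> indices_below (min N N')" using assms(3,4) by auto
  ultimately show ?thesis using expands_on_unique polyradius_pos by metis
qed

text \<open>Each multi-index takes its coefficient from some number of variables large enough for
  it; by \<open>expands_on_coeff_eq\<close> the choice does not matter, so the glued family works
  for every N.\<close>

lemma holomorphic_imp_expands:
  assumes "holomorphic_on_R k f"
  shows "\<exists>c. \<forall>N. expands_on (polyradius k) N f c"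
proof -
  have "\<forall>N. \<exists>c. expands_on (polyradius k) N f c"
    using polydisc_expansion[OF holomorphic_imp_separately_holomorphic[OF assms]] polyradius_pos by blast
  then obtain c where c: "\<And>N. expands_on (polyradius k) N f (c N)" by metis
  have "\<forall>\<alpha>. \<exists>N. \<alpha> \<in> indices_below N"
    using finite_multi_indices_below[of "{_}"] by (metis finite.emptyI finite_insert insert_subset)
  then obtain n where n: "\<And>\<alpha>. \<alpha> \<in> indices_below (n \<alpha>)" by metis
  have "expands_on (polyradius k) N f (\<lambda>\<alpha>. c (n \<alpha>) \<alpha>)" for N
    unfolding expands_on_def
  proof
    fix z assume "z \<in> open_polydisc (polyradius k) N"
    then have "((\<lambda>\<alpha>. c N \<alpha> * mpow \<alpha> z) has_sum f z) (indices_below N)"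
      using c[of N] by (simp add: expands_on_def)
    moreover have "c N \<alpha> * mpow \<alpha> z = c (n \<alpha>) \<alpha> * mpow \<alpha> z" if "\<alpha> \<in> indices_below N" for \<alpha>
      using expands_on_coeff_eq[OF c c that n] by simp
    then have "((\<lambda>\<alpha>. c N \<alpha> * mpow \<alpha> z) has_sum f z) (indices_below N) \<longleftrightarrow>
        ((\<lambda>\<alpha>. c (n \<alpha>) \<alpha> * mpow \<alpha> z) has_sum f z) (indices_below N)"
      by (rule has_sum_cong)
    ultimately show "((\<lambda>\<alpha>. c (n \<alpha>) \<alpha> * mpow \<alpha> z) has_sum f z) (indices_below N)" by blast
  qed
  then show ?thesis by blast
qed

lemma monomial_coeff_eq:
  assumes c: "\<And>N. expands_on (polyradius k) N f c"
  shows "monomial_coeff k f \<alpha> = c \<alpha>"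
  unfolding monomial_coeff_def power_series_expansion_iff
proof (rule the_equality)
  obtain N where "\<alpha> \<in> indices_below N"
    using finite_multi_indices_below[of "{\<alpha>}"] by auto
  then show "\<exists>N d. Poly_Mapping.keys \<alpha> \<subseteq> {..<N} \<and> expands_on (polyradius k) N f d \<and> d \<alpha> = c \<alpha>"
    using c by blast
  fix w assume "\<exists>N d. Poly_Mapping.keys \<alpha> \<subseteq> {..<N} \<and> expands_on (polyradius k) N f d \<and> d \<alpha> = w"
  then show "w = c \<alpha>" using expands_on_coeff_eq[OF _ c] by blast
qed

section \<open>The Hardy norm as a weighted square norm of the coefficients\<close>

definition coeff_norm :: "nat \<Rightarrow> ((nat \<Rightarrow>\<^sub>0 nat) \<Rightarrow> complex) \<Rightarrow> real" where
  "coeff_norm k c = sqrt (\<Sum>\<^sub>\<infinity>\<alpha>. (norm (c \<alpha>) / mpow \<alpha> (prime_weight k))\<^sup>2)"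

lemma torus_mean_has_sum:
  assumes f: "holomorphic_on_R k f" and c: "\<And>N. expands_on (polyradius k) N f c"
    and r: "\<And>j. j < N \<Longrightarrow> 0 < r j \<and> r j < polyradius k j"
  shows "((\<lambda>\<alpha>. (cmod (c \<alpha>) * mpow \<alpha> r)\<^sup>2) has_sum (torus_mean N r f)\<^sup>2) (indices_below N)"
proof -
  \<comment> \<open>\<open>parseval\<close> asks for nonnegative radii at all indices, while r is
    constrained only below N; zeros beyond change neither the torus points nor the monomials
    involved.\<close>
  define r' where "r' j = (if j < N then r j else 0)" for j
  have r': "\<And>j. 0 \<le> r' j" "\<And>j. j < N \<Longrightarrow> 0 \<le> r' j \<and> r' j < polyradius k j"
    using r less_imp_le by (auto simp: r'_def)
  have pt: "torus_point N r = torus_point N r'"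
    by (auto simp: torus_point_def r'_def fun_eq_iff)
  have in_disc: "torus_point N r' t \<in> open_polydisc (polyradius k) N" for t
    by (rule torus_point_in_open_polydisc) (use r' in auto)
  have cont: "continuous_on (open_polydisc (polyradius k) N) f"
    using holomorphic_imp_separately_holomorphic[OF f] by (simp add: separately_holomorphic_def)
  have "((\<lambda>\<alpha>. (cmod (c \<alpha>) * mpow \<alpha> r')\<^sup>2) has_sum
      (LINT t|torus_measure N. (cmod (f (torus_point N r' t)))\<^sup>2)) (indices_below N)"
  proof (rule parseval)
    show "(\<lambda>t. f (torus_point N r' t)) \<in> borel_measurable (torus_measure N)"
    proof (rule torus_borel_measurable)
      show "continuous_on UNIV (\<lambda>t. f (torus_point N r' t))"
        by (rule continuous_on_compose2[OF cont continuous_on_torus_point]) (use in_disc in auto)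
      show "f (torus_point N r' t) = f (torus_point N r' t')" if "\<And>j. j < N \<Longrightarrow> t j = t' j" for t t'
        using that by (simp add: torus_point_def cong: if_cong)
    qed
    show "((\<lambda>\<alpha>. c \<alpha> * mpow \<alpha> (torus_point N r' t)) has_sum f (torus_point N r' t)) (indices_below N)" for t
      using c[of N] in_disc[of t] by (simp add: expands_on_def)
  qed (rule r'(1))
  moreover have "(cmod (c \<alpha>) * mpow \<alpha> r')\<^sup>2 = (cmod (c \<alpha>) * mpow \<alpha> r)\<^sup>2" if "\<alpha> \<in> indices_below N" for \<alpha>
  proof -
    have "mpow \<alpha> r' = mpow \<alpha> r"
      by (rule mpow_cong) (use that in \<open>auto simp: r'_def\<close>)
    then show ?thesis by simp
  qed
  then have "((\<lambda>\<alpha>. (cmod (c \<alpha>) * mpow \<alpha> r')\<^sup>2) has_sum s) (indices_below N) \<longleftrightarrow>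
      ((\<lambda>\<alpha>. (cmod (c \<alpha>) * mpow \<alpha> r)\<^sup>2) has_sum s) (indices_below N)" for s
    by (rule has_sum_cong)
  moreover have "(torus_mean N r f)\<^sup>2 = (LINT t|torus_measure N. (cmod (f (torus_point N r' t)))\<^sup>2)"
    unfolding torus_mean_def pt by (rule real_sqrt_pow2) (rule Bochner_Integration.integral_nonneg, simp)
  ultimately show ?thesis by simp
qed

lemma torus_mean_nonneg: "0 \<le> torus_mean N r f"
  unfolding torus_mean_def by (intro real_sqrt_ge_zero Bochner_Integration.integral_nonneg) simp

text \<open>Monomials increase with the radii, so each Parseval term is at most its value at the
  limiting radii of the polydisc.\<close>

lemma torus_mean_le_coeff_norm:
  assumes f: "holomorphic_on_R k f" and c: "\<And>N. expands_on (polyradius k) N f c"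
    and h: "hardy_coeffs k c" and m: "m \<in> torus_means k f"
  shows "m \<le> coeff_norm k c"
proof -
  obtain N r where m: "m = torus_mean N r f"
    and r: "\<And>j. j < N \<Longrightarrow> 0 < r j \<and> r j < polyradius k j"
    using m unfolding torus_means_def polyradius_def by blast
  have "m\<^sup>2 \<le> (\<Sum>\<^sub>\<infinity>\<alpha>. (norm (c \<alpha>) / mpow \<alpha> (prime_weight k))\<^sup>2)"
  proof (rule has_sum_le_finite_sums)
    show "((\<lambda>\<alpha>. (cmod (c \<alpha>) * mpow \<alpha> r)\<^sup>2) has_sum m\<^sup>2) (indices_below N)"
      unfolding m by (rule torus_mean_has_sum[OF f c r])
    fix F assume F: "finite F" "F \<subseteq> indices_below N"
    have "(\<Sum>\<alpha>\<in>F. (cmod (c \<alpha>) * mpow \<alpha> r)\<^sup>2) \<le> (\<Sum>\<alpha>\<in>F. (norm (c \<alpha>) / mpow \<alpha> (prime_weight k))\<^sup>2)"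
    proof (rule sum_mono)
      fix \<alpha> assume "\<alpha> \<in> F"
      then have j: "j < N" if "j \<in> Poly_Mapping.keys \<alpha>" for j using F(2) that by auto
      have "0 \<le> mpow \<alpha> r" "mpow \<alpha> r \<le> mpow \<alpha> (polyradius k)"
        unfolding mpow_def using r[OF j]
        by (auto intro!: prod_nonneg prod_mono power_mono zero_le_power dest: less_imp_le)
      then have "cmod (c \<alpha>) * mpow \<alpha> r \<le> cmod (c \<alpha>) * mpow \<alpha> (polyradius k)" "0 \<le> cmod (c \<alpha>) * mpow \<alpha> r"
        by (auto intro: mult_left_mono)
      then show "(cmod (c \<alpha>) * mpow \<alpha> r)\<^sup>2 \<le> (norm (c \<alpha>) / mpow \<alpha> (prime_weight k))\<^sup>2"
        unfolding mpow_polyradius by (intro power_mono) auto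
    qed
    also have "\<dots> \<le> (\<Sum>\<^sub>\<infinity>\<alpha>. (norm (c \<alpha>) / mpow \<alpha> (prime_weight k))\<^sup>2)"
      using h F by (intro finite_sum_le_infsum) (auto simp: hardy_coeffs_def)
    finally show "(\<Sum>\<alpha>\<in>F. (cmod (c \<alpha>) * mpow \<alpha> r)\<^sup>2) \<le> (\<Sum>\<^sub>\<infinity>\<alpha>. (norm (c \<alpha>) / mpow \<alpha> (prime_weight k))\<^sup>2)" .
  qed
  then show ?thesis unfolding coeff_norm_def by (rule real_le_rsqrt)
qed

lemma torus_mean_in_torus_means:
  assumes "0 < \<theta>" "\<theta> < 1" "1 \<le> N"
  shows "torus_mean N (\<lambda>j. \<theta> * polyradius k j) f \<in> torus_means k f"
proof -
  have "0 < \<theta> * polyradius k j \<and> \<theta> * polyradius k j < 1 / prime_weight k j" for j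
    using assms polyradius_pos[of k j] by (simp add: polyradius_def [symmetric])
  then show ?thesis using assms(3) unfolding torus_means_def by blast
qed

text \<open>The limiting radii are not admissible, so radii scaled by \<theta> < 1 are used. For a
  fixed finite F the Parseval sum is a polynomial in \<theta>, and its bound passes to the limit at
  1; only afterwards does F vary. Summability of the coefficients comes out of the same
  estimate.\<close>

lemma coeff_norm_le_H2_norm:
  assumes f: "holomorphic_on_R k f" and c: "\<And>N. expands_on (polyradius k) N f c"
    and bdd: "bdd_above (torus_means k f)"
  shows "hardy_coeffs k c" "coeff_norm k c \<le> H2_norm k f"
proof -
  have up: "m \<le> H2_norm k f" if "m \<in> torus_means k f" for m
    unfolding H2_norm_def using that bdd by (rule cSup_upper)
  have H0: "0 \<le> H2_norm k f"
    using up[OF torus_mean_in_torus_means[of "1/2" 1]] torus_mean_nonneg[of 1 _ f] by (force intro: order_trans)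
  have fin: "(\<Sum>\<alpha>\<in>F. norm ((norm (c \<alpha>) / mpow \<alpha> (prime_weight k))\<^sup>2)) \<le> (H2_norm k f)\<^sup>2"
    if F: "finite F" for F
  proof -
    obtain N where N: "N \<ge> 1" "F \<subseteq> indices_below N"
      using finite_multi_indices_below[OF F] by blast
    have "((\<lambda>\<theta>. \<Sum>\<alpha>\<in>F. (cmod (c \<alpha>) * mpow \<alpha> (\<lambda>j. \<theta> * polyradius k j))\<^sup>2) \<longlongrightarrow>
        (\<Sum>\<alpha>\<in>F. (cmod (c \<alpha>) * mpow \<alpha> (\<lambda>j. 1 * polyradius k j))\<^sup>2)) (at_left 1)"
      unfolding mpow_def by (intro tendsto_intros)
    moreover have "eventually (\<lambda>\<theta>. (\<Sum>\<alpha>\<in>F. (cmod (c \<alpha>) * mpow \<alpha> (\<lambda>j. \<theta> * polyradius k j))\<^sup>2) \<le>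
        (H2_norm k f)\<^sup>2) (at_left 1)"
    proof -
      have "eventually (\<lambda>\<theta>::real. \<theta> \<in> {0<..<1}) (at_left 1)"
        by (rule eventually_at_left_real) simp
      then show ?thesis
      proof eventually_elim
        case (elim \<theta>)
        then have \<theta>: "0 < \<theta>" "\<theta> < 1" by auto
        have r: "0 < \<theta> * polyradius k j \<and> \<theta> * polyradius k j < polyradius k j" for j
          using \<theta> polyradius_pos[of k j] by simp
        have "(\<Sum>\<alpha>\<in>F. (cmod (c \<alpha>) * mpow \<alpha> (\<lambda>j. \<theta> * polyradius k j))\<^sup>2) \<le>
            (torus_mean N (\<lambda>j. \<theta> * polyradius k j) f)\<^sup>2"
          by (rule finite_sum_le_has_sum[OF torus_mean_has_sum[OF f c r] F N(2)]) simp
        also have "\<dots> \<le> (H2_norm k f)\<^sup>2"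
          using up[OF torus_mean_in_torus_means[OF \<theta> N(1)]] torus_mean_nonneg by (rule power_mono)
        finally show ?case .
      qed
    qed
    ultimately have "(\<Sum>\<alpha>\<in>F. (cmod (c \<alpha>) * mpow \<alpha> (\<lambda>j. 1 * polyradius k j))\<^sup>2) \<le> (H2_norm k f)\<^sup>2"
      by (rule tendsto_upperbound) simp
    then show ?thesis by (simp add: mpow_polyradius)
  qed
  show h: "hardy_coeffs k c"
    using bounded_finite_sums(1)[of UNIV, OF fin] by (simp add: hardy_coeffs_def)
  have "(\<Sum>\<^sub>\<infinity>\<alpha>. (norm (c \<alpha>) / mpow \<alpha> (prime_weight k))\<^sup>2) \<le> (H2_norm k f)\<^sup>2"
    using h fin unfolding hardy_coeffs_def by (intro infsum_le_finite_sums) auto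
  then show "coeff_norm k c \<le> H2_norm k f"
    unfolding coeff_norm_def using H0 by (intro real_le_lsqrt) auto
qed

lemma H2_norm_eq:
  assumes f: "holomorphic_on_R k f" and c: "\<And>N. expands_on (polyradius k) N f c"
    and h: "hardy_coeffs k c"
  shows "bdd_above (torus_means k f)" "H2_norm k f = coeff_norm k c"
proof -
  note le = torus_mean_le_coeff_norm[OF f c h]
  show bdd: "bdd_above (torus_means k f)" using le by (rule bdd_aboveI)
  \<comment> \<open>The mean in one variable at half the radius shows that the set under the
    supremum is nonempty.\<close>
  have "H2_norm k f \<le> coeff_norm k c"
    unfolding H2_norm_def using torus_mean_in_torus_means[of "1/2" 1 k f] le by (intro cSup_least) auto
  then show "H2_norm k f = coeff_norm k c"
    using coeff_norm_le_H2_norm(2)[OF f c bdd] by simp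
qed

section \<open>The Bohr transform\<close>

lemma truncation_tendsto:
  assumes "z \<in> ell2 k"
  shows "(\<lambda>j. (if j < N then z j else 0) - z j) \<in> ell2 k"
    and "(\<lambda>N. ell2_norm k (\<lambda>j. (if j < N then z j else 0) - z j)) \<longlonglongrightarrow> 0"
proof -
  define a where "a j = (cmod (z j) * prime_weight k j)\<^sup>2" for j
  have a: "summable a" using assms by (simp add: ell2_iff a_def [abs_def])
  have eq: "(cmod ((if j < N then z j else 0) - z j) * prime_weight k j)\<^sup>2 = a j - (if j \<in> {..<N} then a j else 0)" for j N
    by (simp add: a_def)
  have sums: "(\<lambda>j. a j - (if j \<in> {..<N} then a j else 0)) sums (suminf a - sum a {..<N})" for N
    by (intro sums_diff sums_If_finite_set summable_sums a) simp
  show mem: "(\<lambda>j. (if j < N then z j else 0) - z j) \<in> ell2 k" for N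
    unfolding ell2_iff eq using sums by (simp add: sums_iff)
  have "ell2_norm k (\<lambda>j. (if j < N then z j else 0) - z j) = sqrt (suminf a - sum a {..<N})" for N
  proof -
    have "(ell2_norm k (\<lambda>j. (if j < N then z j else 0) - z j))\<^sup>2 = suminf a - sum a {..<N}"
      unfolding ell2_norm_sq[OF mem] eq using sums[of N] by (simp add: sums_iff)
    then show ?thesis using ell2_norm_nonneg[OF mem[of N]] by (metis real_sqrt_unique)
  qed
  moreover have "(\<lambda>N. sqrt (suminf a - sum a {..<N})) \<longlonglongrightarrow> sqrt (suminf a - suminf a)"
    by (intro tendsto_intros summable_LIMSEQ a)
  ultimately show "(\<lambda>N. ell2_norm k (\<lambda>j. (if j < N then z j else 0) - z j)) \<longlonglongrightarrow> 0"
    by simp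
qed

lemma truncation_in_open_polydisc:
  assumes "z \<in> R_dom k"
  shows "(\<lambda>j. if j < N then z j else 0) \<in> open_polydisc (polyradius k) N"
proof -
  obtain s where "s < 1" "\<And>j. cmod (z j) * prime_weight k j \<le> s"
    using assms unfolding R_dom_iff by blast
  then have "cmod (z j) < polyradius k j" for j
    unfolding less_polyradius_iff using le_less_trans by blast
  then show ?thesis by (simp add: open_polydisc_def)
qed

text \<open>Truncations converge in the norm of \<open>ell2 k\<close>, and differentiability gives
  continuity in exactly that norm; polydisc expansions thus determine f on all of
  \<open>R_dom k\<close>.\<close>

lemma holomorphic_limit_of_truncations:
  assumes "holomorphic_on_R k f" "z \<in> R_dom k"
  shows "(\<lambda>N. f (\<lambda>j. if j < N then z j else 0)) \<longlonglongrightarrow> f z"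
proof (rule tendstoI)
  fix \<epsilon> :: real assume "0 < \<epsilon>"
  then obtain \<delta> where \<delta>: "\<delta> > 0" "\<And>h. h \<in> ell2 k \<Longrightarrow> (\<lambda>j. z j + h j) \<in> R_dom k \<Longrightarrow>
      ell2_norm k h < \<delta> \<Longrightarrow> cmod (f (\<lambda>j. z j + h j) - f z) < \<epsilon>"
    using frechet_differentiable_imp_continuous[of k f z \<epsilon>] assms unfolding holomorphic_on_R_def by blast
  have z2: "z \<in> ell2 k" using assms(2) by (simp add: R_dom_iff)
  have "eventually (\<lambda>N. ell2_norm k (\<lambda>j. (if j < N then z j else 0) - z j) < \<delta>) sequentially"
    using truncation_tendsto(2)[OF z2] \<delta>(1) by (rule order_tendstoD(2))
  then show "eventually (\<lambda>N. dist (f (\<lambda>j. if j < N then z j else 0)) (f z) < \<epsilon>) sequentially"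
  proof eventually_elim
    case (elim N)
    have shift: "(\<lambda>j. z j + ((if j < N then z j else 0) - z j)) = (\<lambda>j. if j < N then z j else 0)"
      by simp
    have "(\<lambda>j. if j < N then z j else 0) \<in> R_dom k"
      using truncation_in_open_polydisc[OF assms(2)] open_polydisc_in_R_dom by blast
    then show ?case
      using \<delta>(2)[OF truncation_tendsto(1)[OF z2], of N] elim unfolding shift dist_norm by simp
  qed
qed

lemma holomorphic_eqI:
  assumes "holomorphic_on_R k f" "holomorphic_on_R k g" "z \<in> R_dom k"
    and "\<And>N w. w \<in> open_polydisc (polyradius k) N \<Longrightarrow> f w = g w"
  shows "f z = g z"
proof -
  have "(\<lambda>N. f (\<lambda>j. if j < N then z j else 0)) = (\<lambda>N. g (\<lambda>j. if j < N then z j else 0))"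
    using truncation_in_open_polydisc[OF assms(3)] assms(4) by blast
  with holomorphic_limit_of_truncations[OF assms(1,3)]
  have "(\<lambda>N. g (\<lambda>j. if j < N then z j else 0)) \<longlonglongrightarrow> f z" by simp
  then show ?thesis
    using holomorphic_limit_of_truncations[OF assms(2,3)] by (rule LIMSEQ_unique)
qed

lemma power_series_expands:
  assumes c: "hardy_coeffs k c" and f: "\<And>w. w \<in> R_dom k \<Longrightarrow> f w = power_series c w"
  shows "holomorphic_on_R k f" "expands_on (polyradius k) N f c"
proof -
  show "holomorphic_on_R k f"
    unfolding holomorphic_on_R_def using power_series_frechet_differentiable[OF c _ f] by blast
  show "expands_on (polyradius k) N f c"
    unfolding expands_on_def
  proof
    fix z assume z: "z \<in> open_polydisc (polyradius k) N"
    then have R: "z \<in> R_dom k" using open_polydisc_in_R_dom by blast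
    have "((\<lambda>\<alpha>. c \<alpha> * mpow \<alpha> z) has_sum f z) UNIV"
      using power_series_has_sum[OF c R] f[OF R] by simp
    moreover have "c \<alpha> * mpow \<alpha> z = 0" if "\<alpha> \<notin> indices_below N" for \<alpha>
      using mpow_eq_0[OF that, of z] z by (simp add: open_polydisc_def)
    ultimately show "((\<lambda>\<alpha>. c \<alpha> * mpow \<alpha> z) has_sum f z) (indices_below N)"
      using has_sum_cong_neutral[of UNIV "indices_below N" "\<lambda>\<alpha>. c \<alpha> * mpow \<alpha> z" "\<lambda>\<alpha>. c \<alpha> * mpow \<alpha> z"]
      by blast
  qed
qed

section \<open>Dirichlet coefficients as monomial coefficients\<close>

definition dirichlet_coeffs :: "(nat \<Rightarrow> complex) \<Rightarrow> (nat \<Rightarrow>\<^sub>0 nat) \<Rightarrow> complex" where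
  "dirichlet_coeffs a \<alpha> = a (prime_power \<alpha>)"

text \<open>Reindexing along \<open>bij_prime_power\<close>, which reaches every integer except 0;
  there the normalisation a 0 = 0 applies.\<close>

lemma has_sum_dirichlet_coeffs:
  assumes "a 0 = 0"
  shows "((\<lambda>\<alpha>. (norm (dirichlet_coeffs a \<alpha>) / mpow \<alpha> (prime_weight k))\<^sup>2) has_sum s) UNIV \<longleftrightarrow>
    ((\<lambda>n. (cmod (a n))\<^sup>2 * real n powr (- 2 / real k)) has_sum s) UNIV"
proof -
  have "(norm (dirichlet_coeffs a \<alpha>) / mpow \<alpha> (prime_weight k))\<^sup>2 =
      (cmod (a (prime_power \<alpha>)))\<^sup>2 * real (prime_power \<alpha>) powr (- 2 / real k)" for \<alpha>
    unfolding dirichlet_coeffs_def power_divide mpow_prime_weight_sq by (simp add: divide_inverse)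
  then have "((\<lambda>\<alpha>. (norm (dirichlet_coeffs a \<alpha>) / mpow \<alpha> (prime_weight k))\<^sup>2) has_sum s) UNIV \<longleftrightarrow>
      ((\<lambda>\<alpha>. (cmod (a (prime_power \<alpha>)))\<^sup>2 * real (prime_power \<alpha>) powr (- 2 / real k)) has_sum s) UNIV"
    by presburger
  also have "\<dots> \<longleftrightarrow> ((\<lambda>n. (cmod (a n))\<^sup>2 * real n powr (- 2 / real k)) has_sum s) {0<..}"
    by (rule has_sum_reindex_bij_betw[OF bij_prime_power])
  also have "\<dots> \<longleftrightarrow> ((\<lambda>n. (cmod (a n))\<^sup>2 * real n powr (- 2 / real k)) has_sum s) UNIV"
    using assms by (intro has_sum_cong_neutral) auto
  finally show ?thesis .
qed

lemma hardy_dirichlet_coeffs_iff: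
  assumes "a 0 = 0"
  shows "hardy_coeffs k (dirichlet_coeffs a) \<longleftrightarrow>
    summable (\<lambda>n. (cmod (a n))\<^sup>2 * real n powr (- 2 / real k))"
  unfolding hardy_coeffs_def summable_on_def has_sum_dirichlet_coeffs[of a, OF assms]
  unfolding summable_on_def [symmetric] by (rule summable_on_UNIV_nonneg_real_iff) simp

lemma H_plus_iff: "a \<in> H_plus \<longleftrightarrow> a 0 = 0 \<and> (\<forall>k\<ge>1. hardy_coeffs k (dirichlet_coeffs a))"
  unfolding H_plus_def using hardy_dirichlet_coeffs_iff by auto

lemma H_plusD: "a \<in> H_plus \<Longrightarrow> 1 \<le> k \<Longrightarrow> hardy_coeffs k (dirichlet_coeffs a)"
  by (simp add: H_plus_iff)

lemma dirichlet_norm_eq: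
  assumes "a 0 = 0" "hardy_coeffs k (dirichlet_coeffs a)"
  shows "dirichlet_norm k a = coeff_norm k (dirichlet_coeffs a)"
proof -
  have "((\<lambda>n. (cmod (a n))\<^sup>2 * real n powr (- 2 / real k)) has_sum
      (\<Sum>\<^sub>\<infinity>\<alpha>. (norm (dirichlet_coeffs a \<alpha>) / mpow \<alpha> (prime_weight k))\<^sup>2)) UNIV"
    using assms(2) unfolding has_sum_dirichlet_coeffs[of a, OF assms(1), symmetric]
    by (simp add: hardy_coeffs_def)
  from has_sum_imp_sums[OF this] show ?thesis
    unfolding dirichlet_norm_def coeff_norm_def by (simp add: sums_iff)
qed

lemma H_plus_diff:
  assumes "a \<in> H_plus" "b \<in> H_plus"
  shows "(\<lambda>n. a n - b n) \<in> H_plus"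
  unfolding H_plus_def
proof (intro CollectI conjI allI impI)
  show "a 0 - b 0 = 0" using assms by (simp add: H_plus_def)
  fix k :: nat assume k: "1 \<le> k"
  let ?w = "\<lambda>n. real n powr (- 2 / real k)"
  have sum: "summable (\<lambda>n. (cmod (a n))\<^sup>2 * ?w n)" "summable (\<lambda>n. (cmod (b n))\<^sup>2 * ?w n)"
    using assms k by (auto simp: H_plus_def)
  have s: "summable (\<lambda>n. 2 * ((cmod (a n))\<^sup>2 * ?w n) + 2 * ((cmod (b n))\<^sup>2 * ?w n))"
    using summable_add[OF summable_mult[OF sum(1), of 2] summable_mult[OF sum(2), of 2]] .
  show "summable (\<lambda>n. (cmod (a n - b n))\<^sup>2 * ?w n)"
  proof (rule summable_comparison_test'[OF s])
    fix n
    have "(cmod (a n - b n))\<^sup>2 \<le> (cmod (a n) + cmod (b n))\<^sup>2"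
      by (intro power_mono norm_triangle_ineq4) simp
    also have "\<dots> \<le> 2 * (cmod (a n))\<^sup>2 + 2 * (cmod (b n))\<^sup>2"
      using sum_squares_bound[of "cmod (a n)" "cmod (b n)"] by (simp add: power2_sum)
    finally have "(cmod (a n - b n))\<^sup>2 * ?w n \<le> (2 * (cmod (a n))\<^sup>2 + 2 * (cmod (b n))\<^sup>2) * ?w n"
      by (rule mult_right_mono) simp
    then show "norm ((cmod (a n - b n))\<^sup>2 * ?w n) \<le> 2 * ((cmod (a n))\<^sup>2 * ?w n) + 2 * ((cmod (b n))\<^sup>2 * ?w n)"
      by (simp add: distrib_right)
  qed
qed

text \<open>A single series on the union instead of one function for each k, so compatibility under
  restriction holds by construction.\<close>

definition bohr_transform :: "(nat \<Rightarrow> complex) \<Rightarrow> (nat \<Rightarrow> complex) \<Rightarrow> complex" where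
  "bohr_transform a = restrict (power_series (dirichlet_coeffs a)) R_union"

lemma R_dom_subset_R_union: "1 \<le> k \<Longrightarrow> R_dom k \<subseteq> R_union"
  by (auto simp: R_union_def)

lemma bohr_transform_has_sum:
  assumes a: "a \<in> H_plus" and z: "z \<in> R_union"
  shows "((\<lambda>\<alpha>. a (prime_power \<alpha>) * mpow \<alpha> z) has_sum bohr_transform a z) UNIV"
proof -
  obtain k where "1 \<le> k" "z \<in> R_dom k" using z by (auto simp: R_union_def)
  then show ?thesis
    using power_series_has_sum[OF H_plusD[OF a]] z by (simp add: bohr_transform_def dirichlet_coeffs_def)
qed

lemma bohr_transform_add:
  assumes "a \<in> H_plus" "b \<in> H_plus" "z \<in> R_union"
  shows "bohr_transform (\<lambda>n. a n + b n) z = bohr_transform a z + bohr_transform b z"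
  using infsumI[OF has_sum_add[OF bohr_transform_has_sum[OF assms(1,3)] bohr_transform_has_sum[OF assms(2,3)]]] assms(3)
  by (simp add: bohr_transform_def power_series_def dirichlet_coeffs_def distrib_right)

lemma bohr_transform_cmult:
  assumes "a \<in> H_plus" "z \<in> R_union"
  shows "bohr_transform (\<lambda>n. c * a n) z = c * bohr_transform a z"
  using infsumI[OF has_sum_cmult_right[OF bohr_transform_has_sum[OF assms], of c]] assms(2)
  by (simp add: bohr_transform_def power_series_def dirichlet_coeffs_def mult.assoc)

lemma bohr_transform_diff:
  assumes "a \<in> H_plus" "b \<in> H_plus" "z \<in> R_union"
  shows "bohr_transform (\<lambda>n. a n - b n) z = bohr_transform a z - bohr_transform b z"
  using bohr_transform_add[OF H_plus_diff[OF assms(1,2)] assms(2,3)] by simp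

lemma restrict_bohr_transform:
  assumes a: "a \<in> H_plus" and k: "1 \<le> k"
  shows "holomorphic_on_R k (restrict (bohr_transform a) (R_dom k))"
    and "expands_on (polyradius k) N (restrict (bohr_transform a) (R_dom k)) (dirichlet_coeffs a)"
  using R_dom_subset_R_union[OF k]
  by (auto intro!: power_series_expands[OF H_plusD[OF a k]] simp: bohr_transform_def)

lemma H2_norm_bohr_transform:
  assumes a: "a \<in> H_plus" and k: "1 \<le> k"
  shows "bdd_above (torus_means k (restrict (bohr_transform a) (R_dom k)))"
    and "H2_norm k (restrict (bohr_transform a) (R_dom k)) = dirichlet_norm k a"
  using H2_norm_eq[OF restrict_bohr_transform[OF a k] H_plusD[OF a k]]
    dirichlet_norm_eq[OF _ H_plusD[OF a k]] a by (auto simp: H_plus_def)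

lemma bohr_transform_in_H2_limit: "a \<in> H_plus \<Longrightarrow> bohr_transform a \<in> H2_limit"
  unfolding H2_limit_def H2_def
  by (auto intro: restrict_bohr_transform(1) H2_norm_bohr_transform(1)) (simp add: bohr_transform_def)

lemma monomial_coeff_bohr_transform:
  assumes "a \<in> H_plus" "1 \<le> k"
  shows "monomial_coeff k (restrict (bohr_transform a) (R_dom k)) \<alpha> = a (prime_power \<alpha>)"
  using monomial_coeff_eq[OF restrict_bohr_transform(2)[OF assms]] by (simp add: dirichlet_coeffs_def)

lemma H_plus_eqI:
  assumes "a \<in> H_plus" "b \<in> H_plus" "\<And>\<alpha>. a (prime_power \<alpha>) = b (prime_power \<alpha>)"
  shows "a = b"
proof
  fix n
  show "a n = b n"
  proof (cases "n = 0")
    case False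
    then have "n \<in> prime_power ` UNIV" using bij_prime_power by (simp add: bij_betw_def)
    then show ?thesis using assms(3) by auto
  qed (use assms(1,2) in \<open>simp add: H_plus_def\<close>)
qed

text \<open>The coefficients found on the smallest domain serve for every k, so finiteness of each
  Hardy norm puts one and the same sequence into every weighted space, that is, into
  \<open>H_plus\<close>. Its transform has the expansions of f on all polydiscs and hence equals
  f.\<close>

lemma bohr_transform_surj:
  assumes f: "f \<in> H2_limit"
  shows "\<exists>a\<in>H_plus. bohr_transform a = f"
proof -
  let ?F = "\<lambda>k. restrict f (R_dom k)"
  have hol: "holomorphic_on_R k (?F k)" and bdd: "bdd_above (torus_means k (?F k))" if "1 \<le> k" for k
    using f that by (auto simp: H2_limit_def H2_def)
  obtain c where c: "\<And>N. expands_on (polyradius 1) N (?F 1) c"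
    using holomorphic_imp_expands[OF hol[of 1]] by auto
  have ck: "expands_on (polyradius k) N (?F k) c" if k: "1 \<le> k" for k N
  proof -
    obtain d where d: "\<And>N. expands_on (polyradius k) N (?F k) d"
      using holomorphic_imp_expands[OF hol[OF k]] by auto
    \<comment> \<open>The polydisc for 1 lies in the polydisc for k, where both restrictions are f;
      the expansion found for k is therefore valid on it.\<close>
    have d1: "expands_on (polyradius 1) N (?F 1) d" for N
      unfolding expands_on_def
    proof
      fix z assume z: "z \<in> open_polydisc (polyradius 1) N"
      then have zk: "z \<in> open_polydisc (polyradius k) N"
        using polyradius_mono[OF k] by (force simp: open_polydisc_def intro: less_le_trans)
      then have eq: "?F k z = ?F 1 z"
        using z open_polydisc_in_R_dom by (metis restrict_apply' subsetD)
      show "((\<lambda>\<alpha>. d \<alpha> * mpow \<alpha> z) has_sum ?F 1 z) (indices_below N)"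
        using d[of N] zk unfolding expands_on_def eq [symmetric] by blast
    qed
    have "c \<alpha> = d \<alpha>" for \<alpha>
      using monomial_coeff_eq[OF c, of \<alpha>] monomial_coeff_eq[OF d1, of \<alpha>] by simp
    then have "c = d" by blast
    then show ?thesis using d by simp
  qed
  \<comment> \<open>The value at 0 is the normalisation of \<open>H_plus\<close>; every other index
    has a unique factorisation.\<close>
  define a where "a n = (if n = 0 then 0 else c (inv prime_power n))" for n
  have inj: "inj prime_power" using bij_prime_power by (simp add: bij_betw_def)
  have coeffs: "dirichlet_coeffs a = c"
  proof
    show "dirichlet_coeffs a \<alpha> = c \<alpha>" for \<alpha>
      using prime_power_pos [of \<alpha>] by (simp add: dirichlet_coeffs_def a_def inv_f_f [OF inj])
  qed
  have a: "a \<in> H_plus"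
    unfolding H_plus_iff coeffs using coeff_norm_le_H2_norm(1)[OF hol ck bdd] by (simp add: a_def)
  have "bohr_transform a z = f z" for z
  proof (cases "z \<in> R_union")
    case True
    then obtain k where k: "1 \<le> k" "z \<in> R_dom k" by (auto simp: R_union_def)
    have "restrict (bohr_transform a) (R_dom k) z = ?F k z"
    proof (rule holomorphic_eqI[OF restrict_bohr_transform(1)[OF a k(1)] hol[OF k(1)] k(2)])
      fix N w assume w: "w \<in> open_polydisc (polyradius k) N"
      show "restrict (bohr_transform a) (R_dom k) w = ?F k w"
        using restrict_bohr_transform(2)[OF a k(1), of N] ck[OF k(1), of N] w has_sum_unique
        unfolding expands_on_def coeffs by blast
    qed
    then show ?thesis using k(2) by simp
  next
    case False
    then show ?thesis using f by (simp add: bohr_transform_def H2_limit_def extensional_def)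
  qed
  then show ?thesis using a by blast
qed

section \<open>Bijectivity and homeomorphism\<close>

lemma bij_bohr_transform: "bij_betw bohr_transform H_plus H2_limit"
proof (rule bij_betw_imageI)
  show "inj_on bohr_transform H_plus"
    using monomial_coeff_bohr_transform[of _ 1] by (intro inj_onI H_plus_eqI) (auto, metis order_refl)
  show "bohr_transform ` H_plus = H2_limit"
    using bohr_transform_in_H2_limit bohr_transform_surj by blast
qed

text \<open>Continuity need only be checked on the generating balls, and the preimage of a ball
  around \<Phi> e is the ball around e with the same radius. Stated for a general \<Phi> so that it
  serves the transform and its inverse alike.\<close>

lemma continuous_map_seminorm_topology:
  assumes \<Phi>: "\<Phi> ` V = W" and T: "topspace (seminorm_topology V p) = V"
    and iso: "\<And>k f g. 1 \<le> k \<Longrightarrow> f \<in> V \<Longrightarrow> g \<in> V \<Longrightarrow>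
      q k (\<lambda>x. \<Phi> g x - \<Phi> f x) = p k (\<lambda>x. g x - f x)"
    and W: "topspace (seminorm_topology W q) = W"
  shows "continuous_map (seminorm_topology V p) (seminorm_topology W q) \<Phi>"
  unfolding seminorm_topology_def [of W]
proof (rule continuous_on_generated_topo)
  let ?B = "{{g \<in> W. q k (\<lambda>x. g x - f x) < \<epsilon>} | k f \<epsilon>. 1 \<le> k \<and> f \<in> W \<and> 0 < \<epsilon>}"
  show "\<Phi> ` topspace (seminorm_topology V p) \<subseteq> \<Union>?B"
    using \<Phi> T W unfolding seminorm_topology_def [of W] topology_generated_by_topspace by simp
  fix U assume "U \<in> ?B"
  then obtain k f \<epsilon> where U: "U = {g \<in> W. q k (\<lambda>x. g x - f x) < \<epsilon>}" and k: "1 \<le> k" "f \<in> W" "0 < \<epsilon>"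
    by blast
  obtain e where e: "e \<in> V" "f = \<Phi> e" using k(2) \<Phi> by blast
  have "\<Phi> -` U \<inter> topspace (seminorm_topology V p) = {g \<in> V. p k (\<lambda>x. g x - e x) < \<epsilon>}"
  proof -
    have "\<Phi> g \<in> W" if "g \<in> V" for g using \<Phi> that by blast
    then show ?thesis
      unfolding T U e(2) using iso[OF k(1) e(1)] by auto
  qed
  moreover have "openin (seminorm_topology V p) {g \<in> V. p k (\<lambda>x. g x - e x) < \<epsilon>}"
    unfolding seminorm_topology_def by (rule topology_generated_by_Basis) (use k e in blast)
  ultimately show "openin (seminorm_topology V p) (\<Phi> -` U \<inter> topspace (seminorm_topology V p))"
    by simp
qed

lemma homeomorphic_map_bohr_transform: "homeomorphic_map H_plus_topology H2_limit_topology bohr_transform"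
proof -
  let ?inv = "inv_into H_plus bohr_transform"
  note bij = bij_bohr_transform
  \<comment> \<open>Outside \<open>R_union\<close> both transforms equal \<open>undefined\<close>,
    and their difference need not; the comparison is therefore made after restriction to
    \<open>R_dom k\<close>.\<close>
  have iso: "H2_norm k (restrict (\<lambda>x. bohr_transform g x - bohr_transform f x) (R_dom k)) =
      dirichlet_norm k (\<lambda>x. g x - f x)" if "1 \<le> k" "f \<in> H_plus" "g \<in> H_plus" for k f g
  proof -
    have "restrict (\<lambda>x. bohr_transform g x - bohr_transform f x) (R_dom k) =
        restrict (bohr_transform (\<lambda>x. g x - f x)) (R_dom k)"
      using R_dom_subset_R_union[OF that(1)] bohr_transform_diff[OF that(3,2)] by (intro restrict_ext) auto
    then show ?thesis using H2_norm_bohr_transform(2)[OF H_plus_diff[OF that(3,2)] that(1)] by simp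
  qed
  have inv: "?inv f \<in> H_plus" "bohr_transform (?inv f) = f" if "f \<in> H2_limit" for f
    using bij that by (auto simp: bij_betw_def inv_into_into f_inv_into_f)
  have "continuous_map H_plus_topology H2_limit_topology bohr_transform"
    unfolding H_plus_topology_def H2_limit_topology_def
    using bij iso topspace_H_plus_topology topspace_H2_limit_topology
    unfolding H_plus_topology_def H2_limit_topology_def
    by (intro continuous_map_seminorm_topology) (auto simp: bij_betw_def)
  moreover have "continuous_map H2_limit_topology H_plus_topology ?inv"
    unfolding H_plus_topology_def H2_limit_topology_def
  proof (rule continuous_map_seminorm_topology)
    show "?inv ` H2_limit = H_plus"
      using bij_betw_inv_into[OF bij] by (simp add: bij_betw_def)
    show "dirichlet_norm k (\<lambda>x. ?inv g x - ?inv f x) = H2_norm k (restrict (\<lambda>x. g x - f x) (R_dom k))"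
      if "1 \<le> k" "f \<in> H2_limit" "g \<in> H2_limit" for k f g
      using iso[OF that(1) inv(1)[OF that(2)] inv(1)[OF that(3)]] inv(2) that by simp
  qed (use topspace_H_plus_topology topspace_H2_limit_topology in
      \<open>simp_all add: H_plus_topology_def H2_limit_topology_def\<close>)
  ultimately have "homeomorphic_maps H_plus_topology H2_limit_topology bohr_transform ?inv"
    unfolding homeomorphic_maps_def topspace_H_plus_topology topspace_H2_limit_topology
    using inv(2) bij by (auto simp: bij_betw_def)
  then show ?thesis by (rule homeomorphic_maps_imp_map)
qed

theorem corollary3p6:
  shows "\<exists>\<Phi> :: (nat \<Rightarrow> complex) \<Rightarrow> ((nat \<Rightarrow> complex) \<Rightarrow> complex).
    homeomorphic_map H_plus_topology H2_limit_topology \<Phi> \<and>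
    (\<forall>a\<in>H_plus. \<forall>b\<in>H_plus. \<forall>z\<in>R_union. \<Phi> (\<lambda>n. a n + b n) z = \<Phi> a z + \<Phi> b z) \<and>
    (\<forall>c. \<forall>a\<in>H_plus. \<forall>z\<in>R_union. \<Phi> (\<lambda>n. c * a n) z = c * \<Phi> a z) \<and>
    (\<forall>a\<in>H_plus. \<forall>f\<in>H2_limit. \<forall>k\<ge>1.
       \<Phi> a = f \<longleftrightarrow>
       (\<forall>\<alpha>. monomial_coeff k (restrict f (R_dom k)) \<alpha> = a (prime_power \<alpha>)))"
proof (intro exI[of _ bohr_transform] conjI ballI allI impI)
  show "homeomorphic_map H_plus_topology H2_limit_topology bohr_transform"
    by (rule homeomorphic_map_bohr_transform)
  show "bohr_transform (\<lambda>n. a n + b n) z = bohr_transform a z + bohr_transform b z"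
    if "a \<in> H_plus" "b \<in> H_plus" "z \<in> R_union" for a b z
    using that by (rule bohr_transform_add)
  show "bohr_transform (\<lambda>n. c * a n) z = c * bohr_transform a z"
    if "a \<in> H_plus" "z \<in> R_union" for c a z
    using that by (rule bohr_transform_cmult)
  fix a f and k :: nat assume a: "a \<in> H_plus" and f: "f \<in> H2_limit" and k: "1 \<le> k"
  \<comment> \<open>Writing f as a transform reduces the criterion to equality of a and b, which the
    coefficients at any one k already decide.\<close>
  obtain b where b: "b \<in> H_plus" "bohr_transform b = f"
    using bohr_transform_surj[OF f] by blast
  have "monomial_coeff k (restrict f (R_dom k)) \<alpha> = b (prime_power \<alpha>)" for \<alpha>
    using monomial_coeff_bohr_transform[OF b(1) k] b(2) by simp
  moreover have "bohr_transform a = f \<longleftrightarrow> a = b"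
    using bij_bohr_transform a b by (auto simp: bij_betw_def dest: inj_onD)
  ultimately show "bohr_transform a = f \<longleftrightarrow>
      (\<forall>\<alpha>. monomial_coeff k (restrict f (R_dom k)) \<alpha> = a (prime_power \<alpha>))"
    using H_plus_eqI[OF a b(1)] by metis
qed

end
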